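(* Let $k \ge 1$ be an integer, let $t=t(n)$ and $b=b(n)$, and let $b^* = b^*(n,t,k) = \max\{n^{4k-1}/t^{3k-1},\; n/\sqrt{t}\}$. If $t = \omega\big(n^{\frac{4k-1}{3k}}\big)$ and $b = \omega(b^* )$, then there exists a $(t,b)$-strategy $B$ of Builder such that $$\lim_{n\to\infty} \Pr\big(T_k \subseteq B_t\big) = 1,$$ and if $t = o\big(n^{\frac{4k-1}{3k}}\big)$ or $b = o(b^* )$, then for any $(t,b)$-strategy $B$ of Builder, $$\lim_{n\to\infty} \Pr\big(T_k \subseteq B_t\big) = 0.$$
   Context: Random graph process with restricted budget: the $N=\binom{n}{2}$ edges of the complete graph $K_n$ on vertex set $[n]$ are put in a uniformly random order $e_1,\dots,e_N$ and revealed one at a time; $G_s$ denotes the graph with edges $e_1,\dots,e_s$. A $(t,b)$-strategy of Builder is an online (deterministic or randomized) rule that, for each $1\le s\le t$, upon seeing $e_s$ and knowing her previous choices, decides irrevocably whether to purchase $e_s$, subject to purchasing at most $b$ edges in total; only the first $t$ edges are revealed. $B_s$ denotes the spanning subgraph of $G_s$ consisting of the edges Builder purchased up to time $s$. $T_k$ denotes the graph consisting of $k$ triangles that pairwise intersect in exactly one common vertex (so $T_1$ is a triangle). Asymptotic notation is as $n\to\infty$; $f=\omega(g)$ means $f/g\to\infty$ and $f=o(g)$ means $f/g\to 0$. *)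

theory Defs
  imports
    "HOL-Probability.Probability"
    "HOL-Combinatorics.Multiset_Permutations"
    "HOL-Library.Ramsey"
begin

type_synonym edge = "nat set"
type_synonym graph = "nat set \<times> edge set"

definition contains_copy :: "graph \<Rightarrow> graph \<Rightarrow> bool" where
  "contains_copy H G \<longleftrightarrow>
     (\<exists>f. inj_on f (fst H) \<and> f ` fst H \<subseteq> fst G \<and> (\<forall>e\<in>snd H. f ` e \<in> snd G))"

text \<open>The \<open>k\<close> triangles are \<open>{0, 2i+1, 2i+2}\<close> for \<open>i < k\<close>; their common vertex is \<open>0\<close>.\<close>
definition triangle_fan :: "nat \<Rightarrow> graph" where
  "triangle_fan k =
     ({0..2 * k}, \<Union>i<k. {{0, 2 * i + 1}, {0, 2 * i + 2}, {2 * i + 1, 2 * i + 2}})"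

definition complete_edges :: "nat \<Rightarrow> edge set" where
  "complete_edges n = [{1..n}]\<^bsup>2\<^esup>"

definition edge_orders :: "nat \<Rightarrow> edge list set" where
  "edge_orders n = permutations_of_set (complete_edges n)"

text \<open>A deterministic online rule gets the edges \<open>[e\<^sub>1, \<dots>, e\<^sub>s]\<close> revealed so far and the set of
  edges purchased before time \<open>s\<close>, and decides whether to purchase \<open>e\<^sub>s\<close>.\<close>
type_synonym rule = "edge list \<Rightarrow> edge set \<Rightarrow> bool"

primrec purchased :: "rule \<Rightarrow> edge list \<Rightarrow> nat \<Rightarrow> edge set" where
  "purchased r es 0 = {}"
| "purchased r es (Suc s) =
     (if r (take (Suc s) es) (purchased r es s)
      then insert (es ! s) (purchased r es s) else purchased r es s)"

definition builder_graph :: "nat \<Rightarrow> rule \<Rightarrow> edge list \<Rightarrow> nat \<Rightarrow> graph" where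
  "builder_graph n r es s = ({1..n}, purchased r es s)"

text \<open>A randomized strategy is a random deterministic rule, drawn independently of the edge order;
  a deterministic strategy is the case \<^term>\<open>return_pmf r\<close>. For a fixed \<open>n\<close> only finitely many
  histories occur, so discrete distributions on rules lose no generality. The budget constraint
  holds surely: for every rule that may be drawn and every edge order.\<close>
type_synonym strategy = "rule pmf"

definition tb_strategy :: "nat \<Rightarrow> nat \<Rightarrow> nat \<Rightarrow> strategy \<Rightarrow> bool" where
  "tb_strategy n t b S \<longleftrightarrow>
     (\<forall>r\<in>set_pmf S. \<forall>es\<in>edge_orders n. card (purchased r es t) \<le> b)"

definition prob_contains :: "graph \<Rightarrow> nat \<Rightarrow> nat \<Rightarrow> strategy \<Rightarrow> real" where
  "prob_contains H n t S =
     measure_pmf.prob (pair_pmf (pmf_of_set (edge_orders n)) S)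
       {(es, r). contains_copy H (builder_graph n r es t)}"

definition b_star :: "nat \<Rightarrow> nat \<Rightarrow> nat \<Rightarrow> real" where
  "b_star n t k =
     max (real n ^ (4 * k - 1) / real t ^ (3 * k - 1)) (real n / sqrt (real t))"

text \<open>The asymptotic relations are stated through quotients instead of the library's Landau
  symbols. They agree when the denominator is eventually nonzero. They differ where \<open>t = 0\<close>:
  there \<open>b_star\<close>, which should be infinite, is \<open>0\<close> by the convention \<open>x / 0 = 0\<close>, but the
  quotient \<open>b / b_star\<close> still has the intended value \<open>0\<close>.\<close>
definition is_omega :: "(nat \<Rightarrow> real) \<Rightarrow> (nat \<Rightarrow> real) \<Rightarrow> bool" where
  "is_omega f g \<longleftrightarrow> filterlim (\<lambda>n. f n / g n) at_top sequentially"

definition is_little_o :: "(nat \<Rightarrow> real) \<Rightarrow> (nat \<Rightarrow> real) \<Rightarrow> bool" where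
  "is_little_o f g \<longleftrightarrow> (\<lambda>n. f n / g n) \<longlonglongrightarrow> 0"

end

theory Submission
  imports Defs
begin

text \<open>Write \<open>p = t / n\<^sup>2\<close> for the density.

  \<^emph>\<open>Lower bound.\<close> Builder has to buy the first edge of a copy before seeing its other
  \<open>3k - 1\<close> edges. Each bought edge is the first edge of at most about \<open>n\<^bsup>2k-1\<^esup> p\<^bsup>3k-1\<^esup>\<close> copies in
  expectation, so she succeeds with probability at most of order \<open>b t\<^bsup>3k-1\<^esup> / n\<^bsup>4k-1\<^esup>\<close>; taking
  \<open>b = t\<close> covers the case of small \<open>t\<close>. Moreover \<open>b\<close> edges span at most \<open>b\<^sup>2\<close> paths of length two,
  each closed later with probability of order \<open>p\<close>, so even a triangle has probability at most of
  order \<open>b\<^sup>2 t / n\<^sup>2\<close>.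

  \<^emph>\<open>Strategy.\<close> Fix \<open>\<rho>\<close> centres and \<open>2k\<close> disjoint blocks of \<open>w\<close> further vertices. Builder buys every
  edge between a centre and a block, and every edge between the blocks \<open>2i\<close> and \<open>2i + 1\<close> that closes a
  triangle with bought edges at some centre. Counting only fans with one triangle per pair of blocks,
  whose edges at the centre arrive in the first half and whose other edges arrive in the second
  half of the time, makes the second moment factorise over the \<open>k\<close> triangles. Chebyshev's
  inequality yields such a fan, and Markov's inequality shows that the budget is not exhausted.\<close>

section \<open>Counting permutations with prescribed positions\<close>

text \<open>The price of the strategy explains \<open>b_star\<close>. A centre costs about
  \<open>w * p\<close> edges and is completed with probability of order
  \<open>min 1 (y ^ k)\<close>, where \<open>y = w^2 * p^3\<close>, so about
  \<open>1 + 1 / y ^ k\<close> centres are needed. If \<open>n^2 * p^3\<close> is below 1, blocks of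
  order \<open>n\<close> are best: the price \<open>n * p / y ^ k\<close> is the first term of
  \<open>b_star\<close>, and the \<open>1 / y ^ k = n ^ (4 * k) / t ^ (3 * k)\<close> centres fit
  into \<open>n\<close> vertices exactly when \<open>t\<close> is above its threshold. For larger
  \<open>p\<close> a bounded number of centres is enough and \<open>w\<close> of order
  \<open>p powr (-3/2)\<close> suffices, at price \<open>p powr (-1/2)\<close>, the second term. A
  slowly growing factor \<theta> turns these orders of magnitude into a limit. The obstacle is that
  edges of a random order are not independent. Probabilities are therefore counts of permutations,
  compared with powers of \<open>h / N\<close> up to factors such as
  \<open>(N / (N - m)) ^ m\<close>, which tend to 1 because \<open>m\<close> stays bounded. The zero
  statement needs \<open>t\<close> well below \<open>N\<close>, since otherwise its bounds exceed 1;
  for denser \<open>t\<close>, \<open>b_star\<close> is bounded and a budget of smaller order is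
  eventually 0.\<close>

lemma card_permutations_fixed_positions:
  assumes "finite S" "R \<subseteq> S" "inj_on \<phi> R" "\<phi> ` R \<subseteq> {..<card S}"
  shows "card {es \<in> permutations_of_set S. \<forall>e\<in>R. es ! \<phi> e = e} = fact (card S - card R)"
  using assms
proof (induction "card S - card R" arbitrary: R \<phi>)
  case 0
  have "card R = card S"
    using 0 by (metis card_mono diff_is_0_eq le_antisym)
  then have RS: "R = S" using 0 by (metis card_subset_eq)
  have bij: "bij_betw \<phi> S {..<card S}"
    using 0 RS by (metis bij_betw_def card_image card_lessThan card_subset_eq finite_lessThan)
  define xs where "xs = map (inv_into S \<phi>) [0..<card S]"
  have bij': "bij_betw (inv_into S \<phi>) {..<card S} S"
    using bij by (rule bij_betw_inv_into)
  have "set xs = S"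
    using bij' by (simp add: xs_def bij_betw_def atLeast0LessThan)
  moreover have "distinct xs"
    using bij' by (simp add: xs_def bij_betw_def distinct_map atLeast0LessThan)
  ultimately have "xs \<in> permutations_of_set S"
    by (simp add: permutations_of_set_def)
  moreover have "xs ! \<phi> e = e" if "e \<in> S" for e
  proof -
    have "\<phi> e < card S" using that bij by (auto simp: bij_betw_def)
    then show ?thesis using that bij by (simp add: xs_def bij_betw_def)
  qed
  moreover have "es = xs"
    if es: "es \<in> permutations_of_set S" "\<forall>e\<in>S. es ! \<phi> e = e" for es
  proof (rule nth_equalityI)
    show l: "length es = length xs"
      using es by (simp add: xs_def length_finite_permutations_of_set)
    fix i assume "i < length es"
    then have "i \<in> \<phi> ` S"
      using bij l by (simp add: bij_betw_def xs_def)
    then obtain e where "e \<in> S" "i = \<phi> e" by blast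
    then show "es ! i = xs ! i"
      using es(2) calculation(2) by simp
  qed
  ultimately have "{es \<in> permutations_of_set S. \<forall>e\<in>R. es ! \<phi> e = e} = {xs}"
    unfolding RS by blast
  then show ?case using 0 by simp
next
  case (Suc d)
  have "R \<noteq> S" using Suc.hyps(2) by auto
  then obtain e where e: "e \<in> S" "e \<notin> R" using Suc.prems by blast
  have finR: "finite R" using Suc.prems finite_subset by blast
  \<comment> \<open>The element \<open>e\<close> is still unplaced and sits at one of the
    \<open>Suc d\<close> free positions \<open>J\<close>. Fixing it prescribes one more element, so
    the induction hypothesis gives \<open>fact d\<close> orders for each position.\<close>
  define J where "J = {..<card S} - \<phi> ` R"
  define A where "A j = {es \<in> permutations_of_set S. \<forall>e'\<in>insert e R. es ! (\<phi>(e := j)) e' = e'}" for j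
  have cJ: "card J = Suc d"
    using Suc finR unfolding J_def by (simp add: card_Diff_subset card_image)
  have cA: "card (A j) = fact d" if "j \<in> J" for j
  proof -
    have 1: "d = card S - card (insert e R)"
      using Suc.hyps(2) e finR by simp
    have 2: "(\<phi>(e := j)) ` insert e R \<subseteq> {..<card S}"
      using that Suc.prems(4) e(2) by (auto simp: J_def)
    have 3: "inj_on (\<phi>(e := j)) (insert e R)"
      using that Suc.prems(3) e(2) by (auto simp: J_def inj_on_def)
    show ?thesis
      unfolding A_def using Suc.hyps(1)[OF 1 Suc.prems(1) _ 3 2] e Suc.prems(2) 1 by simp
  qed
  have U: "{es \<in> permutations_of_set S. \<forall>e\<in>R. es ! \<phi> e = e} = (\<Union>j\<in>J. A j)" (is "?L = _")
  proof (intro equalityI subsetI)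
    fix es assume es: "es \<in> ?L"
    then have "set es = S" and d: "distinct es" and l: "length es = card S"
      by (auto simp: permutations_of_set_def distinct_card)
    then obtain j where j: "j < card S" "es ! j = e"
      using e by (metis in_set_conv_nth)
    have "j \<notin> \<phi> ` R" using j es e by auto
    then have "j \<in> J" using j by (simp add: J_def)
    moreover have "es \<in> A j" using es j e by (auto simp: A_def)
    ultimately show "es \<in> (\<Union>j\<in>J. A j)" by blast
  next
    fix es assume "es \<in> (\<Union>j\<in>J. A j)"
    then obtain j where "es \<in> A j" by blast
    then have "es \<in> permutations_of_set S" "\<And>e'. e' \<in> R \<Longrightarrow> es ! \<phi> e' = e'"
      unfolding A_def using e by (auto split: if_splits)
    then show "es \<in> ?L" by blast
  qed
  have "card (\<Union>j\<in>J. A j) = (\<Sum>j\<in>J. card (A j))"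
  proof (rule card_UN_disjoint)
    show "\<forall>i\<in>J. \<forall>j\<in>J. i \<noteq> j \<longrightarrow> A i \<inter> A j = {}"
    proof (intro ballI impI)
      fix i j assume ij: "i \<in> J" "j \<in> J" "i \<noteq> j"
      show "A i \<inter> A j = {}"
      proof (rule ccontr)
        assume "A i \<inter> A j \<noteq> {}"
        then obtain es where "es \<in> A i" "es \<in> A j" by blast
        then have "es ! i = e" "es ! j = e" "distinct es" "length es = card S"
          by (auto simp: A_def permutations_of_set_def distinct_card)
        then show False
          using ij by (auto simp: J_def nth_eq_iff_index_eq)
      qed
    qed
  qed (auto simp: J_def A_def Suc.prems)
  also have "\<dots> = fact (Suc d)" using cA cJ by simp
  finally show ?case using U Suc.hyps(2) by simp
qed

text \<open>A union bound over all choices \<phi> of a permitted position for each element of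
  \<open>R\<close>. A choice that uses a position twice is realised by no order, so each term is at
  most the factorial.\<close>

lemma card_permutations_in_positions_le:
  assumes S: "finite S" and R: "R \<subseteq> S" and Q: "\<And>e. e \<in> R \<Longrightarrow> Q e \<subseteq> {..<card S}"
  shows "card {es \<in> permutations_of_set S. \<forall>e\<in>R. \<exists>j\<in>Q e. es ! j = e}
         \<le> (\<Prod>e\<in>R. card (Q e)) * fact (card S - card R)"
proof -
  have finR: "finite R" using S R finite_subset by blast
  have finQ: "finite (Q e)" if "e \<in> R" for e using Q[OF that] finite_subset by blast
  define F where "F = PiE R Q"
  define A where "A \<phi> = {es \<in> permutations_of_set S. \<forall>e\<in>R. es ! \<phi> e = e}" for \<phi>
  have finF: "finite F" unfolding F_def using finR finQ by (intro finite_PiE)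
  have "{es \<in> permutations_of_set S. \<forall>e\<in>R. \<exists>j\<in>Q e. es ! j = e} \<subseteq> (\<Union>\<phi>\<in>F. A \<phi>)"
  proof
    fix es assume es: "es \<in> {es \<in> permutations_of_set S. \<forall>e\<in>R. \<exists>j\<in>Q e. es ! j = e}"
    then obtain \<phi> where \<phi>: "\<forall>e\<in>R. \<phi> e \<in> Q e \<and> es ! \<phi> e = e" by (auto simp: Bex_def) metis
    then have "restrict \<phi> R \<in> F" "es \<in> A (restrict \<phi> R)" using es by (auto simp: F_def A_def)
    then show "es \<in> (\<Union>\<phi>\<in>F. A \<phi>)" by blast
  qed
  then have "card {es \<in> permutations_of_set S. \<forall>e\<in>R. \<exists>j\<in>Q e. es ! j = e} \<le> card (\<Union>\<phi>\<in>F. A \<phi>)"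
    by (intro card_mono finite_UN_I finF) (auto simp: A_def S)
  also have "\<dots> \<le> (\<Sum>\<phi>\<in>F. card (A \<phi>))" using finF by (rule card_UN_le)
  also have "\<dots> \<le> (\<Sum>\<phi>\<in>F. fact (card S - card R))"
  proof (rule sum_mono)
    fix \<phi> assume "\<phi> \<in> F"
    then have sub: "\<phi> ` R \<subseteq> {..<card S}" using Q by (auto simp: F_def PiE_def Pi_def)
    show "card (A \<phi>) \<le> fact (card S - card R)"
    proof (cases "inj_on \<phi> R")
      case True
      then show ?thesis
        unfolding A_def using card_permutations_fixed_positions[OF S R True sub] by simp
    next
      case False
      then have "A \<phi> = {}" unfolding A_def inj_on_def by auto metis
      then show ?thesis by simp
    qed
  qed
  also have "\<dots> = (\<Prod>e\<in>R. card (Q e)) * fact (card S - card R)"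
    by (simp add: F_def card_PiE finR)
  finally show ?thesis .
qed

text \<open>Choose greedily: at most \<open>m\<close> positions are occupied at any stage, so at
  least \<open>h - m\<close> are left. The bound \<open>m\<close> is kept apart from
  \<open>card R\<close> so that the base \<open>h - m\<close> stays the same throughout the
  induction.\<close>

lemma card_injective_choices_ge:
  assumes "finite R" and "\<And>e. e \<in> R \<Longrightarrow> finite (Q e) \<and> h \<le> card (Q e)" and "card R \<le> m"
  shows "(h - m) ^ card R \<le> card {\<phi> \<in> PiE R Q. inj_on \<phi> R}"
  using assms
proof (induction R rule: finite_induct)
  case empty
  show ?case by simp
next
  case (insert e R)
  define F where "F = {\<phi> \<in> PiE R Q. inj_on \<phi> R}"
  define G where "G = (SIGMA \<phi>:F. Q e - \<phi> ` R)"
  have finF: "finite F"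
    unfolding F_def using insert by (intro finite_subset[OF _ finite_PiE[of R Q]]) auto
  have IH: "(h - m) ^ card R \<le> card F"
    using insert unfolding F_def by simp
  have "(h - m) ^ card (insert e R) = (h - m) ^ card R * (h - m)"
    using insert by simp
  also have "\<dots> \<le> card F * (h - m)" using IH by simp
  also have "\<dots> \<le> (\<Sum>\<phi>\<in>F. card (Q e - \<phi> ` R))"
  proof -
    have "h - m \<le> card (Q e - \<phi> ` R)" for \<phi>
    proof -
      have "card (\<phi> ` R) \<le> m"
        using insert card_image_le[of R \<phi>] by simp
      moreover have "card (Q e) - card (\<phi> ` R) \<le> card (Q e - \<phi> ` R)"
        using insert by (intro diff_card_le_card_Diff) auto
      moreover have "h \<le> card (Q e)" using insert by blast
      ultimately show ?thesis by linarith
    qed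
    then show ?thesis using sum_bounded_below[of F "h - m" "\<lambda>\<phi>. card (Q e - \<phi> ` R)"] by simp
  qed
  also have "\<dots> = card G" unfolding G_def using finF insert by (simp add: card_SigmaI)
  also have "\<dots> \<le> card {\<phi> \<in> PiE (insert e R) Q. inj_on \<phi> (insert e R)}"
  proof (rule card_inj_on_le)
    show "inj_on (\<lambda>(\<phi>, j). \<phi>(e := j)) G"
    proof (rule inj_onI, clarify)
      fix \<phi> j \<psi> i
      assume a: "(\<phi>, j) \<in> G" "(\<psi>, i) \<in> G" "\<phi>(e := j) = \<psi>(e := i)"
      have "\<phi> x = \<psi> x" for x
      proof (cases "x = e")
        case True
        have "\<phi> e = undefined" "\<psi> e = undefined"
          using a insert by (auto simp: G_def F_def PiE_def extensional_def)
        then show ?thesis using True by simp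
      next
        case False
        then show ?thesis using a(3) by (metis fun_upd_other)
      qed
      moreover have "j = i" using a(3) by (metis fun_upd_same)
      ultimately show "\<phi> = \<psi> \<and> j = i" by blast
    qed
    show "(\<lambda>(\<phi>, j). \<phi>(e := j)) ` G \<subseteq> {\<phi> \<in> PiE (insert e R) Q. inj_on \<phi> (insert e R)}"
    proof clarify
      fix \<phi> j assume "(\<phi>, j) \<in> G"
      then have a: "\<phi> \<in> PiE R Q" "inj_on \<phi> R" "j \<in> Q e" "j \<notin> \<phi> ` R"
        by (auto simp: G_def F_def)
      have "inj_on (\<phi>(e := j)) R"
        using a(2) insert(2) by (auto simp: inj_on_def)
      then have "inj_on (\<phi>(e := j)) (insert e R)"
        using a(4) insert(2) by (auto simp: inj_on_insert)
      moreover have "\<phi>(e := j) \<in> PiE (insert e R) Q"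
        using a(1,3) by (auto simp: PiE_def Pi_def extensional_def)
      ultimately show "\<phi>(e := j) \<in> PiE (insert e R) Q \<and> inj_on (\<phi>(e := j)) (insert e R)"
        by blast
    qed
    show "finite {\<phi> \<in> PiE (insert e R) Q. inj_on \<phi> (insert e R)}"
      using insert by (intro finite_subset[OF _ finite_PiE[of "insert e R" Q]]) auto
  qed
  finally show ?case .
qed

text \<open>For a lower bound the union over \<phi> has to be counted exactly. It is disjoint: an
  order without repetitions determines the position of each element of \<open>R\<close>, hence
  \<phi>.\<close>

lemma card_permutations_in_positions_ge:
  assumes S: "finite S" and R: "R \<subseteq> S" and Q: "\<And>e. e \<in> R \<Longrightarrow> Q e \<subseteq> {..<card S} \<and> h \<le> card (Q e)"
  shows "(h - card R) ^ card R * fact (card S - card R)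
         \<le> card {es \<in> permutations_of_set S. \<forall>e\<in>R. \<exists>j\<in>Q e. es ! j = e}"
proof -
  have finR: "finite R" using S R finite_subset by blast
  have finQ: "finite (Q e)" if "e \<in> R" for e using Q[OF that] finite_subset by blast
  define F where "F = {\<phi> \<in> PiE R Q. inj_on \<phi> R}"
  define A where "A \<phi> = {es \<in> permutations_of_set S. \<forall>e\<in>R. es ! \<phi> e = e}" for \<phi>
  have sub: "\<phi> ` R \<subseteq> {..<card S}" if "\<phi> \<in> F" for \<phi>
    using that Q by (force simp: F_def PiE_def Pi_def)
  have finF: "finite F"
    unfolding F_def using finR finQ by (intro finite_subset[OF _ finite_PiE[of R Q]]) auto
  have "(h - card R) ^ card R * fact (card S - card R) \<le> card F * fact (card S - card R)"
    unfolding F_def using card_injective_choices_ge[OF finR, of Q h "card R"] Q finQ by simp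
  also have "\<dots> = (\<Sum>\<phi>\<in>F. card (A \<phi>))"
    using card_permutations_fixed_positions[OF S R] sub by (simp add: A_def F_def)
  also have "\<dots> = card (\<Union>\<phi>\<in>F. A \<phi>)"
  proof (rule card_UN_disjoint[symmetric])
    show "\<forall>\<phi>\<in>F. \<forall>\<psi>\<in>F. \<phi> \<noteq> \<psi> \<longrightarrow> A \<phi> \<inter> A \<psi> = {}"
    proof (intro ballI impI)
      fix \<phi> \<psi> assume a: "\<phi> \<in> F" "\<psi> \<in> F" "\<phi> \<noteq> \<psi>"
      show "A \<phi> \<inter> A \<psi> = {}"
      proof (rule ccontr)
        assume "A \<phi> \<inter> A \<psi> \<noteq> {}"
        then obtain es where es: "es \<in> A \<phi>" "es \<in> A \<psi>" by blast
        then have d: "distinct es" "length es = card S"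
          by (auto simp: A_def permutations_of_set_def distinct_card)
        have "\<phi> e = \<psi> e" if "e \<in> R" for e
        proof -
          have "es ! \<phi> e = es ! \<psi> e" using es that by (simp add: A_def)
          moreover have "\<phi> e < card S" "\<psi> e < card S" using sub a that by blast+
          ultimately show ?thesis using d by (simp add: nth_eq_iff_index_eq)
        qed
        then have "\<phi> = \<psi>" using a by (intro PiE_ext[of \<phi> R Q \<psi>]) (auto simp: F_def)
        then show False using a by simp
      qed
    qed
  qed (auto simp: finF A_def S)
  also have "\<dots> \<le> card {es \<in> permutations_of_set S. \<forall>e\<in>R. \<exists>j\<in>Q e. es ! j = e}"
    by (intro card_mono) (auto simp: S A_def F_def PiE_def Pi_def)
  finally show ?thesis .
qed

text \<open>With the next lemma this encloses the falling factorial
  \<open>N * (N - 1) * ... * (N - m + 1)\<close> between \<open>(N - m) ^ m\<close> and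
  \<open>N ^ m\<close>, which stands in for independence.\<close>

lemma power_mult_fact_le_fact:
  assumes "m \<le> N"
  shows "(N - m) ^ m * fact (N - m) \<le> (fact N :: nat)"
proof -
  have "(N - m) ^ j * fact (N - m) \<le> (fact (N - m + j) :: nat)" for j
  proof (induction j)
    case (Suc j)
    have "(N - m) ^ Suc j * fact (N - m) = (N - m) * ((N - m) ^ j * fact (N - m))" by simp
    also have "\<dots> \<le> (N - m + Suc j) * fact (N - m + j)"
      using Suc by (intro mult_mono) auto
    also have "\<dots> = fact (N - m + Suc j)" by simp
    finally show ?case .
  qed simp
  from this[of m] show ?thesis using assms by simp
qed

lemma fact_le_power_mult_fact:
  assumes "m \<le> N"
  shows "(fact N :: nat) \<le> N ^ m * fact (N - m)"
proof -
  have "(fact N :: nat) div fact (N - m) \<le> N ^ m" by (rule fact_div_fact_le_pow[OF assms])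
  moreover have "(fact (N - m) :: nat) dvd fact N" by (intro fact_dvd) simp
  ultimately show ?thesis by (metis dvd_div_mult_self mult_le_mono1)
qed

section \<open>Edges arriving after a purchase\<close>

lemma purchased_take:
  assumes "s \<le> s'"
  shows "purchased r (take s' es) s = purchased r es s"
  using assms by (induction s) (auto simp: min_def)

lemma finite_purchased [simp]: "finite (purchased r es s)"
  by (induction s) auto

lemma purchased_mono: "s \<le> s' \<Longrightarrow> purchased r es s \<subseteq> purchased r es s'"
  by (rule lift_Suc_mono_le[of "purchased r es"]) auto

text \<open>The decision on the last edge of a prefix, with the earlier purchases recomputed from
  that prefix. It is thus constant on all orders sharing the prefix, which permits
  conditioning.\<close>

definition buys :: "rule \<Rightarrow> edge list \<Rightarrow> bool" where
  "buys r pre \<longleftrightarrow> r pre (purchased r pre (length pre - 1))"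

lemma buys_take_Suc:
  assumes "s < length es"
  shows "buys r (take (Suc s) es) \<longleftrightarrow> r (take (Suc s) es) (purchased r es s)"
proof -
  have "length (take (Suc s) es) - 1 = s" using assms by simp
  then show ?thesis by (simp only: buys_def) (simp add: purchased_take)
qed

lemma purchased_eq_image:
  assumes "t \<le> length es"
  shows "purchased r es t = (!) es ` {s. s < t \<and> buys r (take (Suc s) es)}"
  using assms
proof (induction t)
  case (Suc t)
  have "{s. s < Suc t \<and> buys r (take (Suc s) es)} =
    (if buys r (take (Suc t) es) then insert t {s. s < t \<and> buys r (take (Suc s) es)}
     else {s. s < t \<and> buys r (take (Suc s) es)})"
    by (auto simp: less_Suc_eq)
  then show ?case using Suc by (simp add: buys_take_Suc)
qed simp

lemma purchased_subset_take:
  assumes "t \<le> length es"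
  shows "purchased r es t \<subseteq> set (take t es)"
proof
  fix e assume "e \<in> purchased r es t"
  then obtain s where "s < t" "e = es ! s" using assms by (auto simp: purchased_eq_image)
  then show "e \<in> set (take t es)"
    using assms by (auto simp: in_set_conv_nth intro!: exI[of _ s])
qed

lemma card_purchased:
  assumes "t \<le> length es" "distinct es"
  shows "card (purchased r es t) = card {s. s < t \<and> buys r (take (Suc s) es)}"
  unfolding purchased_eq_image[OF assms(1)]
  by (rule card_image) (use assms in \<open>auto simp: inj_on_def nth_eq_iff_index_eq\<close>)

section \<open>Orders with a given prefix\<close>

lemma permutations_of_set_list:
  assumes "es \<in> permutations_of_set S"
  shows "set es = S" "distinct es" "length es = card S"
  using assms by (auto simp: permutations_of_set_def distinct_card)

lemma take_eq_iff_nth: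
  assumes "length xs \<le> length es"
  shows "take (length xs) es = xs \<longleftrightarrow> (\<forall>i<length xs. es ! i = xs ! i)"
proof
  show "take (length xs) es = xs \<Longrightarrow> \<forall>i<length xs. es ! i = xs ! i"
    by (metis nth_take)
  show "\<forall>i<length xs. es ! i = xs ! i \<Longrightarrow> take (length xs) es = xs"
    using assms by (intro nth_equalityI) auto
qed

lemma card_permutations_prefix:
  assumes S: "finite S" and xs: "distinct xs" "set xs \<subseteq> S"
  shows "card {es \<in> permutations_of_set S. take (length xs) es = xs} = fact (card S - length xs)"
proof -
  define \<phi> where "\<phi> = inv_into {..<length xs} ((!) xs)"
  have bij: "bij_betw ((!) xs) {..<length xs} (set xs)"
    using xs(1) by (rule bij_betw_nth) auto
  have bij': "bij_betw \<phi> (set xs) {..<length xs}"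
    unfolding \<phi>_def using bij by (rule bij_betw_inv_into)
  have le: "length xs \<le> card S"
    using xs S by (metis card_mono distinct_card)
  have \<phi>: "\<phi> (xs ! i) = i" if "i < length xs" for i
    unfolding \<phi>_def using bij that by (simp add: bij_betw_def)
  have "take (length xs) es = xs \<longleftrightarrow> (\<forall>e\<in>set xs. es ! \<phi> e = e)"
    if "es \<in> permutations_of_set S" for es
  proof -
    have "take (length xs) es = xs \<longleftrightarrow> (\<forall>i<length xs. es ! i = xs ! i)"
      using take_eq_iff_nth[of xs es] le permutations_of_set_list(3)[OF that] by simp
    also have "\<dots> \<longleftrightarrow> (\<forall>e\<in>set xs. es ! \<phi> e = e)"
      by (simp add: all_set_conv_all_nth \<phi>)
    finally show ?thesis .
  qed
  then have "{es \<in> permutations_of_set S. take (length xs) es = xs} =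
      {es \<in> permutations_of_set S. \<forall>e\<in>set xs. es ! \<phi> e = e}" by blast
  moreover have "\<phi> ` set xs \<subseteq> {..<card S}"
    using bij' le by (auto simp: bij_betw_def)
  ultimately show ?thesis
    using card_permutations_fixed_positions[OF S xs(2), of \<phi>] bij' xs
    by (simp add: bij_betw_def distinct_card)
qed

lemma card_permutations_prefix_later_le:
  assumes S: "finite S" and xs: "distinct xs" "set xs \<subseteq> S" and t: "t \<le> card S" and R: "finite R"
  shows "card {es \<in> permutations_of_set S.
           take (length xs) es = xs \<and> R \<subseteq> set (drop (length xs) (take t es))}
         \<le> (t - length xs) ^ card R * fact (card S - length xs - card R)"
    (is "card ?A \<le> _")
\<comment> \<open>A member of the set shows that \<open>R\<close> lies in \<open>S\<close> and,
  having no repetitions, that \<open>R\<close> avoids \<open>xs\<close>; neither is assumed. If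
  there is no member, the bound is trivial.\<close>
proof (cases "?A = {}")
  case False
  then obtain es where es: "es \<in> ?A" by blast
  note es' = permutations_of_set_list[of es S]
  have le: "length xs \<le> card S"
    using xs S by (metis card_mono distinct_card)
  have RS: "R \<subseteq> S" using es es' by (auto dest!: in_set_dropD in_set_takeD)
  have disj: "R \<inter> set xs = {}"
  proof -
    have "set (take (length xs) es) \<inter> set (drop (length xs) es) = {}"
      using es es' by (intro set_take_disj_set_drop_if_distinct) auto
    moreover have "set (drop (length xs) (take t es)) \<subseteq> set (drop (length xs) es)"
      by (metis drop_take set_take_subset)
    ultimately show ?thesis using es by auto
  qed
  define \<phi> where "\<phi> = inv_into {..<length xs} ((!) xs)"
  have bij: "bij_betw ((!) xs) {..<length xs} (set xs)"
    using xs(1) by (rule bij_betw_nth) auto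
  have \<phi>: "\<phi> e < length xs" "xs ! \<phi> e = e" if "e \<in> set xs" for e
  proof -
    have "e \<in> (!) xs ` {..<length xs}" using that bij by (simp add: bij_betw_def)
    then show "\<phi> e < length xs" "xs ! \<phi> e = e"
      unfolding \<phi>_def using inv_into_into[of e "(!) xs" "{..<length xs}"]
      by (auto simp: f_inv_into_f)
  qed
  \<comment> \<open>A prefix edge has one admissible position; an edge of \<open>R\<close> has the
    window from \<open>length xs\<close> to \<open>t - 1\<close>.\<close>
  define Q where "Q e = (if e \<in> set xs then {\<phi> e} else {length xs..<t})" for e
  have "?A \<subseteq> {es \<in> permutations_of_set S. \<forall>e\<in>set xs \<union> R. \<exists>j\<in>Q e. es ! j = e}"
  proof (intro subsetI CollectI conjI ballI)
    fix es e assume es: "es \<in> ?A" and e: "e \<in> set xs \<union> R"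
    show "\<exists>j\<in>Q e. es ! j = e"
    proof (cases "e \<in> set xs")
      case True
      have "es ! \<phi> e = xs ! \<phi> e" using es \<phi>(1)[OF True] by (metis (mono_tags, lifting) mem_Collect_eq nth_take)
      then show ?thesis using True \<phi> by (simp add: Q_def)
    next
      case False
      then have "e \<in> set (drop (length xs) (take t es))" using es e by blast
      then obtain i where "i < length (drop (length xs) (take t es))"
        "drop (length xs) (take t es) ! i = e" by (metis in_set_conv_nth)
      then have "length xs + i < t" "es ! (length xs + i) = e"
        using es t permutations_of_set_list(3)[of es S] by auto
      then show ?thesis using False by (intro bexI[of _ "length xs + i"]) (auto simp: Q_def)
    qed
  qed simp
  then have "card ?A \<le> card {es \<in> permutations_of_set S. \<forall>e\<in>set xs \<union> R. \<exists>j\<in>Q e. es ! j = e}"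
    by (intro card_mono) (auto simp: S)
  also have "\<dots> \<le> (\<Prod>e\<in>set xs \<union> R. card (Q e)) * fact (card S - card (set xs \<union> R))"
  proof (rule card_permutations_in_positions_le[OF S])
    fix e assume "e \<in> set xs \<union> R"
    show "Q e \<subseteq> {..<card S}" using \<phi>(1)[of e] le t by (auto simp: Q_def)
  qed (use RS xs in auto)
  also have "(\<Prod>e\<in>set xs \<union> R. card (Q e)) = (\<Prod>e\<in>set xs. card (Q e)) * (\<Prod>e\<in>R. card (Q e))"
    using R disj by (intro prod.union_disjoint) auto
  also have "(\<Prod>e\<in>set xs. card (Q e)) = 1" by (simp add: Q_def)
  also have "(\<Prod>e\<in>R. card (Q e)) = (\<Prod>e\<in>R. t - length xs)"
    using disj by (intro prod.cong) (auto simp: Q_def)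
  also have "card (set xs \<union> R) = length xs + card R"
    using R disj xs by (subst card_Un_disjoint) (auto simp: distinct_card)
  finally show ?thesis by simp
next
  case True
  then show ?thesis by (metis card.empty le0)
qed

lemma card_eq_sum_card_fibres:
  assumes "finite A"
  shows "card {x \<in> A. P x} = (\<Sum>y\<in>f ` A. card {x \<in> A. P x \<and> f x = y})"
proof -
  have "{x \<in> A. P x} = (\<Union>y\<in>f ` A. {x \<in> A. P x \<and> f x = y})" by blast
  moreover have "card (\<Union>y\<in>f ` A. {x \<in> A. P x \<and> f x = y})
      = (\<Sum>y\<in>f ` A. card {x \<in> A. P x \<and> f x = y})"
    using assms by (intro card_UN_disjoint) auto
  ultimately show ?thesis by metis
qed

text \<open>Conditioned on the first \<open>s + 1\<close> edges, any \<open>m\<close> given edges all arrive during the remaining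
  time with probability at most \<open>(t / (N - t - m))\<^sup>m\<close>; this is summed over the at most \<open>b\<close>
  times at which Builder buys.\<close>
lemma card_bought_then_completed_le:
  fixes \<R> :: "edge list \<Rightarrow> edge set set"
  assumes S: "finite S" and t: "t + m < card S"
    and budget: "\<And>es. es \<in> permutations_of_set S \<Longrightarrow> card (purchased r es t) \<le> b"
    and \<R>: "\<And>es s R. \<lbrakk>es \<in> permutations_of_set S; s < t; R \<in> \<R> (take (Suc s) es)\<rbrakk>
              \<Longrightarrow> finite R \<and> card R = m"
    and L: "\<And>es s. \<lbrakk>es \<in> permutations_of_set S; s < t\<rbrakk>
              \<Longrightarrow> finite (\<R> (take (Suc s) es)) \<and> card (\<R> (take (Suc s) es)) \<le> L"
  shows "real (card {es \<in> permutations_of_set S. \<exists>s<t. buys r (take (Suc s) es) \<and>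
            (\<exists>R\<in>\<R> (take (Suc s) es). R \<subseteq> set (drop (Suc s) (take t es)))})
         \<le> real b * real L * (real t / (real (card S) - real t - real m)) ^ m * fact (card S)"
proof -
  define N where "N = card S"
  define \<Omega> where "\<Omega> = permutations_of_set S"
  define q where "q = (real t / (real N - real t - real m)) ^ m"
  have q0: "q \<ge> 0" using t by (simp add: q_def N_def)
  have fin: "finite \<Omega>" by (simp add: \<Omega>_def)
  define completed where "completed s es \<longleftrightarrow>
    (\<exists>R\<in>\<R> (take (Suc s) es). R \<subseteq> set (drop (Suc s) (take t es)))" for s es
  \<comment> \<open>The prefix determines both whether Builder buys and which sets \<open>R\<close>
    would complete a copy, so a union bound over at most \<open>L\<close> fixed sets applies to the
    orders with this prefix.\<close>
  have prefix: "real (card {es \<in> \<Omega>. (buys r (take (Suc s) es) \<and> completed s es) \<and> take (Suc s) es = xs})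
      \<le> real L * q * real (card {es \<in> \<Omega>. buys r (take (Suc s) es) \<and> take (Suc s) es = xs})"
    if s: "s < t" and xs: "xs \<in> take (Suc s) ` \<Omega>" for s xs
  proof (cases "buys r xs")
    case True
    from xs obtain es0 where es0: "es0 \<in> \<Omega>" "xs = take (Suc s) es0" by blast
    have len: "length xs = Suc s" and dx: "distinct xs" and sx: "set xs \<subseteq> S"
      using es0 s t permutations_of_set_list[of es0 S] by (auto simp: \<Omega>_def dest: in_set_takeD)
    have finR: "finite (\<R> xs)" and cL: "card (\<R> xs) \<le> L" using L es0 s by (auto simp: \<Omega>_def)
    define A where "A R = {es \<in> \<Omega>. take (Suc s) es = xs \<and> R \<subseteq> set (drop (Suc s) (take t es))}" for R
    have A: "real (card (A R)) \<le> q * fact (N - Suc s)" if "R \<in> \<R> xs" for R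
    proof -
      have R: "finite R" "card R = m" using \<R> that es0 s by (auto simp: \<Omega>_def)
      have "card (A R) \<le> (t - Suc s) ^ m * fact (N - Suc s - m)"
        using card_permutations_prefix_later_le[OF S dx sx _ R(1), of t] t R(2) len
        by (simp add: A_def \<Omega>_def N_def)
      then have "real (card (A R)) \<le> real ((t - Suc s) ^ m * fact (N - Suc s - m))"
        by (rule of_nat_mono)
      also have "\<dots> \<le> real t ^ m * fact (N - Suc s - m)"
        by (auto intro!: mult_right_mono power_mono)
      also have "\<dots> = q * ((real N - real t - real m) ^ m * fact (N - Suc s - m))"
        using t by (simp add: q_def power_divide N_def)
      \<comment> \<open>As \<open>Suc s \<le> t\<close>, having \<open>t\<close> in the denominator
        of \<open>q\<close> makes one bound serve all times \<open>s\<close>.\<close>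
      also have "\<dots> \<le> q * (real (N - Suc s - m) ^ m * fact (N - Suc s - m))"
        using t s by (intro mult_left_mono mult_right_mono power_mono q0) (auto simp: N_def)
      also have "real (N - Suc s - m) ^ m * fact (N - Suc s - m)
          = real ((N - Suc s - m) ^ m * fact (N - Suc s - m))" by simp
      also have "\<dots> \<le> real (fact (N - Suc s))"
        using t s by (intro of_nat_mono power_mult_fact_le_fact) (auto simp: N_def)
      finally show ?thesis using q0 by (simp add: mult_left_mono)
    qed
    have "{es \<in> \<Omega>. (buys r (take (Suc s) es) \<and> completed s es) \<and> take (Suc s) es = xs} \<subseteq> (\<Union>R\<in>\<R> xs. A R)"
      by (auto simp: completed_def A_def)
    then have "card {es \<in> \<Omega>. (buys r (take (Suc s) es) \<and> completed s es) \<and> take (Suc s) es = xs}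
        \<le> card (\<Union>R\<in>\<R> xs. A R)"
      using finR fin by (intro card_mono) (auto simp: A_def)
    also have "\<dots> \<le> (\<Sum>R\<in>\<R> xs. card (A R))" using finR by (rule card_UN_le)
    finally have "real (card {es \<in> \<Omega>. (buys r (take (Suc s) es) \<and> completed s es) \<and> take (Suc s) es = xs})
        \<le> (\<Sum>R\<in>\<R> xs. real (card (A R)))" unfolding of_nat_sum[symmetric] by (rule of_nat_mono)
    also have "\<dots> \<le> real (card (\<R> xs)) * (q * fact (N - Suc s))" using A by (rule sum_bounded_above)
    also have "\<dots> \<le> real L * (q * fact (N - Suc s))"
      using cL q0 by (intro mult_right_mono) auto
    also have "fact (N - Suc s) = real (card {es \<in> \<Omega>. take (Suc s) es = xs})"
      using card_permutations_prefix[OF S dx sx] by (simp add: len \<Omega>_def N_def)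
    also have "{es \<in> \<Omega>. take (Suc s) es = xs} = {es \<in> \<Omega>. buys r (take (Suc s) es) \<and> take (Suc s) es = xs}"
      using True by blast
    finally show ?thesis by (simp add: mult.assoc)
  next
    case False
    then have "{es \<in> \<Omega>. (buys r (take (Suc s) es) \<and> completed s es) \<and> take (Suc s) es = xs} = {}" by blast
    then have "card {es \<in> \<Omega>. (buys r (take (Suc s) es) \<and> completed s es) \<and> take (Suc s) es = xs} = 0"
      by (simp only: card.empty)
    then show ?thesis using q0 by simp
  qed
  have step: "real (card {es \<in> \<Omega>. buys r (take (Suc s) es) \<and> completed s es})
      \<le> real L * q * real (card {es \<in> \<Omega>. buys r (take (Suc s) es)})" if "s < t" for s
    unfolding card_eq_sum_card_fibres[OF fin,
        of "\<lambda>es. buys r (take (Suc s) es) \<and> completed s es" "take (Suc s)"]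
      card_eq_sum_card_fibres[OF fin, of "\<lambda>es. buys r (take (Suc s) es)" "take (Suc s)"]
      of_nat_sum sum_distrib_left
    by (rule sum_mono) (rule prefix[OF that])
  have "{es \<in> \<Omega>. \<exists>s<t. buys r (take (Suc s) es) \<and> completed s es} =
      (\<Union>s<t. {es \<in> \<Omega>. buys r (take (Suc s) es) \<and> completed s es})" by blast
  then have "card {es \<in> \<Omega>. \<exists>s<t. buys r (take (Suc s) es) \<and> completed s es}
      \<le> (\<Sum>s<t. card {es \<in> \<Omega>. buys r (take (Suc s) es) \<and> completed s es})"
    using card_UN_le[of "{..<t}"] by simp
  then have "real (card {es \<in> \<Omega>. \<exists>s<t. buys r (take (Suc s) es) \<and> completed s es})
      \<le> (\<Sum>s<t. real (card {es \<in> \<Omega>. buys r (take (Suc s) es) \<and> completed s es}))"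
    unfolding of_nat_sum[symmetric] by (rule of_nat_mono)
  also have "\<dots> \<le> (\<Sum>s<t. real L * q * real (card {es \<in> \<Omega>. buys r (take (Suc s) es)}))"
    by (rule sum_mono) (use step in auto)
  also have "\<dots> = real L * q * real (\<Sum>s<t. card {es \<in> \<Omega>. buys r (take (Suc s) es)})"
    by (simp add: sum_distrib_left)
  \<comment> \<open>Double counting of pairs of an order and a buying time. The budget limits the
    buying times of each order, so the chance of a purchase at a particular time need not be
    estimated.\<close>
  also have "(\<Sum>s<t. card {es \<in> \<Omega>. buys r (take (Suc s) es)})
      = (\<Sum>es\<in>\<Omega>. card {s \<in> {..<t}. buys r (take (Suc s) es)})"
  proof -
    have "(\<Sum>s<t. card {es \<in> \<Omega>. buys r (take (Suc s) es)})
        = (\<Sum>s<t. \<Sum>es\<in>\<Omega>. if buys r (take (Suc s) es) then 1 else 0)"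
      using fin by (simp only: card_eq_sum sum.inter_filter)
    also have "\<dots> = (\<Sum>es\<in>\<Omega>. \<Sum>s<t. if buys r (take (Suc s) es) then 1 else 0)"
      by (rule sum.swap)
    also have "\<dots> = (\<Sum>es\<in>\<Omega>. card {s \<in> {..<t}. buys r (take (Suc s) es)})"
      by (simp only: card_eq_sum sum.inter_filter finite_lessThan)
    finally show ?thesis .
  qed
  also have "\<dots> \<le> (\<Sum>es\<in>\<Omega>. b)"
  proof (rule sum_mono)
    fix es assume es: "es \<in> \<Omega>"
    then have "card (purchased r es t) = card {s \<in> {..<t}. buys r (take (Suc s) es)}"
      using card_purchased[of t es r] t permutations_of_set_list[of es S] by (simp add: \<Omega>_def)
    then show "card {s \<in> {..<t}. buys r (take (Suc s) es)} \<le> b"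
      using budget[of es] es by (simp add: \<Omega>_def)
  qed
  also have "(\<Sum>es\<in>\<Omega>. b) = fact N * b" using S by (simp add: \<Omega>_def N_def)
  finally have "real (card {es \<in> \<Omega>. \<exists>s<t. buys r (take (Suc s) es) \<and> completed s es})
      \<le> real L * q * real (fact N * b)"
    using q0 by (simp add: mult_left_mono)
  then show ?thesis
    by (simp add: completed_def \<Omega>_def N_def q_def mult_ac)
qed

section \<open>Builder graphs containing a triangle fan\<close>

lemma card_complete_edges [simp]: "card (complete_edges n) = n choose 2"
  by (simp add: complete_edges_def card_nsets)

lemma finite_complete_edges [simp]: "finite (complete_edges n)"
  by (simp add: complete_edges_def finite_imp_finite_nsets)

lemma in_complete_edges: "e \<in> complete_edges n \<longleftrightarrow> e \<subseteq> {1..n} \<and> card e = 2"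
  using finite_subset[of e "{1..n}"] by (auto simp: complete_edges_def nsets_def)

abbreviation fan_edges :: "nat \<Rightarrow> edge set" where
  "fan_edges k \<equiv> snd (triangle_fan k)"

lemma fan_edges_eq:
  "fan_edges k = (\<Union>i<k. {{0, 2 * i + 1}, {0, 2 * i + 2}, {2 * i + 1, 2 * i + 2}})"
  by (simp add: triangle_fan_def)

lemma finite_fan_edges [simp]: "finite (fan_edges k)"
  by (simp add: fan_edges_eq)

lemma fan_edgesD:
  assumes "e \<in> fan_edges k"
  shows "e \<subseteq> {0..2 * k}" "card e = 2"
  using assms by (auto simp: fan_edges_eq)

lemma card_fan_edges: "card (fan_edges k) = 3 * k"
proof -
  define T :: "nat \<Rightarrow> edge set"
    where "T i = {{0, 2 * i + 1}, {0, 2 * i + 2}, {2 * i + 1, 2 * i + 2}}" for i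
  have c: "card (T i) = 3" for i
    by (simp add: T_def doubleton_eq_iff card_insert_if)
  have "card (\<Union>i<k. T i) = (\<Sum>i<k. card (T i))"
  proof (rule card_UN_disjoint)
    show "\<forall>i\<in>{..<k}. \<forall>j\<in>{..<k}. i \<noteq> j \<longrightarrow> T i \<inter> T j = {}"
      by (auto simp: T_def doubleton_eq_iff)
  qed (auto simp: T_def)
  then show ?thesis by (simp only: c fan_edges_eq T_def[symmetric]) simp
qed

lemma in_set_drop_take:
  assumes "s \<le> j" "j < t" "t \<le> length es"
  shows "es ! j \<in> set (drop s (take t es))"
  unfolding in_set_conv_nth using assms by (intro exI[of _ "j - s"]) auto

lemma last_take_Suc: "s < length es \<Longrightarrow> last (take (Suc s) es) = es ! s"
  by (simp add: take_Suc_conv_app_nth)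

text \<open>The constant is \<open>3 * 4\<close>: one of the \<open>3 * k\<close> fan edges goes to
  \<open>e\<close>, its two ends have at most \<open>2 * 2\<close> images there, and the other
  \<open>2 * k - 1\<close> vertices are free. Maps that are not injective are counted too.\<close>

lemma card_embeddings_through_edge_le:
  assumes e: "card e = 2" and k: "k \<ge> 1"
  shows "card {f \<in> PiE {0..2 * k} (\<lambda>_. {1..n}). e \<in> image f ` fan_edges k} \<le> 12 * k * n ^ (2 * k - 1)"
    (is "card ?F \<le> _")
proof -
  have fe: "finite e" using e card.infinite by fastforce
  define P where "P \<epsilon> = PiE {0..2 * k} (\<lambda>v. if v \<in> \<epsilon> then e else {1..n})" for \<epsilon>
  have cP: "card (P \<epsilon>) = 4 * n ^ (2 * k - 1)" if \<epsilon>: "\<epsilon> \<in> fan_edges k" for \<epsilon>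
  proof -
    have "card (P \<epsilon>) = (\<Prod>v\<in>{0..2 * k}. if v \<in> \<epsilon> then 2 else n)"
      unfolding P_def by (subst card_PiE) (auto simp: e intro!: prod.cong)
    also have "\<dots> = 2 ^ card ({0..2 * k} \<inter> \<epsilon>) * n ^ card ({0..2 * k} \<inter> - \<epsilon>)"
      by (subst prod.If_cases) auto
    also have "{0..2 * k} \<inter> \<epsilon> = \<epsilon>" using fan_edgesD[OF \<epsilon>] by blast
    also have "card ({0..2 * k} \<inter> - \<epsilon>) = 2 * k - 1"
      using fan_edgesD[OF \<epsilon>] by (simp add: Diff_eq[symmetric] card_Diff_subset finite_subset)
    finally show ?thesis using fan_edgesD[OF \<epsilon>] by simp
  qed
  have "?F \<subseteq> (\<Union>\<epsilon>\<in>fan_edges k. P \<epsilon>)"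
    by (auto simp: P_def PiE_def Pi_def extensional_def)
  then have "card ?F \<le> card (\<Union>\<epsilon>\<in>fan_edges k. P \<epsilon>)"
    using fe by (intro card_mono finite_UN_I) (auto simp: P_def intro!: finite_PiE)
  also have "\<dots> \<le> (\<Sum>\<epsilon>\<in>fan_edges k. card (P \<epsilon>))" by (rule card_UN_le) simp
  also have "\<dots> = 12 * k * n ^ (2 * k - 1)" using cP by (simp add: card_fan_edges)
  finally show ?thesis .
qed

lemma card_orders_contains_fan_le_first_edge:
  assumes k: "k \<ge> 1" and t: "t + (3 * k - 1) < n choose 2"
    and budget: "\<And>es. es \<in> edge_orders n \<Longrightarrow> card (purchased r es t) \<le> b"
  shows "real (card {es \<in> edge_orders n. contains_copy (triangle_fan k) (builder_graph n r es t)})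
    \<le> real b * real (12 * k * n ^ (2 * k - 1))
       * (real t / (real (n choose 2) - real t - real (3 * k - 1))) ^ (3 * k - 1) * fact (n choose 2)"
proof -
  define Emb where "Emb e =
    {f \<in> PiE {0..2 * k} (\<lambda>_. {1..n}). inj_on f {0..2 * k} \<and> e \<in> image f ` fan_edges k}" for e
  \<comment> \<open>The possible remainders of a copy through the edge just revealed. Each has
    \<open>3 * k - 1\<close> edges, because an injective map keeps the fan edges distinct.\<close>
  define \<R> where "\<R> pre = (\<lambda>f. image f ` fan_edges k - {last pre}) ` Emb (last pre)" for pre :: "edge list"
  have finEmb: "finite (Emb e)" for e
    unfolding Emb_def by (rule finite_subset[OF _ finite_PiE[of "{0..2 * k}" "\<lambda>_. {1..n}"]]) auto
  have cimg: "card (image f ` fan_edges k) = 3 * k" if "inj_on f {0..2 * k}" for f :: "nat \<Rightarrow> nat"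
  proof -
    have "inj_on (image f) (fan_edges k)"
      using inj_on_image_Pow[OF that] by (rule inj_on_subset) (use fan_edgesD in blast)
    then show ?thesis by (simp add: card_image card_fan_edges)
  qed
  have "{es \<in> edge_orders n. contains_copy (triangle_fan k) (builder_graph n r es t)}
     \<subseteq> {es \<in> permutations_of_set (complete_edges n). \<exists>s<t. buys r (take (Suc s) es) \<and>
            (\<exists>R\<in>\<R> (take (Suc s) es). R \<subseteq> set (drop (Suc s) (take t es)))}" (is "_ \<subseteq> ?B")
  proof clarify
    fix es assume es: "es \<in> edge_orders n"
      and cc: "contains_copy (triangle_fan k) (builder_graph n r es t)"
    have es': "es \<in> permutations_of_set (complete_edges n)" using es by (simp add: edge_orders_def)
    have d: "distinct es" and l: "length es = n choose 2"
      using permutations_of_set_list[OF es'] by simp_all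
    have tl: "t \<le> length es" using l t by simp
    from cc obtain f0 where f0: "inj_on f0 {0..2 * k}" "f0 ` {0..2 * k} \<subseteq> {1..n}"
        "\<forall>e\<in>fan_edges k. f0 ` e \<in> purchased r es t"
      unfolding contains_copy_def builder_graph_def by (auto simp: triangle_fan_def)
    \<comment> \<open>The restriction is extensional, hence one of the finitely many members of
      \<open>PiE\<close>.\<close>
    define f where "f = restrict f0 {0..2 * k}"
    have inj: "inj_on f {0..2 * k}" using f0(1) by (auto simp: f_def inj_on_def)
    have fP: "f \<in> PiE {0..2 * k} (\<lambda>_. {1..n})" using f0(2) unfolding f_def by (intro restrict_PiE_iff[THEN iffD2]) auto
    define E where "E = image f ` fan_edges k"
    have E: "E \<subseteq> purchased r es t"
    proof -
      have "f ` e = f0 ` e" if "e \<in> fan_edges k" for e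
        using fan_edgesD(1)[OF that] unfolding f_def by (intro image_cong) auto
      then show ?thesis using f0(3) by (auto simp: E_def)
    qed
    have "E \<noteq> {}" using cimg[OF inj] k by (auto simp: E_def)
    then obtain e0 where "e0 \<in> E" by blast
    moreover have bought: "\<exists>s<t. buys r (take (Suc s) es) \<and> e = es ! s" if "e \<in> E" for e
      using that E unfolding purchased_eq_image[OF tl] by auto
    ultimately obtain j where j: "j < t" "es ! j \<in> E" by blast
    \<comment> \<open>First arrival of an edge of the copy. The minimum ranges over the whole order,
      but it is below \<open>t\<close> since the edge at \<open>j\<close> is.\<close>
    define s where "s = (LEAST j. es ! j \<in> E)"
    have sE: "es ! s \<in> E" and st: "s < t"
      using LeastI[of "\<lambda>j. es ! j \<in> E", OF j(2)] Least_le[of "\<lambda>j. es ! j \<in> E", OF j(2)] j(1)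
      by (auto simp: s_def)
    have "buys r (take (Suc s) es)"
    proof -
      obtain s' where "s' < t" "buys r (take (Suc s') es)" "es ! s = es ! s'"
        using bought[OF sE] by blast
      then show ?thesis using d tl st by (simp add: nth_eq_iff_index_eq)
    qed
    moreover have lst: "last (take (Suc s) es) = es ! s" using st tl by (intro last_take_Suc) simp
    have "E - {es ! s} \<in> \<R> (take (Suc s) es)"
      unfolding \<R>_def lst using inj fP sE by (auto simp: E_def Emb_def)
    moreover have "E - {es ! s} \<subseteq> set (drop (Suc s) (take t es))"
    proof
      fix e assume e: "e \<in> E - {es ! s}"
      then obtain i where i: "i < t" "e = es ! i" using bought by blast
      have "s \<le> i" using e i unfolding s_def by (intro Least_le) auto
      moreover have "i \<noteq> s" using e i by auto
      ultimately show "e \<in> set (drop (Suc s) (take t es))"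
        unfolding i(2) using i(1) tl by (intro in_set_drop_take) auto
    qed
    ultimately show "es \<in> permutations_of_set (complete_edges n) \<and> (\<exists>s<t. buys r (take (Suc s) es) \<and>
            (\<exists>R\<in>\<R> (take (Suc s) es). R \<subseteq> set (drop (Suc s) (take t es))))"
      using es' st by blast
  qed
  then have "real (card {es \<in> edge_orders n. contains_copy (triangle_fan k) (builder_graph n r es t)})
      \<le> real (card ?B)"
    by (intro of_nat_mono card_mono) auto
  also have "\<dots> \<le> real b * real (12 * k * n ^ (2 * k - 1))
       * (real t / (real (card (complete_edges n)) - real t - real (3 * k - 1))) ^ (3 * k - 1)
       * fact (card (complete_edges n))"
  proof (rule card_bought_then_completed_le)
    show "t + (3 * k - 1) < card (complete_edges n)" using t by simp
    fix es assume es: "es \<in> permutations_of_set (complete_edges n)"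
    show "card (purchased r es t) \<le> b" using budget es by (simp add: edge_orders_def)
    fix s assume s: "s < t"
    have sl: "s < length es" using s t permutations_of_set_list(3)[OF es] by simp
    have lst: "last (take (Suc s) es) = es ! s" using sl by (rule last_take_Suc)
    have "es ! s \<in> complete_edges n" using sl permutations_of_set_list(1)[OF es] by force
    then have c2: "card (es ! s) = 2" by (simp add: in_complete_edges)
    have "card (\<R> (take (Suc s) es)) \<le> card (Emb (es ! s))"
      unfolding \<R>_def lst by (rule card_image_le) (rule finEmb)
    also have "\<dots> \<le> card {f \<in> PiE {0..2 * k} (\<lambda>_. {1..n}). es ! s \<in> image f ` fan_edges k}"
      unfolding Emb_def by (intro card_mono finite_subset[OF _ finite_PiE[of "{0..2 * k}" "\<lambda>_. {1..n}"]]) auto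
    also have "\<dots> \<le> 12 * k * n ^ (2 * k - 1)"
      by (rule card_embeddings_through_edge_le[OF c2 k])
    finally show "finite (\<R> (take (Suc s) es)) \<and> card (\<R> (take (Suc s) es)) \<le> 12 * k * n ^ (2 * k - 1)"
      unfolding \<R>_def using finEmb by simp
    fix R assume "R \<in> \<R> (take (Suc s) es)"
    then obtain f where "R = image f ` fan_edges k - {es ! s}" "inj_on f {0..2 * k}"
      "es ! s \<in> image f ` fan_edges k"
      unfolding \<R>_def lst Emb_def by blast
    then show "finite R \<and> card R = 3 * k - 1" using cimg by simp
  qed simp
  finally show ?thesis by simp
qed

text \<open>A copy contains a triangle, and the second of its edges to arrive forms a path with an
  edge bought before. Hence one later edge is awaited (\<open>m = 1\<close>), and the at most
  \<open>b\<close> purchases bound the number of such paths (\<open>L = b\<close>).\<close>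

lemma card_orders_contains_fan_le_cherries:
  assumes k: "k \<ge> 1" and t: "t + 1 < n choose 2"
    and budget: "\<And>es. es \<in> edge_orders n \<Longrightarrow> card (purchased r es t) \<le> b"
  shows "real (card {es \<in> edge_orders n. contains_copy (triangle_fan k) (builder_graph n r es t)})
    \<le> real b * real b * (real t / (real (n choose 2) - real t - 1)) * fact (n choose 2)"
proof -
  \<comment> \<open>The symmetric difference of two edges with exactly one common vertex is the edge
    closing the triangle. For disjoint edges it has four elements and is not an edge, which does no
    harm.\<close>
  define \<R> where "\<R> pre = (\<lambda>e. {(last pre - e) \<union> (e - last pre)}) ` purchased r pre (length pre - 1)" for pre
  have \<R>_take: "\<R> (take (Suc s) es) = (\<lambda>e. {(es ! s - e) \<union> (e - es ! s)}) ` purchased r es s"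
    if "s < length es" for s es
  proof -
    have "length (take (Suc s) es) - 1 = s" using that by simp
    then show ?thesis unfolding \<R>_def by (simp only: last_take_Suc[OF that] purchased_take[OF le_SucI[OF order_refl]])
  qed
  have "{es \<in> edge_orders n. contains_copy (triangle_fan k) (builder_graph n r es t)}
     \<subseteq> {es \<in> permutations_of_set (complete_edges n). \<exists>s<t. buys r (take (Suc s) es) \<and>
            (\<exists>R\<in>\<R> (take (Suc s) es). R \<subseteq> set (drop (Suc s) (take t es)))}" (is "_ \<subseteq> ?B")
  proof
    fix es assume "es \<in> {es \<in> edge_orders n. contains_copy (triangle_fan k) (builder_graph n r es t)}"
    then have es: "es \<in> edge_orders n"
      and cc: "contains_copy (triangle_fan k) (builder_graph n r es t)" by auto
    have es': "es \<in> permutations_of_set (complete_edges n)" using es by (simp add: edge_orders_def)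
    have d: "distinct es" and l: "length es = n choose 2"
      using permutations_of_set_list[OF es'] by simp_all
    have tl: "t \<le> length es" using l t by simp
    from cc obtain f where f: "inj_on f {0..2 * k}" "\<forall>e\<in>fan_edges k. f ` e \<in> purchased r es t"
      unfolding contains_copy_def builder_graph_def by (auto simp: triangle_fan_def)
    have fe: "{0, 1} \<in> fan_edges k" "{0, 2} \<in> fan_edges k" "{1, 2} \<in> fan_edges k"
      using k by (auto simp: fan_edges_eq intro!: bexI[of _ 0])
    have pur: "{f 0, f 1} \<in> purchased r es t" "{f 0, f 2} \<in> purchased r es t"
        "{f 1, f 2} \<in> purchased r es t"
      using bspec[OF f(2) fe(1)] bspec[OF f(2) fe(2)] bspec[OF f(2) fe(3)] by simp_all
    have ne: "f 0 \<noteq> f 1" "f 0 \<noteq> f 2" "f 1 \<noteq> f 2" using k by (auto simp: inj_on_eq_iff[OF f(1)])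
    have bought: "\<exists>s<t. buys r (take (Suc s) es) \<and> e = es ! s" if "e \<in> purchased r es t" for e
      using that unfolding purchased_eq_image[OF tl] by auto
    obtain x where x: "x < t" "buys r (take (Suc x) es)" "es ! x = {f 0, f 1}" using bought[OF pur(1)] by metis
    obtain y where y: "y < t" "buys r (take (Suc y) es)" "es ! y = {f 0, f 2}" using bought[OF pur(2)] by metis
    obtain z where z: "z < t" "buys r (take (Suc z) es)" "es ! z = {f 1, f 2}" using bought[OF pur(3)] by metis
    \<comment> \<open>Here \<open>i\<close>, \<open>j\<close>, \<open>m\<close> are the arrival
      times of the three edges in increasing order; each of the six possible orders below is an
      instance.\<close>
    have key: "es \<in> ?B" if "i < j" "j < m" "m < t" "buys r (take (Suc i) es)" "buys r (take (Suc j) es)"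
      "(es ! j - es ! i) \<union> (es ! i - es ! j) = es ! m" for i j m
    proof -
      have "es ! i \<in> purchased r es j"
        using that tl purchased_eq_image[of j es r] by auto
      then have "{es ! m} \<in> \<R> (take (Suc j) es)"
        using that tl by (subst \<R>_take) auto
      moreover have "{es ! m} \<subseteq> set (drop (Suc j) (take t es))"
        using in_set_drop_take[of "Suc j" m t es] that tl by simp
      moreover have "j < t" using that(2,3) by simp
      ultimately show ?thesis using that(5) es' by blast
    qed
    have "x \<noteq> y" "x \<noteq> z" "y \<noteq> z"
      using x(3) y(3) z(3) ne by (auto simp: doubleton_eq_iff)
    then consider "x < y" "y < z" | "x < z" "z < y" | "y < x" "x < z" | "y < z" "z < x" | "z < x" "x < y" | "z < y" "y < x"
      by linarith
    then show "es \<in> ?B"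
    proof cases
      case 1 then show ?thesis by (rule key) (use x y z ne in auto)
    next
      case 2 then show ?thesis by (rule key) (use x y z ne in auto)
    next
      case 3 then show ?thesis by (rule key) (use x y z ne in auto)
    next
      case 4 then show ?thesis by (rule key) (use x y z ne in auto)
    next
      case 5 then show ?thesis by (rule key) (use x y z ne in auto)
    next
      case 6 then show ?thesis by (rule key) (use x y z ne in auto)
    qed
  qed
  then have "real (card {es \<in> edge_orders n. contains_copy (triangle_fan k) (builder_graph n r es t)})
      \<le> real (card ?B)"
    by (intro of_nat_mono card_mono) auto
  also have "\<dots> \<le> real b * real b
       * (real t / (real (card (complete_edges n)) - real t - real 1)) ^ 1
       * fact (card (complete_edges n))"
  proof (rule card_bought_then_completed_le)
    show "t + 1 < card (complete_edges n)" using t by simp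
    fix es assume es: "es \<in> permutations_of_set (complete_edges n)"
    show b: "card (purchased r es t) \<le> b" using budget es by (simp add: edge_orders_def)
    fix s assume s: "s < t"
    have sl: "s < length es" using s t permutations_of_set_list(3)[OF es] by simp
    have "card (\<R> (take (Suc s) es)) \<le> card (purchased r es s)"
      unfolding \<R>_take[OF sl] by (rule card_image_le) simp
    also have "\<dots> \<le> card (purchased r es t)"
      using s by (intro card_mono purchased_mono) auto
    finally show "finite (\<R> (take (Suc s) es)) \<and> card (\<R> (take (Suc s) es)) \<le> b"
      using b by (simp add: \<R>_take[OF sl])
    fix R assume "R \<in> \<R> (take (Suc s) es)"
    then show "finite R \<and> card R = 1" by (auto simp: \<R>_take[OF sl])
  qed simp
  finally show ?thesis by simp
qed

text \<open>A randomized strategy is a mixture of deterministic rules. Exchanging the two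
  independent draws puts the rule first, and a bound uniform in the rule survives averaging.\<close>

lemma prob_contains_le:
  assumes c: "c \<ge> 0"
    and *: "\<And>r. r \<in> set_pmf S \<Longrightarrow>
      real (card {es \<in> edge_orders n. contains_copy H (builder_graph n r es t)}) \<le> c * fact (n choose 2)"
  shows "prob_contains H n t S \<le> c"
proof -
  let ?X = "{(es, r). contains_copy H (builder_graph n r es t)}"
  let ?A = "pmf_of_set (edge_orders n)"
  have fin: "finite (edge_orders n)" "edge_orders n \<noteq> {}"
    and cardO: "card (edge_orders n) = fact (n choose 2)"
    by (simp_all add: edge_orders_def)
  have "pair_pmf ?A S = bind_pmf S (\<lambda>r. map_pmf (\<lambda>es. (es, r)) ?A)"
    unfolding pair_pmf_def map_pmf_def by (rule bind_commute_pmf)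
  then have "emeasure (measure_pmf (pair_pmf ?A S)) ?X
      = (\<integral>\<^sup>+r. emeasure (map_pmf (\<lambda>es. (es, r)) ?A) ?X \<partial>S)"
    by simp
  also have "\<dots> \<le> (\<integral>\<^sup>+r. ennreal c \<partial>S)"
  proof (intro nn_integral_mono_AE, unfold AE_measure_pmf_iff, intro ballI)
    fix r assume r: "r \<in> set_pmf S"
    have "emeasure (map_pmf (\<lambda>es. (es, r)) ?A) ?X
        = ennreal (measure ?A {es. contains_copy H (builder_graph n r es t)})"
      by (simp add: measure_pmf.emeasure_eq_measure vimage_def)
    also have "measure ?A {es. contains_copy H (builder_graph n r es t)}
        = real (card {es \<in> edge_orders n. contains_copy H (builder_graph n r es t)}) / fact (n choose 2)"
      using fin by (simp add: measure_pmf_of_set cardO Int_def)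
    also have "ennreal \<dots> \<le> ennreal c"
      using *[OF r] by (intro ennreal_leI) (simp add: divide_le_eq)
    finally show "emeasure (map_pmf (\<lambda>es. (es, r)) ?A) ?X \<le> ennreal c" .
  qed
  also have "\<dots> = ennreal c" by simp
  finally show ?thesis
    using c by (simp add: prob_contains_def measure_pmf.emeasure_eq_measure)
qed

section \<open>The zero statement\<close>

lemma real_choose_two_ge:
  assumes "n \<ge> 2"
  shows "real n ^ 2 / 4 \<le> real (n choose 2)"
proof -
  have "real (n choose 2) = real n * (real n - 1) / 2"
    using assms by (simp add: choose_two real_of_nat_div of_nat_diff)
  moreover have "real n * real n \<le> real n * (2 * (real n - 1))"
    using assms by (intro mult_left_mono) auto
  ultimately show ?thesis by (simp add: power2_eq_square algebra_simps)
qed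

lemma prob_contains_fan_le_sparse:
  assumes k: "k \<ge> 1" and n: "n \<ge> 7 * k" and t: "16 * real t \<le> real n ^ 2"
    and S: "tb_strategy n t b S"
  shows "prob_contains (triangle_fan k) n t S
           \<le> real (12 * k) * 8 ^ (3 * k - 1) * (real b * real t ^ (3 * k - 1) / real n ^ (4 * k - 1))"
      (is ?first)
    and "prob_contains (triangle_fan k) n t S \<le> 8 * (real b ^ 2 * real t / real n ^ 2)" (is ?cherries)
proof -
  define N where "N = n choose 2"
  have n0: "real n > 0" "n \<ge> 2" using n k by auto
  have N: "real n ^ 2 / 4 \<le> real N" unfolding N_def using n0 by (intro real_choose_two_ge)
  have nk: "16 * real (3 * k) \<le> real n ^ 2"
  proof -
    have "48 * k \<le> (7 * k) ^ 2" using k by (simp add: power2_eq_square)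
    also have "\<dots> \<le> n ^ 2" using n by (rule power_mono) simp
    finally have "real (48 * k) \<le> real (n ^ 2)" by (rule of_nat_mono)
    then show ?thesis by simp
  qed
  \<comment> \<open>Of at least \<open>n^2 / 4\<close> edges, \<open>t\<close> and \<open>m\<close>
    each take away at most \<open>n^2 / 16\<close>. For \<open>m\<close> this rests on
    \<open>n \<ge> 7 * k\<close> and \<open>48 * k \<le> 49 * k^2\<close>.\<close>
  have gap: "real n ^ 2 / 8 \<le> real N - real t - real m" if "m \<le> 3 * k" for m
  proof -
    have "real m \<le> real (3 * k)" using that by (rule of_nat_mono)
    then show ?thesis using N t nk by linarith
  qed
  have lt: "t + m < N" if "m \<le> 3 * k" for m
  proof -
    have "real n ^ 2 / 8 > 0" using n0 by simp
    then have "real (t + m) < real N" using gap[OF that] unfolding of_nat_add by linarith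
    then show ?thesis by linarith
  qed
  have quot: "real t / (real N - real t - real m) \<le> 8 * real t / real n ^ 2" if "m \<le> 3 * k" for m
  proof -
    have "real t / (real N - real t - real m) \<le> real t / (real n ^ 2 / 8)"
      using n0 by (intro frac_le gap[OF that]) auto
    then show ?thesis by (simp add: mult.commute)
  qed
  have quot0: "0 \<le> real t / (real N - real t - real m)" if "m \<le> 3 * k" for m
    by (rule divide_nonneg_nonneg) (use order_trans[OF _ gap[OF that], of 0] in auto)
  show ?first
  proof (rule prob_contains_le)
    fix r assume r: "r \<in> set_pmf S"
    have "real (card {es \<in> edge_orders n. contains_copy (triangle_fan k) (builder_graph n r es t)})
      \<le> real b * real (12 * k * n ^ (2 * k - 1))
       * (real t / (real N - real t - real (3 * k - 1))) ^ (3 * k - 1) * fact N"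
      unfolding N_def using S r lt[of "3 * k - 1"] k
      by (intro card_orders_contains_fan_le_first_edge) (auto simp: tb_strategy_def N_def)
    also have "\<dots> \<le> real b * real (12 * k * n ^ (2 * k - 1))
       * (8 * real t / real n ^ 2) ^ (3 * k - 1) * fact N"
      by (intro mult_right_mono mult_left_mono power_mono quot quot0) auto
    also have "real b * real (12 * k * n ^ (2 * k - 1)) * (8 * real t / real n ^ 2) ^ (3 * k - 1)
      = real (12 * k) * 8 ^ (3 * k - 1) * (real b * real t ^ (3 * k - 1) / real n ^ (4 * k - 1))"
    proof -
      have "(real n ^ 2) ^ (3 * k - 1) = real n ^ (2 * k - 1) * real n ^ (4 * k - 1)"
        unfolding power_mult[symmetric] power_add[symmetric] using k
        by (intro arg_cong[where f = "\<lambda>i. real n ^ i"]) auto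
      then show ?thesis using n0 by (simp add: power_divide power_mult_distrib)
    qed
    finally show "real (card {es \<in> edge_orders n. contains_copy (triangle_fan k) (builder_graph n r es t)})
      \<le> real (12 * k) * 8 ^ (3 * k - 1) * (real b * real t ^ (3 * k - 1) / real n ^ (4 * k - 1)) * fact (n choose 2)"
      by (simp only: N_def)
  qed simp
  show ?cherries
  proof (rule prob_contains_le)
    fix r assume r: "r \<in> set_pmf S"
    have "real (card {es \<in> edge_orders n. contains_copy (triangle_fan k) (builder_graph n r es t)})
      \<le> real b * real b * (real t / (real N - real t - 1)) * fact N"
      unfolding N_def using S r lt[of 1] k
      by (intro card_orders_contains_fan_le_cherries) (auto simp: tb_strategy_def N_def)
    also have "\<dots> \<le> real b * real b * (8 * real t / real n ^ 2) * fact N"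
      using quot[of 1] k by (intro mult_right_mono mult_left_mono) auto
    finally show "real (card {es \<in> edge_orders n. contains_copy (triangle_fan k) (builder_graph n r es t)})
      \<le> 8 * (real b ^ 2 * real t / real n ^ 2) * fact (n choose 2)"
      by (simp add: N_def power2_eq_square mult_ac)
  qed simp
qed

lemma tb_strategy_trivial_budget:
  assumes "t \<le> n choose 2"
  shows "tb_strategy n t t S"
  unfolding tb_strategy_def
proof (intro ballI)
  fix r es assume "es \<in> edge_orders n"
  then have "length es = n choose 2" using permutations_of_set_list(3)[of es] by (simp add: edge_orders_def)
  then have "card (purchased r es t) \<le> card (set (take t es))"
    using assms by (intro card_mono purchased_subset_take) auto
  also have "\<dots> \<le> length (take t es)" by (rule card_length)
  finally show "card (purchased r es t) \<le> t" by simp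
qed

lemma prob_contains_fan_no_budget:
  assumes k: "k \<ge> 1" and S: "tb_strategy n t 0 S"
  shows "prob_contains (triangle_fan k) n t S \<le> 0"
proof (rule prob_contains_le)
  fix r assume r: "r \<in> set_pmf S"
  have "\<not> contains_copy (triangle_fan k) (builder_graph n r es t)" if "es \<in> edge_orders n" for es
  proof -
    have "card (purchased r es t) \<le> 0" using S r that by (auto simp: tb_strategy_def)
    then have "purchased r es t = {}" by simp
    moreover have "fan_edges k \<noteq> {}" using card_fan_edges[of k] k by auto
    ultimately show ?thesis by (auto simp: contains_copy_def builder_graph_def)
  qed
  then have "{es \<in> edge_orders n. contains_copy (triangle_fan k) (builder_graph n r es t)} = {}" by blast
  then show "real (card {es \<in> edge_orders n. contains_copy (triangle_fan k) (builder_graph n r es t)})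
      \<le> 0 * fact (n choose 2)" by (simp only: card.empty)
qed simp

lemma prob_contains_tendsto_0I:
  assumes "eventually (\<lambda>n. prob_contains H n (t n) (B n) \<le> g n) sequentially" "g \<longlonglongrightarrow> 0"
  shows "(\<lambda>n. prob_contains H n (t n) (B n)) \<longlonglongrightarrow> 0"
  by (rule tendsto_sandwich[OF _ assms(1) tendsto_const assms(2)]) (simp add: prob_contains_def)

text \<open>The fractional exponent enters the estimates only through this power, where it becomes
  an integer.\<close>

lemma powr_threshold_power:
  assumes "k \<ge> 1" "n > 0"
  shows "(real n powr ((4 * real k - 1) / (3 * real k))) ^ (3 * k) = real n ^ (4 * k - 1)"
proof -
  have "(real n powr ((4 * real k - 1) / (3 * real k))) ^ (3 * k)
      = real n powr ((4 * real k - 1) / (3 * real k) * real (3 * k))"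
    using assms by (simp add: powr_realpow[symmetric] powr_powr)
  also have "(4 * real k - 1) / (3 * real k) * real (3 * k) = real (4 * k - 1)"
    using assms by (simp add: of_nat_diff)
  also have "real n powr \<dots> = real n ^ (4 * k - 1)" using assms by (intro powr_realpow) simp
  finally show ?thesis .
qed

lemma prob_contains_fan_tendsto_0_few_edges:
  assumes k: "k \<ge> 1" and t: "\<forall>n. t n \<le> n choose 2"
    and o: "is_little_o (\<lambda>n. real (t n)) (\<lambda>n. real n powr ((4 * real k - 1) / (3 * real k)))"
  shows "(\<lambda>n. prob_contains (triangle_fan k) n (t n) (B n)) \<longlonglongrightarrow> 0"
proof -
  define x where "x n = real (t n) / real n powr ((4 * real k - 1) / (3 * real k))" for n
  have x: "x \<longlonglongrightarrow> 0" using o by (simp add: is_little_o_def x_def[abs_def])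
  have "eventually (\<lambda>n. prob_contains (triangle_fan k) n (t n) (B n)
      \<le> real (12 * k) * 8 ^ (3 * k - 1) * x n ^ (3 * k)) sequentially"
    using eventually_ge_at_top[of "7 * k"] order_tendstoD(2)[OF x, of "1 / 16", simplified]
  proof eventually_elim
    case (elim n)
    have n0: "n > 0" using elim k by simp
    \<comment> \<open>The threshold exponent is below 2, so \<open>t\<close> of smaller order than
      the threshold is eventually sparse enough for the bound.\<close>
    have "real n powr ((4 * real k - 1) / (3 * real k)) \<le> real n powr 2"
      using n0 k by (intro powr_mono) (auto simp: field_simps)
    also have "\<dots> = real n ^ 2" using n0 by (simp add: powr_numeral)
    finally have le: "real n powr ((4 * real k - 1) / (3 * real k)) \<le> real n ^ 2" .
    have "16 * real (t n) < real n powr ((4 * real k - 1) / (3 * real k))"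
      using elim(2) n0 by (simp add: x_def divide_less_eq)
    then have t16: "16 * real (t n) \<le> real n ^ 2" using le by linarith
    have "prob_contains (triangle_fan k) n (t n) (B n)
        \<le> real (12 * k) * 8 ^ (3 * k - 1) * (real (t n) * real (t n) ^ (3 * k - 1) / real n ^ (4 * k - 1))"
      using t by (intro prob_contains_fan_le_sparse(1)[OF k elim(1) t16] tb_strategy_trivial_budget) auto
    also have "real (t n) * real (t n) ^ (3 * k - 1) = real (t n) ^ (3 * k)"
      using k by (simp add: power_eq_if)
    also have "real (t n) ^ (3 * k) / real n ^ (4 * k - 1) = x n ^ (3 * k)"
      by (simp only: x_def power_divide powr_threshold_power[OF k n0])
    finally show ?case .
  qed
  moreover have "(\<lambda>n. real (12 * k) * 8 ^ (3 * k - 1) * x n ^ (3 * k)) \<longlonglongrightarrow> 0"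
  proof -
    have "(\<lambda>n. real (12 * k) * 8 ^ (3 * k - 1) * x n ^ (3 * k))
        \<longlonglongrightarrow> real (12 * k) * 8 ^ (3 * k - 1) * 0 ^ (3 * k)"
      by (intro tendsto_intros x)
    then show ?thesis using k by (simp add: power_0_left)
  qed
  ultimately show ?thesis by (rule prob_contains_tendsto_0I)
qed

text \<open>For sparse \<open>t\<close> the larger term of \<open>b_star\<close> decides which of
  the two bounds applies. If \<open>t\<close> exceeds \<open>n^2 / 16\<close>, then
  \<open>b_star\<close> is at most a constant, so a budget of smaller order is eventually 0.\<close>

lemma prob_contains_fan_tendsto_0_small_budget:
  assumes k: "k \<ge> 1"
    and o: "is_little_o (\<lambda>n. real (b n)) (\<lambda>n. b_star n (t n) k)"
    and B: "\<forall>n. tb_strategy n (t n) (b n) (B n)"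
  shows "(\<lambda>n. prob_contains (triangle_fan k) n (t n) (B n)) \<longlonglongrightarrow> 0"
proof -
  define x where "x n = real (b n) / b_star n (t n) k" for n
  have x: "x \<longlonglongrightarrow> 0" using o by (simp add: is_little_o_def x_def[abs_def])
  define C where "C = real (12 * k) * 8 ^ (3 * k - 1)"
  have C0: "C \<ge> 0" by (simp add: C_def)
  have "eventually (\<lambda>n. prob_contains (triangle_fan k) n (t n) (B n) \<le> C * \<bar>x n\<bar> + 8 * x n ^ 2) sequentially"
    \<comment> \<open>The reciprocal of the bound on \<open>b_star\<close> for dense
      \<open>t\<close>: below it, \<open>b n < 1\<close>.\<close>
    using eventually_ge_at_top[of "7 * k"] order_tendstoD(2)[OF x, of "1 / 16 ^ (3 * k - 1)", simplified]
  proof eventually_elim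
    case (elim n)
    have n0: "real n \<ge> 1" using elim k by simp
    have S: "tb_strategy n (t n) (b n) (B n)" using B by blast
    define P where "P = prob_contains (triangle_fan k) n (t n) (B n)"
    show ?case
    \<comment> \<open>Here \<open>b_star\<close> and \<open>x n\<close> are 0 by the convention on
      division. The first bound still gives 0, as its factor \<open>t ^ (3 * k - 1)\<close> has a
      positive exponent.\<close>
    proof (cases "t n = 0")
      case True
      then have "P \<le> 0"
        unfolding P_def using prob_contains_fan_le_sparse(1)[OF k elim(1) _ S] k by (simp add: power_0_left)
      then show ?thesis using C0 unfolding P_def by (smt (verit) mult_nonneg_nonneg abs_ge_zero zero_le_power2)
    next
      case False
      define u where "u = real n ^ (4 * k - 1) / real (t n) ^ (3 * k - 1)"
      define v where "v = real n / sqrt (real (t n))"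
      have u0: "u > 0" and v0: "v > 0" using False n0 by (auto simp: u_def v_def)
      have bs: "b_star n (t n) k = max u v" by (simp add: b_star_def u_def v_def)
      have b: "real (b n) = x n * max u v" using u0 by (simp add: x_def bs)
      have x0: "x n \<ge> 0" using u0 by (simp add: x_def bs)
      show ?thesis
      proof (cases "16 * real (t n) \<le> real n ^ 2")
        case sparse: True
        show ?thesis
        proof (cases "v \<le> u")
          case True
          have "P \<le> C * (real (b n) / u)"
            using prob_contains_fan_le_sparse(1)[OF k elim(1) sparse S] by (simp add: P_def C_def u_def)
          also have "real (b n) / u = x n" using True u0 by (simp add: b)
          finally have "P \<le> C * x n" .
          then show ?thesis using x0 unfolding P_def by (smt (verit) zero_le_power2)
        next
          case False
          have "v ^ 2 = real n ^ 2 / real (t n)" by (simp add: v_def power_divide)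
          then have "P \<le> 8 * (real (b n) ^ 2 / v ^ 2)"
            using prob_contains_fan_le_sparse(2)[OF k elim(1) sparse S] by (simp add: P_def)
          also have "real (b n) ^ 2 / v ^ 2 = x n ^ 2" using False v0 by (simp add: b power_mult_distrib)
          finally have "P \<le> 8 * x n ^ 2" .
          then show ?thesis using x0 C0 unfolding P_def by (smt (verit) mult_nonneg_nonneg)
        qed
      next
        case dense: False
        have k3: "3 * k - 1 \<ge> 1" using k by simp
        have "u \<le> 16 ^ (3 * k - 1)"
        proof -
          have "real n ^ (4 * k - 1) \<le> real n ^ (2 * (3 * k - 1))"
            using n0 k by (intro power_increasing) auto
          also have "\<dots> = (real n ^ 2) ^ (3 * k - 1)" by (rule power_mult)
          also have "\<dots> \<le> (16 * real (t n)) ^ (3 * k - 1)" using dense by (intro power_mono) auto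
          finally show ?thesis using False by (simp add: u_def divide_le_eq power_mult_distrib)
        qed
        moreover have "v \<le> 16 ^ (3 * k - 1)"
        proof -
          have "real n = sqrt (real n ^ 2)" by simp
          also have "\<dots> \<le> sqrt (16 * real (t n))" using dense by (intro real_sqrt_le_mono) auto
          also have "\<dots> = 4 * sqrt (real (t n))" by (simp add: real_sqrt_mult)
          finally have "v \<le> 4" using False by (simp add: v_def divide_le_eq)
          also have "(4::real) \<le> 16 ^ 1" by simp
          also have "(16::real) ^ 1 \<le> 16 ^ (3 * k - 1)" using k3 by (intro power_increasing) auto
          finally show ?thesis .
        qed
        ultimately have "max u v \<le> 16 ^ (3 * k - 1)" by simp
        then have "real (b n) \<le> x n * 16 ^ (3 * k - 1)" unfolding b using x0 by (intro mult_left_mono)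
        also have "\<dots> < 1" using elim(2) by (simp add: field_simps)
        finally have "b n = 0" by simp
        then have "P \<le> 0" unfolding P_def using prob_contains_fan_no_budget[OF k] S by simp
        then show ?thesis using C0 unfolding P_def by (smt (verit) mult_nonneg_nonneg abs_ge_zero zero_le_power2)
      qed
    qed
  qed
  moreover have "(\<lambda>n. C * \<bar>x n\<bar> + 8 * x n ^ 2) \<longlonglongrightarrow> 0"
  proof -
    have "(\<lambda>n. C * \<bar>x n\<bar> + 8 * x n ^ 2) \<longlonglongrightarrow> C * \<bar>0\<bar> + 8 * 0 ^ 2"
      by (intro tendsto_intros x)
    then show ?thesis by simp
  qed
  ultimately show ?thesis by (rule prob_contains_tendsto_0I)
qed

section \<open>Fans on centres and blocks\<close>

locale centres_and_blocks =
  fixes k n \<rho> w :: nat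
  assumes k: "k \<ge> 1" and fits: "\<rho> + 2 * k * w \<le> n"
begin

text \<open>Intervals above the centres \<open>1, ..., \<rho>\<close>, increasing in
  \<open>j\<close>, so that comparing vertices by size decides which edges can coincide.\<close>

definition block :: "nat \<Rightarrow> nat set" where
  "block j = {\<rho> + j * w <.. \<rho> + Suc j * w}"

definition pairs :: "nat \<Rightarrow> (nat \<times> nat) set" where
  "pairs i = block (2 * i) \<times> block (2 * i + 1)"

definition triangle :: "nat \<Rightarrow> nat \<times> nat \<Rightarrow> edge set" where
  "triangle c p = {{c, fst p}, {c, snd p}, {fst p, snd p}}"

text \<open>A product set: a sum over it of products over \<open>i\<close> becomes, for each centre,
  a product of sums over \<open>pairs i\<close>.\<close>

definition fans :: "(nat \<times> (nat \<Rightarrow> nat \<times> nat)) set" where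
  "fans = {1..\<rho>} \<times> PiE {..<k} pairs"

definition edges_of :: "nat \<times> (nat \<Rightarrow> nat \<times> nat) \<Rightarrow> edge set" where
  "edges_of \<kappa> = (\<Union>i<k. triangle (fst \<kappa>) (snd \<kappa> i))"

lemma card_block [simp]: "card (block j) = w"
  by (simp add: block_def)

lemma finite_block [simp]: "finite (block j)"
  by (simp add: block_def)

lemma card_pairs [simp]: "card (pairs i) = w * w"
  by (simp add: pairs_def card_cartesian_product)

lemma finite_pairs [simp]: "finite (pairs i)"
  by (simp add: pairs_def)

lemma block_gt: "x \<in> block j \<Longrightarrow> \<rho> < x"
  by (auto simp: block_def)

lemma block_less:
  assumes "i < j" "x \<in> block i" "y \<in> block j"
  shows "x < y"
proof -
  have "Suc i * w \<le> j * w" using assms(1) by (intro mult_right_mono) auto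
  then show ?thesis using assms by (auto simp: block_def)
qed

lemma block_disjoint:
  assumes "x \<in> block i" "x \<in> block j"
  shows "i = j"
  using block_less[of i j x x] block_less[of j i x x] assms by (metis less_irrefl nat_neq_iff)

lemma block_le:
  assumes "j < 2 * k" "x \<in> block j"
  shows "x \<le> n"
proof -
  have "Suc j * w \<le> 2 * k * w" using assms(1) by (intro mult_right_mono) auto
  then show ?thesis using assms fits by (auto simp: block_def)
qed

lemma card_fans: "card fans = \<rho> * (w * w) ^ k"
  by (simp add: fans_def card_cartesian_product card_PiE)

lemma finite_fans [simp]: "finite fans"
  by (simp add: fans_def finite_PiE)

lemma pairsD:
  assumes "p \<in> pairs i" "c \<le> \<rho>"
  shows "c < fst p" "fst p < snd p"
  using assms block_gt[of "fst p" "2 * i"] block_less[of "2 * i" "2 * i + 1" "fst p" "snd p"]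
  by (auto simp: pairs_def mem_Times_iff)

lemma finite_triangle [simp]: "finite (triangle c p)"
  by (simp add: triangle_def)

lemma card_triangle:
  assumes "p \<in> pairs i" "c \<le> \<rho>"
  shows "card (triangle c p) = 3"
proof -
  have "{c, fst p} \<noteq> {c, snd p}" "{c, fst p} \<noteq> {fst p, snd p}" "{c, snd p} \<noteq> {fst p, snd p}"
    using pairsD[OF assms] by (auto simp: doubleton_eq_iff)
  then show ?thesis by (simp add: triangle_def)
qed

lemma triangle_subset:
  assumes "p \<in> pairs i" "c \<in> {1..\<rho>}" "i < k"
  shows "triangle c p \<subseteq> complete_edges n"
proof -
  have p: "fst p \<in> block (2 * i)" "snd p \<in> block (2 * i + 1)" using assms by (auto simp: pairs_def)
  have "fst p \<le> n" "snd p \<le> n"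
    using block_le[OF _ p(1)] block_le[OF _ p(2)] assms(3) by auto
  then show ?thesis
    using pairsD[OF assms(1), of c] assms(2)
    by (auto simp: triangle_def in_complete_edges)
qed

text \<open>Every edge of a triangle has an end in its own pair of blocks, and the other pair of
  blocks and the centres avoid that end. Parity separates block \<open>2 * i\<close> from block
  \<open>2 * j + 1\<close>.\<close>

lemma triangle_disjoint:
  assumes "p \<in> pairs i" "p' \<in> pairs j" "i \<noteq> j" "c \<le> \<rho>" "c' \<le> \<rho>"
  shows "triangle c p \<inter> triangle c' p' = {}"
proof -
  have *: "fst p \<in> block (2 * i)" "snd p \<in> block (2 * i + 1)" "fst p' \<in> block (2 * j)" "snd p' \<in> block (2 * j + 1)"
    using assms by (auto simp: pairs_def)
  have "fst p \<noteq> fst p'" using block_disjoint[OF *(1)] *(3) assms(3) by fastforce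
  moreover have "fst p \<noteq> snd p'" using block_disjoint[OF *(1)] *(4) by (metis even_Suc even_mult_iff even_numeral Suc_eq_plus1)
  moreover have "snd p \<noteq> fst p'" using block_disjoint[OF *(2)] *(3) by (metis even_Suc even_mult_iff even_numeral Suc_eq_plus1)
  moreover have "snd p \<noteq> snd p'" using block_disjoint[OF *(2)] *(4) assms(3) by fastforce
  ultimately show ?thesis
    using pairsD[OF assms(1), of c'] pairsD[OF assms(2), of c] assms(4,5) pairsD[OF assms(1), of c] pairsD[OF assms(2), of c']
    by (auto simp: triangle_def doubleton_eq_iff)
qed

lemma fansD:
  assumes "\<kappa> \<in> fans"
  shows "fst \<kappa> \<in> {1..\<rho>}" "fst \<kappa> \<le> \<rho>" "i < k \<Longrightarrow> snd \<kappa> i \<in> pairs i"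
  using assms by (auto simp: fans_def PiE_def Pi_def)

lemma finite_edges_of [simp]: "finite (edges_of \<kappa>)"
  by (simp add: edges_of_def)

lemma edges_of_subset:
  assumes "\<kappa> \<in> fans"
  shows "edges_of \<kappa> \<subseteq> complete_edges n"
  unfolding edges_of_def using triangle_subset[OF fansD(3)[OF assms] fansD(1)[OF assms]] by blast

lemma card_edges_of:
  assumes "\<kappa> \<in> fans"
  shows "card (edges_of \<kappa>) = 3 * k"
proof -
  have "card (edges_of \<kappa>) = (\<Sum>i<k. card (triangle (fst \<kappa>) (snd \<kappa> i)))"
    unfolding edges_of_def
  proof (rule card_UN_disjoint)
    show "\<forall>i\<in>{..<k}. \<forall>j\<in>{..<k}. i \<noteq> j \<longrightarrow>
       triangle (fst \<kappa>) (snd \<kappa> i) \<inter> triangle (fst \<kappa>) (snd \<kappa> j) = {}"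
      using triangle_disjoint[OF fansD(3)[OF assms] fansD(3)[OF assms]] fansD(2)[OF assms] by simp
  qed auto
  also have "\<dots> = (\<Sum>i<k. 3)"
    by (rule sum.cong[OF refl], rule card_triangle[OF fansD(3)[OF assms] fansD(2)[OF assms]]) simp
  finally show ?thesis by simp
qed

section \<open>Overlaps of two fans\<close>

definition new_edges :: "nat \<Rightarrow> nat \<times> nat \<Rightarrow> nat \<Rightarrow> nat \<times> nat \<Rightarrow> nat" where
  "new_edges c p c' p' = card (triangle c' p' - triangle c p)"

text \<open>Only triangles over the same pair of blocks can share edges, so the edges added by the
  second fan may be counted for each \<open>i\<close> separately. This turns \<open>q ^ card\<close>
  of the union into a product over \<open>i\<close>.\<close>

lemma card_edges_of_Un:
  assumes \<kappa>: "\<kappa> \<in> fans" and \<kappa>': "\<kappa>' \<in> fans"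
  shows "card (edges_of \<kappa> \<union> edges_of \<kappa>')
    = 3 * k + (\<Sum>i<k. new_edges (fst \<kappa>) (snd \<kappa> i) (fst \<kappa>') (snd \<kappa>' i))"
proof -
  have "edges_of \<kappa>' - edges_of \<kappa>
      = (\<Union>i<k. triangle (fst \<kappa>') (snd \<kappa>' i) - triangle (fst \<kappa>) (snd \<kappa> i))" (is "_ = ?R")
  proof (intro equalityI subsetI)
    fix e assume "e \<in> ?R"
    then obtain i where i: "i < k" "e \<in> triangle (fst \<kappa>') (snd \<kappa>' i)" "e \<notin> triangle (fst \<kappa>) (snd \<kappa> i)"
      by blast
    have "e \<notin> triangle (fst \<kappa>) (snd \<kappa> j)" if "j < k" for j
    proof (cases "j = i")
      case False
      then show ?thesis
        using triangle_disjoint[OF fansD(3)[OF \<kappa> that] fansD(3)[OF \<kappa>' i(1)] False fansD(2)[OF \<kappa>] fansD(2)[OF \<kappa>']] i(2)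
        by blast
    qed (use i in simp)
    then show "e \<in> edges_of \<kappa>' - edges_of \<kappa>" using i by (auto simp: edges_of_def)
  qed (auto simp: edges_of_def)
  moreover have "card ?R = (\<Sum>i<k. new_edges (fst \<kappa>) (snd \<kappa> i) (fst \<kappa>') (snd \<kappa>' i))"
    unfolding new_edges_def
  proof (rule card_UN_disjoint)
    show "\<forall>i\<in>{..<k}. \<forall>j\<in>{..<k}. i \<noteq> j \<longrightarrow>
       (triangle (fst \<kappa>') (snd \<kappa>' i) - triangle (fst \<kappa>) (snd \<kappa> i)) \<inter>
       (triangle (fst \<kappa>') (snd \<kappa>' j) - triangle (fst \<kappa>) (snd \<kappa> j)) = {}"
    proof (intro ballI impI)
      fix i j assume "i \<in> {..<k}" "j \<in> {..<k}" "i \<noteq> j"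
      then show "(triangle (fst \<kappa>') (snd \<kappa>' i) - triangle (fst \<kappa>) (snd \<kappa> i)) \<inter>
       (triangle (fst \<kappa>') (snd \<kappa>' j) - triangle (fst \<kappa>) (snd \<kappa> j)) = {}"
        using triangle_disjoint[of "snd \<kappa>' i" i "snd \<kappa>' j" j "fst \<kappa>'" "fst \<kappa>'"] fansD[OF \<kappa>'] by blast
    qed
  qed auto
  moreover have "edges_of \<kappa> \<union> edges_of \<kappa>' = edges_of \<kappa> \<union> (edges_of \<kappa>' - edges_of \<kappa>)" by blast
  ultimately show ?thesis
    using card_edges_of[OF \<kappa>] by (metis Diff_disjoint card_Un_disjoint finite_Diff finite_edges_of)
qed

text \<open>At a common centre, two triangles with exactly one common block vertex share only the
  edge from the centre to it; without a common block vertex they share no edge.\<close>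

lemma new_edges_same_centre:
  assumes p: "p \<in> pairs i" and p': "p' \<in> pairs i" and c: "c \<le> \<rho>"
  shows "fst p' = fst p \<Longrightarrow> snd p' \<noteq> snd p \<Longrightarrow> 2 \<le> new_edges c p c p'"
    and "fst p' \<noteq> fst p \<Longrightarrow> snd p' = snd p \<Longrightarrow> 2 \<le> new_edges c p c p'"
    and "fst p' \<noteq> fst p \<Longrightarrow> snd p' \<noteq> snd p \<Longrightarrow> 3 \<le> new_edges c p c p'"
proof -
  have *: "fst p \<in> block (2 * i)" "snd p \<in> block (2 * i + 1)" "fst p' \<in> block (2 * i)" "snd p' \<in> block (2 * i + 1)"
    using p p' by (auto simp: pairs_def)
  have lt: "c < fst p" "c < fst p'" "fst p < snd p" "fst p' < snd p'" "fst p < snd p'" "fst p' < snd p"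
    using pairsD[OF p c] pairsD[OF p' c] block_less[OF _ *(1,4)] block_less[OF _ *(3,2)] by auto
  have mono: "card X \<le> new_edges c p c p'" if "X \<subseteq> triangle c p' - triangle c p" for X
    unfolding new_edges_def using that by (intro card_mono) auto
  show "2 \<le> new_edges c p c p'" if "fst p' = fst p" "snd p' \<noteq> snd p"
  proof -
    have "{{c, snd p'}, {fst p', snd p'}} \<subseteq> triangle c p' - triangle c p"
      using lt that by (auto simp: triangle_def doubleton_eq_iff)
    moreover have "card {{c, snd p'}, {fst p', snd p'}} = 2"
      using lt by (auto simp: doubleton_eq_iff)
    ultimately show ?thesis using mono by metis
  qed
  show "2 \<le> new_edges c p c p'" if "fst p' \<noteq> fst p" "snd p' = snd p"
  proof -
    have "{{c, fst p'}, {fst p', snd p'}} \<subseteq> triangle c p' - triangle c p"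
      using lt that by (auto simp: triangle_def doubleton_eq_iff)
    moreover have "card {{c, fst p'}, {fst p', snd p'}} = 2"
      using lt by (auto simp: doubleton_eq_iff)
    ultimately show ?thesis using mono by metis
  qed
  show "3 \<le> new_edges c p c p'" if "fst p' \<noteq> fst p" "snd p' \<noteq> snd p"
  proof -
    have "triangle c p' \<subseteq> triangle c p' - triangle c p"
      using lt that by (auto simp: triangle_def doubleton_eq_iff)
    then show ?thesis using mono card_triangle[OF p' c] by metis
  qed
qed

text \<open>The only edge that triangles at different centres can share is the one between the
  blocks, and then the pairs agree. This weak dependence between centres is what makes the second
  moment small.\<close>

lemma new_edges_other_centre:
  assumes p: "p \<in> pairs i" and p': "p' \<in> pairs i" and c: "c \<le> \<rho>" "c' \<le> \<rho>" "c \<noteq> c'"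
  shows "2 \<le> new_edges c p c' p'"
    and "p \<noteq> p' \<Longrightarrow> 3 \<le> new_edges c p c' p'"
proof -
  have *: "fst p \<in> block (2 * i)" "snd p \<in> block (2 * i + 1)" "fst p' \<in> block (2 * i)" "snd p' \<in> block (2 * i + 1)"
    using p p' by (auto simp: pairs_def)
  have lt: "c < fst p" "c < fst p'" "c' < fst p" "c' < fst p'" "fst p < snd p" "fst p' < snd p'"
      "fst p < snd p'" "fst p' < snd p"
    using pairsD[OF p c(1)] pairsD[OF p' c(1)] pairsD[OF p c(2)] pairsD[OF p' c(2)]
      block_less[OF _ *(1,4)] block_less[OF _ *(3,2)] by auto
  have mono: "card X \<le> new_edges c p c' p'" if "X \<subseteq> triangle c' p' - triangle c p" for X
    unfolding new_edges_def using that by (intro card_mono) auto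
  have "{{c', fst p'}, {c', snd p'}} \<subseteq> triangle c' p' - triangle c p"
    using lt c(3) by (auto simp: triangle_def doubleton_eq_iff)
  moreover have "card {{c', fst p'}, {c', snd p'}} = 2"
    using lt by (auto simp: doubleton_eq_iff)
  ultimately show "2 \<le> new_edges c p c' p'" using mono by metis
  show "3 \<le> new_edges c p c' p'" if "p \<noteq> p'"
  proof -
    have "fst p \<noteq> fst p' \<or> snd p \<noteq> snd p'" using that by (simp add: prod_eq_iff)
    then have "triangle c' p' \<subseteq> triangle c' p' - triangle c p"
      using lt c(3) by (auto simp: triangle_def doubleton_eq_iff)
    then show ?thesis using mono card_triangle[OF p' c(2)] by metis
  qed
qed

lemma sum_power_new_edges_same_centre:
  fixes q :: real
  assumes q: "0 \<le> q" "q \<le> 1" and p: "p \<in> pairs i" and c: "c \<le> \<rho>"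
  shows "(\<Sum>p'\<in>pairs i. q ^ new_edges c p c p') \<le> 1 + 2 * real w * q ^ 2 + real w ^ 2 * q ^ 3"
proof -
  have *: "fst p \<in> block (2 * i)" "snd p \<in> block (2 * i + 1)" using p by (auto simp: pairs_def)
  \<comment> \<open>One weight per type of overlap: the pair itself, the \<open>w\<close> pairs
    agreeing in either coordinate, and exponent 3 for all pairs. The types on the right overlap,
    which only enlarges the bound.\<close>
  have "(\<Sum>p'\<in>pairs i. q ^ new_edges c p c p') \<le>
      (\<Sum>p'\<in>pairs i. ((if p' = p then 1 else 0) + (if fst p' = fst p then q ^ 2 else 0))
          + ((if snd p' = snd p then q ^ 2 else 0) + q ^ 3))"
  proof (rule sum_mono)
    fix p' assume p': "p' \<in> pairs i"
    have le: "q ^ new_edges c p c p' \<le> q ^ m" if "m \<le> new_edges c p c p'" for m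
      using that q by (rule power_decreasing)
    define Z2 Z3 where "Z2 = q ^ 2" and "Z3 = q ^ 3"
    have pos: "0 \<le> Z2" "0 \<le> Z3" using q by (auto simp: Z2_def Z3_def)
    note new = new_edges_same_centre[OF p p' c]
    consider "p' = p" | "fst p' = fst p" "snd p' \<noteq> snd p" | "fst p' \<noteq> fst p" "snd p' = snd p"
      | "fst p' \<noteq> fst p" "snd p' \<noteq> snd p"
      by (auto simp: prod_eq_iff)
    then have "q ^ new_edges c p c p' \<le> ((if p' = p then 1 else 0) + (if fst p' = fst p then Z2 else 0))
          + ((if snd p' = snd p then Z2 else 0) + Z3)"
    proof cases
      case 1
      then show ?thesis using le[of 0] pos by simp
    next
      case 2
      then have "q ^ new_edges c p c p' \<le> Z2" unfolding Z2_def by (intro le new)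
      then show ?thesis using pos 2 by auto
    next
      case 3
      then have "q ^ new_edges c p c p' \<le> Z2" unfolding Z2_def by (intro le new)
      then show ?thesis using pos 3 by auto
    next
      case 4
      then have "q ^ new_edges c p c p' \<le> Z3" unfolding Z3_def by (intro le new)
      then show ?thesis using 4 by auto
    qed
    then show "q ^ new_edges c p c p' \<le> ((if p' = p then 1 else 0) + (if fst p' = fst p then q ^ 2 else 0))
          + ((if snd p' = snd p then q ^ 2 else 0) + q ^ 3)"
      by (simp only: Z2_def Z3_def)
  qed
  also have "\<dots> = ((\<Sum>p'\<in>pairs i. if p' = p then 1 else 0) + (\<Sum>p'\<in>pairs i. if fst p' = fst p then q ^ 2 else 0))
          + ((\<Sum>p'\<in>pairs i. if snd p' = snd p then q ^ 2 else 0) + (\<Sum>p'\<in>pairs i. q ^ 3))"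
    by (simp only: sum.distrib)
  also have "(\<Sum>p'\<in>pairs i. if p' = p then 1 else 0) = (1::real)" using p by simp
  also have "(\<Sum>p'\<in>pairs i. if fst p' = fst p then q ^ 2 else 0) = real w * q ^ 2"
  proof -
    have "{p' \<in> pairs i. fst p' = fst p} = {fst p} \<times> block (2 * i + 1)"
      using * by (auto simp: pairs_def)
    then show ?thesis by (simp add: sum.inter_filter[symmetric] card_cartesian_product)
  qed
  also have "(\<Sum>p'\<in>pairs i. if snd p' = snd p then q ^ 2 else 0) = real w * q ^ 2"
  proof -
    have "{p' \<in> pairs i. snd p' = snd p} = block (2 * i) \<times> {snd p}"
      using * by (auto simp: pairs_def)
    then show ?thesis by (simp add: sum.inter_filter[symmetric] card_cartesian_product)
  qed
  also have "(\<Sum>p'\<in>pairs i. q ^ 3) = real w ^ 2 * q ^ 3" by (simp add: power2_eq_square)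
  finally show ?thesis by simp
qed

lemma sum_power_new_edges_other_centre:
  fixes q :: real
  assumes q: "0 \<le> q" "q \<le> 1" and p: "p \<in> pairs i" and c: "c \<le> \<rho>" "c' \<le> \<rho>" "c \<noteq> c'"
  shows "(\<Sum>p'\<in>pairs i. q ^ new_edges c p c' p') \<le> q ^ 2 + real w ^ 2 * q ^ 3"
proof -
  have "(\<Sum>p'\<in>pairs i. q ^ new_edges c p c' p') \<le> (\<Sum>p'\<in>pairs i. (if p' = p then q ^ 2 else 0) + q ^ 3)"
  proof (rule sum_mono)
    fix p' assume p': "p' \<in> pairs i"
    have le: "q ^ new_edges c p c' p' \<le> q ^ m" if "m \<le> new_edges c p c' p'" for m
      using that q by (rule power_decreasing)
    note new = new_edges_other_centre[OF p p' c]
    show "q ^ new_edges c p c' p' \<le> (if p' = p then q ^ 2 else 0) + q ^ 3"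
      using le[OF new(1)] le[OF new(2)] q by (cases "p' = p") (auto intro: order_trans)
  qed
  also have "\<dots> = q ^ 2 + real w ^ 2 * q ^ 3"
    using p by (simp add: sum.distrib power2_eq_square)
  finally show ?thesis .
qed

lemma sum_power_card_edges_of_Un_le:
  fixes q :: real
  assumes q: "0 \<le> q" "q \<le> 1" and \<kappa>: "\<kappa> \<in> fans"
  shows "(\<Sum>\<kappa>'\<in>fans. q ^ card (edges_of \<kappa> \<union> edges_of \<kappa>'))
    \<le> q ^ (3 * k) * ((1 + 2 * real w * q ^ 2 + real w ^ 2 * q ^ 3) ^ k + real \<rho> * (q ^ 2 + real w ^ 2 * q ^ 3) ^ k)"
proof -
  define c where "c = fst \<kappa>"
  define a where "a = snd \<kappa>"
  have c: "c \<in> {1..\<rho>}" and a: "\<And>i. i < k \<Longrightarrow> a i \<in> pairs i"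
    using fansD[OF \<kappa>] by (auto simp: c_def a_def)
  have "(\<Sum>\<kappa>'\<in>fans. (\<Prod>i<k. q ^ new_edges c (a i) (fst \<kappa>') (snd \<kappa>' i)))
      = (\<Sum>c'\<in>{1..\<rho>}. \<Sum>a'\<in>PiE {..<k} pairs. (\<Prod>i<k. q ^ new_edges c (a i) c' (a' i)))"
    unfolding fans_def by (subst sum.cartesian_product) (simp add: case_prod_beta)
  also have "\<dots> = (\<Sum>c'\<in>{1..\<rho>}. (\<Prod>i<k. \<Sum>p'\<in>pairs i. q ^ new_edges c (a i) c' p'))"
    by (intro sum.cong refl prod_sum_PiE[symmetric]) auto
  \<comment> \<open>The second summand is granted to every centre, \<open>c\<close> included, which
    yields the factor \<rho> instead of \<open>\<rho> - 1\<close>.\<close>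
  also have "\<dots> \<le> (\<Sum>c'\<in>{1..\<rho>}. (if c' = c then (1 + 2 * real w * q ^ 2 + real w ^ 2 * q ^ 3) ^ k else 0)
      + (q ^ 2 + real w ^ 2 * q ^ 3) ^ k)"
  proof (rule sum_mono)
    fix c' assume c': "c' \<in> {1..\<rho>}"
    show "(\<Prod>i<k. \<Sum>p'\<in>pairs i. q ^ new_edges c (a i) c' p')
      \<le> (if c' = c then (1 + 2 * real w * q ^ 2 + real w ^ 2 * q ^ 3) ^ k else 0)
      + (q ^ 2 + real w ^ 2 * q ^ 3) ^ k"
    proof (cases "c' = c")
      case True
      have "(\<Prod>i<k. \<Sum>p'\<in>pairs i. q ^ new_edges c (a i) c p')
          \<le> (\<Prod>i<k. 1 + 2 * real w * q ^ 2 + real w ^ 2 * q ^ 3)"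
        using q a c by (intro prod_mono conjI sum_power_new_edges_same_centre sum_nonneg) auto
      moreover have "0 \<le> (q ^ 2 + real w ^ 2 * q ^ 3) ^ k" using q by auto
      ultimately show ?thesis using True by simp
    next
      case False
      have "(\<Prod>i<k. \<Sum>p'\<in>pairs i. q ^ new_edges c (a i) c' p') \<le> (\<Prod>i<k. q ^ 2 + real w ^ 2 * q ^ 3)"
        using q a c c' False by (intro prod_mono conjI sum_power_new_edges_other_centre sum_nonneg) auto
      then show ?thesis using False by simp
    qed
  qed
  also have "\<dots> = (1 + 2 * real w * q ^ 2 + real w ^ 2 * q ^ 3) ^ k + real \<rho> * (q ^ 2 + real w ^ 2 * q ^ 3) ^ k"
  proof -
    have "(\<Sum>c'\<in>{1..\<rho>}. (if c' = c then X else 0) + Y) = X + real \<rho> * Y" for X Y :: real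
    proof -
      have "(\<Sum>c'\<in>{1..\<rho>}. (if c' = c then X else 0)) = (if c \<in> {1..\<rho>} then X else 0)"
        by (rule sum.delta) simp
      then have "(\<Sum>c'\<in>{1..\<rho>}. (if c' = c then X else 0)) = X" by (simp only: c if_True)
      then show ?thesis by (simp only: sum.distrib) simp
    qed
    then show ?thesis .
  qed
  finally have le: "(\<Sum>\<kappa>'\<in>fans. (\<Prod>i<k. q ^ new_edges c (a i) (fst \<kappa>') (snd \<kappa>' i)))
      \<le> (1 + 2 * real w * q ^ 2 + real w ^ 2 * q ^ 3) ^ k + real \<rho> * (q ^ 2 + real w ^ 2 * q ^ 3) ^ k" .
  have "(\<Sum>\<kappa>'\<in>fans. q ^ card (edges_of \<kappa> \<union> edges_of \<kappa>'))
      = (\<Sum>\<kappa>'\<in>fans. q ^ (3 * k) * (\<Prod>i<k. q ^ new_edges c (a i) (fst \<kappa>') (snd \<kappa>' i)))"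
    by (intro sum.cong refl) (simp add: card_edges_of_Un[OF \<kappa>] power_add power_sum c_def a_def)
  also have "\<dots> = q ^ (3 * k) * (\<Sum>\<kappa>'\<in>fans. (\<Prod>i<k. q ^ new_edges c (a i) (fst \<kappa>') (snd \<kappa>' i)))"
    by (rule sum_distrib_left[symmetric])
  finally show ?thesis using mult_left_mono[OF le, of "q ^ (3 * k)"] q by simp
qed

end

section \<open>Second moment of the number of well-timed fans\<close>

text \<open>Chebyshev's inequality in counting form, with \<open>A\<close> bounding the mean square
  and \<open>m\<close> the mean \<mu> from below. Passing from \<mu> to \<open>m\<close> at the end
  uses \<open>A \<ge> 0\<close>, which follows from the bound on the squares.\<close>

lemma card_zeros_le_second_moment:
  fixes X :: "'a \<Rightarrow> real"
  assumes fin: "finite \<Omega>" "\<Omega> \<noteq> {}" and m: "m > 0"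
    and second: "(\<Sum>\<omega>\<in>\<Omega>. X \<omega> ^ 2) \<le> A * real (card \<Omega>)"
    and first: "m * real (card \<Omega>) \<le> (\<Sum>\<omega>\<in>\<Omega>. X \<omega>)"
  shows "real (card {\<omega> \<in> \<Omega>. X \<omega> = 0}) \<le> (A / m ^ 2 - 1) * real (card \<Omega>)"
proof -
  define \<mu> where "\<mu> = (\<Sum>\<omega>\<in>\<Omega>. X \<omega>) / real (card \<Omega>)"
  have c: "real (card \<Omega>) > 0" using fin by (simp add: card_gt_0_iff)
  have \<mu>: "m \<le> \<mu>" using first c by (simp add: \<mu>_def le_divide_eq)
  have sumX: "(\<Sum>\<omega>\<in>\<Omega>. X \<omega>) = \<mu> * real (card \<Omega>)" using c by (simp add: \<mu>_def)
  have A0: "A \<ge> 0"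
  proof -
    have "0 \<le> A * real (card \<Omega>)" using second by (rule order_trans[rotated]) (simp add: sum_nonneg)
    then show ?thesis using c by (simp add: zero_le_mult_iff)
  qed
  have "real (card {\<omega> \<in> \<Omega>. X \<omega> = 0}) * \<mu> ^ 2 = (\<Sum>\<omega>\<in>{\<omega> \<in> \<Omega>. X \<omega> = 0}. (X \<omega> - \<mu>) ^ 2)" by simp
  also have "\<dots> \<le> (\<Sum>\<omega>\<in>\<Omega>. (X \<omega> - \<mu>) ^ 2)" using fin by (intro sum_mono2) auto
  also have "\<dots> = (\<Sum>\<omega>\<in>\<Omega>. X \<omega> ^ 2 + (\<mu> ^ 2 - 2 * \<mu> * X \<omega>))"
    by (intro sum.cong refl) (simp add: power2_eq_square algebra_simps)
  also have "\<dots> = (\<Sum>\<omega>\<in>\<Omega>. X \<omega> ^ 2) + (real (card \<Omega>) * \<mu> ^ 2 - 2 * \<mu> * (\<Sum>\<omega>\<in>\<Omega>. X \<omega>))"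
    by (simp add: sum.distrib sum_subtractf sum_distrib_left)
  also have "\<dots> = (\<Sum>\<omega>\<in>\<Omega>. X \<omega> ^ 2) - real (card \<Omega>) * \<mu> ^ 2"
    unfolding sumX by (simp add: power2_eq_square algebra_simps)
  also have "\<dots> \<le> (A - \<mu> ^ 2) * real (card \<Omega>)" using second by (simp add: algebra_simps)
  finally have "real (card {\<omega> \<in> \<Omega>. X \<omega> = 0}) \<le> (A - \<mu> ^ 2) * real (card \<Omega>) / \<mu> ^ 2"
    using m \<mu> by (simp add: le_divide_eq)
  also have "\<dots> = (A / \<mu> ^ 2 - 1) * real (card \<Omega>)"
    using m \<mu> by (simp add: field_simps)
  also have "\<dots> \<le> (A / m ^ 2 - 1) * real (card \<Omega>)"
    using m \<mu> A0 by (intro mult_right_mono diff_right_mono divide_left_mono power_mono) auto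
  finally show ?thesis .
qed

lemma edge_orders_finite [simp]: "finite (edge_orders n)" "edge_orders n \<noteq> {}"
  and card_edge_orders [simp]: "card (edge_orders n) = fact (n choose 2)"
  by (simp_all add: edge_orders_def)

text \<open>Comparison with independent edges. The correction factor depends on the cap
  \<open>m\<close> and not on \<open>card R\<close>, so it can be taken out of a sum over pairs of
  fans with varying overlap.\<close>

lemma card_orders_in_positions_le:
  fixes n N :: nat
  defines "N \<equiv> n choose 2"
  assumes R: "R \<subseteq> complete_edges n" and m: "card R \<le> m" "m < N"
    and Q: "\<And>e. e \<in> R \<Longrightarrow> Q e \<subseteq> {..<N} \<and> card (Q e) \<le> h"
  shows "real (card {es \<in> edge_orders n. \<forall>e\<in>R. \<exists>j\<in>Q e. es ! j = e})
     \<le> (real h / real N) ^ card R * (real N / (real N - real m)) ^ m * fact N"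
proof -
  have "card {es \<in> edge_orders n. \<forall>e\<in>R. \<exists>j\<in>Q e. es ! j = e} \<le> (\<Prod>e\<in>R. card (Q e)) * fact (N - card R)"
    using card_permutations_in_positions_le[OF _ R, of Q] Q by (simp add: edge_orders_def N_def)
  also have "\<dots> \<le> h ^ card R * fact (N - card R)"
    using Q prod_mono[of R "\<lambda>e. card (Q e)" "\<lambda>_. h"] by simp
  finally have "real (card {es \<in> edge_orders n. \<forall>e\<in>R. \<exists>j\<in>Q e. es ! j = e})
      \<le> real (h ^ card R * fact (N - card R))" by (rule of_nat_mono)
  also have "\<dots> = (real h / real N) ^ card R * (real N ^ card R * fact (N - card R))"
    using m by (simp add: power_divide)
  also have "\<dots> \<le> (real h / real N) ^ card R * ((real N / (real N - real m)) ^ m * fact N)"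
  proof (rule mult_left_mono)
    have pos: "real N - real m > 0" using m by simp
    have "(real N - real m) ^ card R * fact (N - card R) \<le> real (N - card R) ^ card R * fact (N - card R)"
      using m by (intro mult_right_mono power_mono) auto
    also have "\<dots> = real ((N - card R) ^ card R * fact (N - card R))" by simp
    also have "\<dots> \<le> real (fact N)" using m by (intro of_nat_mono power_mult_fact_le_fact) simp
    finally have *: "(real N - real m) ^ card R * fact (N - card R) \<le> (fact N :: real)" by simp
    have "real N ^ card R * fact (N - card R)
        = (real N / (real N - real m)) ^ card R * ((real N - real m) ^ card R * fact (N - card R))"
      using pos by (simp add: power_divide)
    also have "\<dots> \<le> (real N / (real N - real m)) ^ card R * fact N"
      using * pos by (intro mult_left_mono) auto
    also have "\<dots> \<le> (real N / (real N - real m)) ^ m * fact N"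
      using pos m by (intro mult_right_mono power_increasing) (auto simp: le_divide_eq)
    finally show "real N ^ card R * fact (N - card R) \<le> (real N / (real N - real m)) ^ m * fact N" .
  qed simp
  finally show ?thesis by (simp only: mult.assoc)
qed

context centres_and_blocks
begin

text \<open>Both windows have length \<open>h\<close>, so all edges have the same probability of
  meeting their window and only the number of distinct edges matters.\<close>

definition slot :: "nat \<Rightarrow> edge \<Rightarrow> nat set" where
  "slot h e = (if e \<inter> {1..\<rho>} \<noteq> {} then {..<h} else {h..<2 * h})"

definition good :: "nat \<Rightarrow> edge list \<Rightarrow> nat \<times> (nat \<Rightarrow> nat \<times> nat) \<Rightarrow> bool" where
  "good h es \<kappa> \<longleftrightarrow> (\<forall>e\<in>edges_of \<kappa>. \<exists>j\<in>slot h e. es ! j = e)"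

text \<open>The quotient in front corrects for sampling without repetition. The two summands compare
  pairs of fans with equal and with different centres to the squared mean: the former gain a factor
  \<open>1 / \<rho>\<close>, the latter contribute nearly 1 as soon as \<open>w^2 * q\<close> is
  large.\<close>

lemma card_orders_no_good_le:
  fixes h N :: nat and q :: real
  defines "N \<equiv> n choose 2"
  defines "q \<equiv> real h / real N"
  assumes h: "3 * k < h" "2 * h \<le> N" and N: "6 * k < N" and w: "w > 0" and \<rho>: "\<rho> > 0"
  shows "real (card {es \<in> edge_orders n. \<forall>\<kappa>\<in>fans. \<not> good h es \<kappa>})
    \<le> ((real N / (real N - real (6 * k))) ^ (6 * k) / (1 - real (3 * k) / real h) ^ (6 * k)
        * (1 / real \<rho> * (1 + 2 / (real w * q) + 1 / (real w ^ 2 * q ^ 3)) ^ k + (1 + 1 / (real w ^ 2 * q)) ^ k)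
        - 1) * fact N"
proof -
  define \<Gamma> where "\<Gamma> = (real N / (real N - real (6 * k))) ^ (6 * k)"
  define D where "D = (1 - real (3 * k) / real h) ^ (3 * k)"
  define Z where "Z = (1 + 2 * real w * q ^ 2 + real w ^ 2 * q ^ 3) ^ k + real \<rho> * (q ^ 2 + real w ^ 2 * q ^ 3) ^ k"
  define K where "K = real (card fans)"
  define X where "X es = (\<Sum>\<kappa>\<in>fans. of_bool (good h es \<kappa>) :: real)" for es
  have q: "0 < q" "q \<le> 1" using h N by (auto simp: q_def)
  have hpos: "real h > 0" using h by simp
  have \<Gamma>0: "\<Gamma> \<ge> 0" using N by (simp add: \<Gamma>_def)
  have Dpos: "D > 0" unfolding D_def using h hpos by (intro zero_less_power) simp
  have Kpos: "K > 0" using w \<rho> by (simp add: K_def card_fans)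
  have K: "K * q ^ (3 * k) = real \<rho> * (real w ^ 2 * q ^ 3) ^ k"
    by (simp add: K_def card_fans power_mult power_mult_distrib power2_eq_square)
  have slot: "slot h e \<subseteq> {..<N} \<and> card (slot h e) = h" for e
    using h by (auto simp: slot_def)
  have good_pair: "(\<Sum>es\<in>edge_orders n. of_bool (good h es \<kappa>) * of_bool (good h es \<kappa>') :: real)
      \<le> q ^ card (edges_of \<kappa> \<union> edges_of \<kappa>') * (\<Gamma> * fact N)"
    if "\<kappa> \<in> fans" "\<kappa>' \<in> fans" for \<kappa> \<kappa>'
  proof -
    have "(\<Sum>es\<in>edge_orders n. of_bool (good h es \<kappa>) * of_bool (good h es \<kappa>') :: real)
        = (\<Sum>es\<in>edge_orders n. of_bool (\<forall>e\<in>edges_of \<kappa> \<union> edges_of \<kappa>'. \<exists>j\<in>slot h e. es ! j = e))"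
      by (intro sum.cong refl) (auto simp: good_def)
    also have "\<dots> = real (card {es \<in> edge_orders n. \<forall>e\<in>edges_of \<kappa> \<union> edges_of \<kappa>'. \<exists>j\<in>slot h e. es ! j = e})"
      by (simp only: sum_of_bool_eq edge_orders_finite Int_def mem_Collect_eq)
    also have "\<dots> \<le> (real h / real N) ^ card (edges_of \<kappa> \<union> edges_of \<kappa>')
        * (real N / (real N - real (6 * k))) ^ (6 * k) * fact N"
      unfolding N_def
    proof (rule card_orders_in_positions_le)
      show "edges_of \<kappa> \<union> edges_of \<kappa>' \<subseteq> complete_edges n" using edges_of_subset that by blast
      show "card (edges_of \<kappa> \<union> edges_of \<kappa>') \<le> 6 * k"
        using card_Un_le[of "edges_of \<kappa>" "edges_of \<kappa>'"] card_edges_of that by simp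
    qed (use slot N in \<open>auto simp: N_def\<close>)
    finally show ?thesis by (simp add: q_def \<Gamma>_def mult.assoc)
  qed
  have "(\<Sum>es\<in>edge_orders n. X es ^ 2)
      = (\<Sum>es\<in>edge_orders n. \<Sum>\<kappa>\<in>fans. \<Sum>\<kappa>'\<in>fans. of_bool (good h es \<kappa>) * of_bool (good h es \<kappa>'))"
    by (simp only: X_def power2_eq_square sum_product)
  also have "\<dots> = (\<Sum>\<kappa>\<in>fans. \<Sum>es\<in>edge_orders n. \<Sum>\<kappa>'\<in>fans. of_bool (good h es \<kappa>) * of_bool (good h es \<kappa>'))"
    by (rule sum.swap)
  also have "\<dots> = (\<Sum>\<kappa>\<in>fans. \<Sum>\<kappa>'\<in>fans. \<Sum>es\<in>edge_orders n. of_bool (good h es \<kappa>) * of_bool (good h es \<kappa>'))"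
    by (intro sum.cong refl sum.swap)
  also have "\<dots> \<le> (\<Sum>\<kappa>\<in>fans. \<Sum>\<kappa>'\<in>fans. q ^ card (edges_of \<kappa> \<union> edges_of \<kappa>') * (\<Gamma> * fact N))"
    by (intro sum_mono good_pair)
  also have "\<dots> = (\<Sum>\<kappa>\<in>fans. (\<Sum>\<kappa>'\<in>fans. q ^ card (edges_of \<kappa> \<union> edges_of \<kappa>')) * (\<Gamma> * fact N))"
    by (simp only: sum_distrib_right)
  also have "\<dots> \<le> (\<Sum>\<kappa>\<in>fans. (q ^ (3 * k) * Z) * (\<Gamma> * fact N))"
    unfolding Z_def using q \<Gamma>0 by (intro sum_mono mult_right_mono sum_power_card_edges_of_Un_le) auto
  also have "\<dots> = (K * q ^ (3 * k) * Z * \<Gamma>) * fact N" by (simp add: K_def)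
  finally have second: "(\<Sum>es\<in>edge_orders n. X es ^ 2) \<le> (K * q ^ (3 * k) * Z * \<Gamma>) * real (card (edge_orders n))"
    by (simp add: N_def)
  have "(\<Sum>\<kappa>\<in>fans. q ^ (3 * k) * D * fact N) \<le> (\<Sum>\<kappa>\<in>fans. \<Sum>es\<in>edge_orders n. of_bool (good h es \<kappa>))"
  proof (rule sum_mono)
    fix \<kappa> assume \<kappa>: "\<kappa> \<in> fans"
    have "q ^ (3 * k) * D * fact N = ((real h - real (3 * k)) / real N) ^ (3 * k) * fact N"
    proof -
      have "q * (1 - real (3 * k) / real h) = (real h - real (3 * k)) / real N"
        using hpos by (simp add: q_def right_diff_distrib diff_divide_distrib)
      then show ?thesis by (simp only: D_def power_mult_distrib[symmetric])
    qed
    also have "\<dots> \<le> ((real h - real (3 * k)) / real N) ^ (3 * k) * (real N ^ (3 * k) * fact (N - 3 * k))"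
    proof (rule mult_left_mono)
      have "fact N \<le> N ^ (3 * k) * fact (N - 3 * k)"
        using N by (intro fact_le_power_mult_fact) simp
      then have "real (fact N) \<le> real (N ^ (3 * k) * fact (N - 3 * k))" by (rule of_nat_mono)
      then show "fact N \<le> real N ^ (3 * k) * fact (N - 3 * k)" by simp
    qed (use h in simp)
    also have "\<dots> = real ((h - 3 * k) ^ (3 * k) * fact (N - 3 * k))"
      using h N by (simp add: power_divide of_nat_diff)
    also have "\<dots> \<le> real (card {es \<in> edge_orders n. good h es \<kappa>})"
    proof (rule of_nat_mono)
      show "(h - 3 * k) ^ (3 * k) * fact (N - 3 * k) \<le> card {es \<in> edge_orders n. good h es \<kappa>}"
        using card_permutations_in_positions_ge[OF _ edges_of_subset[OF \<kappa>], of "slot h" h] slot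
        by (simp add: card_edges_of[OF \<kappa>] edge_orders_def good_def N_def)
    qed
    also have "\<dots> = (\<Sum>es\<in>edge_orders n. of_bool (good h es \<kappa>))"
      by (simp only: sum_of_bool_eq edge_orders_finite Int_def mem_Collect_eq)
    finally show "q ^ (3 * k) * D * fact N \<le> (\<Sum>es\<in>edge_orders n. of_bool (good h es \<kappa>))" .
  qed
  also have "\<dots> = (\<Sum>es\<in>edge_orders n. X es)" unfolding X_def by (rule sum.swap)
  finally have first: "(K * q ^ (3 * k) * D) * real (card (edge_orders n)) \<le> (\<Sum>es\<in>edge_orders n. X es)"
    by (simp add: K_def N_def mult.assoc)
  have m: "K * q ^ (3 * k) * D > 0" using Kpos q Dpos by simp
  have "{es \<in> edge_orders n. \<forall>\<kappa>\<in>fans. \<not> good h es \<kappa>} = {es \<in> edge_orders n. X es = 0}"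
    by (auto simp: X_def sum_nonneg_eq_0_iff)
  then have "real (card {es \<in> edge_orders n. \<forall>\<kappa>\<in>fans. \<not> good h es \<kappa>})
      \<le> (K * q ^ (3 * k) * Z * \<Gamma> / (K * q ^ (3 * k) * D) ^ 2 - 1) * fact N"
    using card_zeros_le_second_moment[OF edge_orders_finite m second first] by (simp add: N_def)
  \<comment> \<open>One factor \<open>K * q ^ (3 * k)\<close> cancels. The other is
    \<open>\<rho> * y ^ k\<close> with \<open>y = w^2 * q^3\<close>, up to corrections the mean
    number of good fans.\<close>
  also have "K * q ^ (3 * k) * Z * \<Gamma> / (K * q ^ (3 * k) * D) ^ 2 = \<Gamma> / D ^ 2 * (Z / (K * q ^ (3 * k)))"
    using Kpos q Dpos by (simp add: power2_eq_square mult_ac)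
  also have "D ^ 2 = (1 - real (3 * k) / real h) ^ (6 * k)"
    by (simp add: D_def power_mult[symmetric] mult.commute)
  also have "Z / (K * q ^ (3 * k))
      = 1 / real \<rho> * (1 + 2 / (real w * q) + 1 / (real w ^ 2 * q ^ 3)) ^ k + (1 + 1 / (real w ^ 2 * q)) ^ k"
  proof -
    define y where "y = real w ^ 2 * q ^ 3"
    have y: "y > 0" using w q by (simp add: y_def)
    have "Z / (K * q ^ (3 * k)) = 1 / real \<rho> * ((1 + 2 * real w * q ^ 2 + y) / y) ^ k + ((q ^ 2 + y) / y) ^ k"
      using y \<rho> unfolding K Z_def y_def[symmetric] by (simp add: power_divide field_simps)
    also have "(1 + 2 * real w * q ^ 2 + y) / y = 1 + 2 / (real w * q) + 1 / y"
    proof -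
      have "2 * real w * q ^ 2 / y = 2 / (real w * q)"
        using w q by (simp add: y_def power2_eq_square power3_eq_cube)
      then show ?thesis using y by (simp add: add_divide_distrib)
    qed
    also have "(q ^ 2 + y) / y = 1 + 1 / (real w ^ 2 * q)"
    proof -
      have "q ^ 2 / y = 1 / (real w ^ 2 * q)"
        using w q by (simp add: y_def power2_eq_square power3_eq_cube)
      then show ?thesis using y by (simp add: add_divide_distrib)
    qed
    finally show ?thesis by (simp only: y_def)
  qed
  finally show ?thesis by (simp only: \<Gamma>_def)
qed

end

section \<open>The strategy\<close>

lemma prob_contains_return_pmf:
  "prob_contains H n t (return_pmf r)
     = real (card {es \<in> edge_orders n. contains_copy H (builder_graph n r es t)}) / fact (n choose 2)"
  by (simp add: prob_contains_def pair_return_pmf2 vimage_def measure_pmf_of_set Int_def)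

text \<open>The constant bounds the sampling correction: \<open>N / (N - 3) \<le> 2\<close> for
  \<open>N \<ge> 6\<close>, and at most three edges are involved.\<close>

lemma card_orders_all_early_le:
  assumes R: "R \<subseteq> complete_edges n" "card R \<le> 3" and t: "t \<le> n choose 2" and N: "n choose 2 \<ge> 6"
  shows "real (card {es \<in> edge_orders n. R \<subseteq> set (take t es)})
    \<le> 8 * (real t / real (n choose 2)) ^ card R * fact (n choose 2)"
proof -
  define N where "N = n choose 2"
  have N6: "real N \<ge> 6" using N unfolding N_def by linarith
  have "{es \<in> edge_orders n. R \<subseteq> set (take t es)} \<subseteq> {es \<in> edge_orders n. \<forall>e\<in>R. \<exists>j\<in>{..<t}. es ! j = e}"
  proof clarify
    fix es e assume "es \<in> edge_orders n" "R \<subseteq> set (take t es)" "e \<in> R"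
    then have "e \<in> set (take t es)" by blast
    then obtain j where "j < length (take t es)" "take t es ! j = e" by (metis in_set_conv_nth)
    then show "\<exists>j\<in>{..<t}. es ! j = e" by auto
  qed
  then have "real (card {es \<in> edge_orders n. R \<subseteq> set (take t es)})
      \<le> real (card {es \<in> edge_orders n. \<forall>e\<in>R. \<exists>j\<in>{..<t}. es ! j = e})"
    by (intro of_nat_mono card_mono) auto
  also have "\<dots> \<le> (real t / real N) ^ card R * (real N / (real N - real 3)) ^ 3 * fact N"
    unfolding N_def using R t N by (intro card_orders_in_positions_le) auto
  also have "\<dots> \<le> (real t / real N) ^ card R * 2 ^ 3 * fact N"
    using N6 by (intro mult_right_mono mult_left_mono power_mono) (auto simp: divide_le_eq)
  finally show ?thesis by (simp add: N_def mult_ac)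
qed

context centres_and_blocks
begin

section \<open>The purchasing rule and its cost\<close>

definition star_edges :: "edge set" where
  "star_edges = (\<lambda>(c, x). {c, x}) ` ({1..\<rho>} \<times> (\<Union>j<2 * k. block j))"

definition cross_edges :: "edge set" where
  "cross_edges = (\<Union>i<k. (\<lambda>p. {fst p, snd p}) ` pairs i)"

definition wanted :: "edge set \<Rightarrow> edge \<Rightarrow> bool" where
  "wanted P e \<longleftrightarrow> e \<in> star_edges \<or> (e \<in> cross_edges \<and> (\<exists>c\<in>{1..\<rho>}. \<forall>x\<in>e. {c, x} \<in> P))"

definition fan_rule :: "nat \<Rightarrow> rule" where
  "fan_rule b pre P \<longleftrightarrow> card P < b \<and> wanted P (last pre)"

text \<open>The edges wanted when all revealed edges count as bought. This contains every purchase
  and depends neither on the budget nor on the order of the first \<open>t\<close> edges, so its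
  mean size can be counted directly.\<close>

definition wishlist :: "edge list \<Rightarrow> nat \<Rightarrow> edge set" where
  "wishlist es t = {e \<in> set (take t es). wanted (set (take t es)) e}"

lemma wanted_mono: "P \<subseteq> P' \<Longrightarrow> wanted P e \<Longrightarrow> wanted P' e"
  unfolding wanted_def by blast

lemma card_purchased_fan_rule: "card (purchased (fan_rule b) es s) \<le> b"
  by (induction s) (auto simp: fan_rule_def card_insert_if)

lemma purchased_fan_rule_subset:
  assumes "s \<le> t" "t \<le> length es"
  shows "purchased (fan_rule b) es s \<subseteq> wishlist es t"
  using assms(1)
proof (induction s)
  case (Suc s)
  have IH: "purchased (fan_rule b) es s \<subseteq> wishlist es t" using Suc by simp
  then have "purchased (fan_rule b) es s \<subseteq> set (take t es)" by (auto simp: wishlist_def)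
  moreover have "es ! s \<in> set (take t es)"
    using in_set_drop_take[of 0 s t es] Suc assms by simp
  moreover have "last (take (Suc s) es) = es ! s" using Suc assms by (intro last_take_Suc) simp
  ultimately have "es ! s \<in> wishlist es t"
    if "fan_rule b (take (Suc s) es) (purchased (fan_rule b) es s)"
    using that wanted_mono[of "purchased (fan_rule b) es s"]
    unfolding fan_rule_def[of b "take (Suc s) es"] wishlist_def by simp
  then show ?case using IH by simp
qed simp

text \<open>The purchases before time \<open>s\<close> belong to the wishlist and miss its member
  \<open>es ! s\<close>, so they are fewer than \<open>b\<close>: a wishlist within budget means
  that the budget never binds.\<close>

lemma purchased_if_wanted:
  assumes es: "distinct es" "t \<le> length es" and s: "s < t"
    and affordable: "card (wishlist es t) \<le> b"
    and wanted: "wanted (purchased (fan_rule b) es s) (es ! s)"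
  shows "es ! s \<in> purchased (fan_rule b) es t"
proof -
  let ?P = "purchased (fan_rule b) es"
  have P: "?P s \<subseteq> wishlist es t" using s es by (intro purchased_fan_rule_subset) auto
  have in_take: "es ! s \<in> set (take t es)" using in_set_drop_take[of 0 s t es] s es by simp
  have "?P s \<subseteq> set (take t es)" using P by (auto simp: wishlist_def)
  then have W: "es ! s \<in> wishlist es t"
    using in_take wanted_mono[OF _ wanted] by (simp add: wishlist_def)
  have "es ! s \<notin> ?P s"
  proof
    assume "es ! s \<in> ?P s"
    then have "es ! s \<in> set (take s es)" using purchased_subset_take[of s es] s es by auto
    then obtain j where "j < s" "es ! j = es ! s" using s es by (auto simp: in_set_conv_nth)
    then show False using s es by (auto simp: nth_eq_iff_index_eq)
  qed
  then have "?P s \<subset> wishlist es t" using P W by blast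
  then have "card (?P s) < card (wishlist es t)" by (rule psubset_card_mono[rotated]) (simp add: wishlist_def)
  moreover have "last (take (Suc s) es) = es ! s" using s es by (intro last_take_Suc) simp
  ultimately have "es ! s \<in> ?P (Suc s)" using affordable wanted by (simp add: fan_rule_def)
  moreover have "?P (Suc s) \<subseteq> ?P t" using s by (intro purchased_mono) simp
  ultimately show ?thesis by blast
qed

lemma contains_fan_if_good:
  assumes es: "distinct es" "t \<le> length es" and h: "2 * h \<le> t"
    and affordable: "card (wishlist es t) \<le> b"
    and \<kappa>: "\<kappa> \<in> fans" and good: "good h es \<kappa>"
  shows "contains_copy (triangle_fan k) (builder_graph n (fan_rule b) es t)"
proof -
  let ?P = "purchased (fan_rule b) es"
  define c where "c = fst \<kappa>"
  define a where "a = snd \<kappa>"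
  have c: "c \<in> {1..\<rho>}" and a: "\<And>i. i < k \<Longrightarrow> a i \<in> pairs i"
    using fansD[OF \<kappa>] by (auto simp: c_def a_def)
  have blk: "fst (a i) \<in> block (2 * i)" "snd (a i) \<in> block (2 * i + 1)" if "i < k" for i
    using a[OF that] by (auto simp: pairs_def)
  have pos: "\<exists>j\<in>slot h e. es ! j = e" if "i < k" "e \<in> triangle c (a i)" for i e
    using good that by (auto simp: good_def edges_of_def c_def a_def)
  \<comment> \<open>Shown for time \<open>h\<close> and not only for \<open>t\<close>: the edge
    between the blocks arrives at \<open>h\<close> or later, and is wanted only if both edges to the
    centre are already bought.\<close>
  have star: "{c, x} \<in> ?P h" if i: "i < k" and x: "x = fst (a i) \<or> x = snd (a i)" for i x
  proof -
    have "{c, x} \<in> triangle c (a i)" using x by (auto simp: triangle_def)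
    then obtain j where j: "j \<in> slot h {c, x}" "es ! j = {c, x}" using pos[OF i] by blast
    have jh: "j < h" using j(1) c by (auto simp: slot_def)
    have "x \<in> (\<Union>j<2 * k. block j)"
      using x
    proof
      assume "x = fst (a i)"
      then show ?thesis using blk(1)[OF i] i by (intro UN_I[of "2 * i"]) auto
    next
      assume "x = snd (a i)"
      then show ?thesis using blk(2)[OF i] i by (intro UN_I[of "2 * i + 1"]) auto
    qed
    then have "{c, x} \<in> star_edges" using c by (auto simp: star_edges_def)
    then have w: "wanted (?P j) (es ! j)" by (simp add: wanted_def j(2))
    have "card (wishlist es h) \<le> b"
    proof -
      have "set (take h es) \<subseteq> set (take t es)" using h by (intro set_take_subset_set_take) simp
      then have "wishlist es h \<subseteq> wishlist es t" unfolding wishlist_def using wanted_mono by blast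
      then have "card (wishlist es h) \<le> card (wishlist es t)" by (intro card_mono) (simp add: wishlist_def)
      then show ?thesis using affordable by simp
    qed
    then show ?thesis using purchased_if_wanted[of es h j b] es h jh w j(2) by simp
  qed
  have star': "{c, x} \<in> ?P t" if "i < k" "x = fst (a i) \<or> x = snd (a i)" for i x
    using star[OF that] purchased_mono[of h t "fan_rule b" es] h by auto
  have cross: "{fst (a i), snd (a i)} \<in> ?P t" if i: "i < k" for i
  proof -
    let ?e = "{fst (a i), snd (a i)}"
    obtain j where j: "j \<in> slot h ?e" "es ! j = ?e"
      using pos[OF i, of ?e] by (auto simp: triangle_def)
    have "?e \<inter> {1..\<rho>} = {}" using block_gt[OF blk(1)[OF i]] block_gt[OF blk(2)[OF i]] by auto
    then have jh: "h \<le> j" "j < 2 * h" using j(1) by (auto simp: slot_def)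
    have "?e \<in> cross_edges" using a[OF i] i by (auto simp: cross_edges_def)
    moreover have "\<forall>x\<in>?e. {c, x} \<in> ?P j"
      using star[OF i] purchased_mono[OF jh(1), of "fan_rule b" es] by blast
    ultimately have "wanted (?P j) (es ! j)" using c by (auto simp: wanted_def j(2))
    then show ?thesis using purchased_if_wanted[OF es _ affordable, of j] jh h j(2) by simp
  qed
  \<comment> \<open>For \<open>v > 0\<close> the triangle has index \<open>(v - 1) div 2\<close>,
    and odd and even \<open>v\<close> go to its first and second block. Thus \<open>f v\<close> lies
    in block \<open>v - 1\<close>, and disjointness of the blocks gives injectivity.\<close>
  define f where "f v = (if v = 0 then c else if odd v then fst (a ((v - 1) div 2)) else snd (a ((v - 1) div 2)))" for v
  have f_block: "f v \<in> block (v - 1)" if v: "v \<noteq> 0" "v \<le> 2 * k" for v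
  proof (cases "odd v")
    case True
    then obtain i where i: "v = 2 * i + 1" by (elim oddE)
    then show ?thesis using blk(1)[of i] v by (simp add: f_def)
  next
    case False
    then obtain i' where "v = 2 * i'" by (auto elim: evenE)
    then obtain i where i: "v = 2 * i + 2" using v by (cases i') auto
    then show ?thesis using blk(2)[of i] v by (simp add: f_def)
  qed
  have f0: "f 0 = c" by (simp add: f_def)
  have fodd: "f (Suc (2 * i)) = fst (a i)" and feven: "f (Suc (Suc (2 * i))) = snd (a i)" for i by (simp_all add: f_def)
  show ?thesis
    unfolding contains_copy_def builder_graph_def
  proof (intro exI[of _ f] conjI ballI)
    show "inj_on f (fst (triangle_fan k))"
    proof (rule inj_onI)
      fix u v assume uv: "u \<in> fst (triangle_fan k)" "v \<in> fst (triangle_fan k)" "f u = f v"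
      then have le: "u \<le> 2 * k" "v \<le> 2 * k" by (auto simp: triangle_fan_def)
      have gt: "c < f x" if "x \<noteq> 0" "x \<le> 2 * k" for x
        using block_gt[OF f_block[OF that]] c by simp
      consider "u = 0" "v = 0" | "u = 0" "v \<noteq> 0" | "u \<noteq> 0" "v = 0" | "u \<noteq> 0" "v \<noteq> 0" by blast
      then show "u = v"
      proof cases
        case 4
        then have "u - 1 = v - 1" using f_block[of u] f_block[of v] le uv(3) block_disjoint by metis
        then show ?thesis using 4 by simp
      qed (use gt le uv f0 in \<open>auto dest: sym\<close>)
    qed
    show "f ` fst (triangle_fan k) \<subseteq> fst ({1..n}, ?P t)"
    proof clarify
      fix v assume "v \<in> fst (triangle_fan k)"
      then have v: "v \<le> 2 * k" by (simp add: triangle_fan_def)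
      show "f v \<in> fst ({1..n}, ?P t)"
      proof (cases "v = 0")
        case True
        then show ?thesis using c fits f0 by simp
      next
        case False
        then have "f v \<in> block (v - 1)" "v - 1 < 2 * k" using f_block v by auto
        then show ?thesis using block_gt[of "f v"] block_le[of "v - 1" "f v"] by fastforce
      qed
    qed
    fix e assume "e \<in> snd (triangle_fan k)"
    then obtain i where i: "i < k" and e: "e = {0, 2 * i + 1} \<or> e = {0, 2 * i + 2} \<or> e = {2 * i + 1, 2 * i + 2}"
      by (auto simp: fan_edges_eq)
    show "f ` e \<in> snd ({1..n}, ?P t)"
      using e star'[OF i] cross[OF i] by (auto simp: f0 fodd feven)
  qed
qed

text \<open>A star edge is charged to its centre and block vertex, a cross edge to some fully
  revealed triangle; multiple charges do no harm. The constant is \<open>2 * 8\<close> for the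
  \<open>2 * k\<close> blocks of star edges; triangles need only 8 and are rounded up.\<close>

lemma sum_card_wishlist_le:
  fixes t N :: nat
  defines "N \<equiv> n choose 2"
  assumes t: "t \<le> N" and N: "N \<ge> 6"
  shows "(\<Sum>es\<in>edge_orders n. real (card (wishlist es t)))
    \<le> 16 * real k * real \<rho> * (real w * (real t / real N) + real w ^ 2 * (real t / real N) ^ 3) * fact N"
proof -
  define U where "U = (\<Union>j<2 * k. block j)"
  define A where "A = {1..\<rho>} \<times> U"
  define T where "T = {1..\<rho>} \<times> (SIGMA i:{..<k}. pairs i)"
  have finU: "finite U" by (simp add: U_def)
  have finA: "finite A" and finT: "finite T" by (simp_all add: A_def T_def finU)
  have cU: "card U \<le> 2 * k * w"
    unfolding U_def using card_UN_le[of "{..<2 * k}" block] by simp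
  have cA: "real (card A) \<le> 2 * real k * real \<rho> * real w"
  proof -
    have "card A \<le> \<rho> * (2 * k * w)" using cU by (simp add: A_def card_cartesian_product)
    then have "real (card A) \<le> real (\<rho> * (2 * k * w))" by (rule of_nat_mono)
    then show ?thesis by (simp add: mult_ac)
  qed
  have cT: "real (card T) = real k * real \<rho> * real w ^ 2"
    by (simp add: T_def card_cartesian_product card_SigmaI power2_eq_square)
  have pt: "real (card (wishlist es t)) \<le> (\<Sum>\<alpha>\<in>A. of_bool ({fst \<alpha>, snd \<alpha>} \<in> set (take t es)))
      + (\<Sum>\<tau>\<in>T. of_bool (triangle (fst \<tau>) (snd (snd \<tau>)) \<subseteq> set (take t es)))" for es
  proof -
    let ?G = "set (take t es)"
    let ?A = "{\<alpha> \<in> A. {fst \<alpha>, snd \<alpha>} \<in> ?G}"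
    let ?T = "{\<tau> \<in> T. triangle (fst \<tau>) (snd (snd \<tau>)) \<subseteq> ?G}"
    have "wishlist es t \<subseteq> (\<lambda>\<alpha>. {fst \<alpha>, snd \<alpha>}) ` ?A \<union> (\<lambda>\<tau>. {fst (snd (snd \<tau>)), snd (snd (snd \<tau>))}) ` ?T"
    proof
      fix e assume "e \<in> wishlist es t"
      then have eG: "e \<in> ?G" and "wanted ?G e" by (auto simp: wishlist_def)
      then consider "e \<in> star_edges" | c where "e \<in> cross_edges" "c \<in> {1..\<rho>}" "\<forall>x\<in>e. {c, x} \<in> ?G"
        unfolding wanted_def by blast
      then show "e \<in> (\<lambda>\<alpha>. {fst \<alpha>, snd \<alpha>}) ` ?A \<union> (\<lambda>\<tau>. {fst (snd (snd \<tau>)), snd (snd (snd \<tau>))}) ` ?T"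
      proof cases
        case 1
        then obtain \<alpha> where "\<alpha> \<in> A" "e = {fst \<alpha>, snd \<alpha>}"
          unfolding star_edges_def A_def U_def by (auto simp: case_prod_beta)
        then show ?thesis using eG by blast
      next
        case 2
        then obtain i p where ip: "i < k" "p \<in> pairs i" "e = {fst p, snd p}"
          by (auto simp: cross_edges_def)
        then have "(c, i, p) \<in> ?T" using 2 eG by (auto simp: T_def triangle_def)
        then have "(\<lambda>\<tau>. {fst (snd (snd \<tau>)), snd (snd (snd \<tau>))}) (c, i, p)
            \<in> (\<lambda>\<tau>. {fst (snd (snd \<tau>)), snd (snd (snd \<tau>))}) ` ?T" by (rule imageI)
        then show ?thesis using ip by simp
      qed
    qed
    then have "card (wishlist es t) \<le> card ((\<lambda>\<alpha>. {fst \<alpha>, snd \<alpha>}) ` ?A \<union> (\<lambda>\<tau>. {fst (snd (snd \<tau>)), snd (snd (snd \<tau>))}) ` ?T)"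
      using finA finT by (intro card_mono) auto
    also have "\<dots> \<le> card ((\<lambda>\<alpha>. {fst \<alpha>, snd \<alpha>}) ` ?A) + card ((\<lambda>\<tau>. {fst (snd (snd \<tau>)), snd (snd (snd \<tau>))}) ` ?T)"
      by (rule card_Un_le)
    also have "\<dots> \<le> card ?A + card ?T"
      using finA finT by (intro add_mono card_image_le) auto
    finally have "real (card (wishlist es t)) \<le> real (card ?A + card ?T)" by (rule of_nat_mono)
    then show ?thesis using finA finT by (simp add: sum_of_bool_eq Int_def)
  qed
  have starP: "(\<Sum>es\<in>edge_orders n. of_bool ({fst \<alpha>, snd \<alpha>} \<in> set (take t es))) \<le> 8 * (real t / real N) * fact N"
    if \<alpha>: "\<alpha> \<in> A" for \<alpha>
  proof -
    obtain j where j: "j < 2 * k" "snd \<alpha> \<in> block j" using \<alpha> by (auto simp: A_def U_def)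
    have "fst \<alpha> \<in> {1..\<rho>}" using \<alpha> by (auto simp: A_def)
    then have sub: "{{fst \<alpha>, snd \<alpha>}} \<subseteq> complete_edges n"
      using block_gt[OF j(2)] block_le[OF j] by (auto simp: in_complete_edges)
    have "(\<Sum>es\<in>edge_orders n. of_bool ({fst \<alpha>, snd \<alpha>} \<in> set (take t es)))
        = real (card {es \<in> edge_orders n. {{fst \<alpha>, snd \<alpha>}} \<subseteq> set (take t es)})"
      by (simp add: sum_of_bool_eq Int_def)
    also have "\<dots> \<le> 8 * (real t / real N) ^ card {{fst \<alpha>, snd \<alpha>}} * fact N"
      unfolding N_def using sub t N by (intro card_orders_all_early_le) (auto simp: N_def)
    finally show ?thesis by simp
  qed
  have triP: "(\<Sum>es\<in>edge_orders n. of_bool (triangle (fst \<tau>) (snd (snd \<tau>)) \<subseteq> set (take t es)))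
      \<le> 8 * (real t / real N) ^ 3 * fact N"
    if \<tau>: "\<tau> \<in> T" for \<tau>
  proof -
    have c: "fst \<tau> \<in> {1..\<rho>}" "fst (snd \<tau>) < k" "snd (snd \<tau>) \<in> pairs (fst (snd \<tau>))" using \<tau> by (auto simp: T_def)
    have c3: "card (triangle (fst \<tau>) (snd (snd \<tau>))) = 3" using card_triangle[OF c(3)] c(1) by simp
    have "(\<Sum>es\<in>edge_orders n. of_bool (triangle (fst \<tau>) (snd (snd \<tau>)) \<subseteq> set (take t es)))
        = real (card {es \<in> edge_orders n. triangle (fst \<tau>) (snd (snd \<tau>)) \<subseteq> set (take t es)})"
      by (simp add: sum_of_bool_eq Int_def)
    also have "\<dots> \<le> 8 * (real t / real N) ^ card (triangle (fst \<tau>) (snd (snd \<tau>))) * fact N"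
      unfolding N_def using triangle_subset[OF c(3,1,2)] c3 t N
      by (intro card_orders_all_early_le) (auto simp: N_def)
    finally show ?thesis by (simp only: c3)
  qed
  have "(\<Sum>es\<in>edge_orders n. real (card (wishlist es t)))
      \<le> (\<Sum>es\<in>edge_orders n. (\<Sum>\<alpha>\<in>A. of_bool ({fst \<alpha>, snd \<alpha>} \<in> set (take t es)))
      + (\<Sum>\<tau>\<in>T. of_bool (triangle (fst \<tau>) (snd (snd \<tau>)) \<subseteq> set (take t es))))"
    by (rule sum_mono) (rule pt)
  also have "\<dots> = (\<Sum>\<alpha>\<in>A. \<Sum>es\<in>edge_orders n. of_bool ({fst \<alpha>, snd \<alpha>} \<in> set (take t es)))
      + (\<Sum>\<tau>\<in>T. \<Sum>es\<in>edge_orders n. of_bool (triangle (fst \<tau>) (snd (snd \<tau>)) \<subseteq> set (take t es)))"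
    unfolding sum.distrib by (intro arg_cong2[where f = "(+)"] sum.swap)
  also have "\<dots> \<le> real (card A) * (8 * (real t / real N) * fact N) + real (card T) * (8 * (real t / real N) ^ 3 * fact N)"
    by (intro add_mono sum_bounded_above starP triP)
  also have "\<dots> \<le> (2 * real k * real \<rho> * real w) * (8 * (real t / real N) * fact N)
      + 2 * (real k * real \<rho> * real w ^ 2) * (8 * (real t / real N) ^ 3 * fact N)"
    unfolding cT using cA by (intro add_mono mult_right_mono) auto
  also have "\<dots> = 16 * real k * real \<rho> * (real w * (real t / real N) + real w ^ 2 * (real t / real N) ^ 3) * fact N"
    by (simp add: algebra_simps)
  finally show ?thesis .
qed

text \<open>Failure means that no fan is good or the wishlist exceeds the budget. These have
  probability at most \<open>F - 1\<close> by the second moment and \<open>W / b\<close> by Markov's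
  inequality, whence the leading 2.\<close>

lemma prob_contains_fan_rule_ge:
  fixes t h N b :: nat and q p :: real
  defines "N \<equiv> n choose 2"
  defines "q \<equiv> real h / real N" and "p \<equiv> real t / real N"
  assumes h: "3 * k < h" "2 * h \<le> t" and t: "t \<le> N" and N: "6 * k < N" and w: "w > 0" and \<rho>: "\<rho> > 0"
    and b: "b > 0"
  shows "prob_contains (triangle_fan k) n t (return_pmf (fan_rule b)) \<ge>
    2 - (real N / (real N - real (6 * k))) ^ (6 * k) / (1 - real (3 * k) / real h) ^ (6 * k)
        * (1 / real \<rho> * (1 + 2 / (real w * q) + 1 / (real w ^ 2 * q ^ 3)) ^ k + (1 + 1 / (real w ^ 2 * q)) ^ k)
      - 16 * real k * real \<rho> * (real w * p + real w ^ 2 * p ^ 3) / real b"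
proof -
  define F where "F = (real N / (real N - real (6 * k))) ^ (6 * k) / (1 - real (3 * k) / real h) ^ (6 * k)
        * (1 / real \<rho> * (1 + 2 / (real w * q) + 1 / (real w ^ 2 * q ^ 3)) ^ k + (1 + 1 / (real w ^ 2 * q)) ^ k)"
  define W where "W = 16 * real k * real \<rho> * (real w * p + real w ^ 2 * p ^ 3)"
  let ?\<Omega> = "edge_orders n"
  let ?S = "{es \<in> ?\<Omega>. contains_copy (triangle_fan k) (builder_graph n (fan_rule b) es t)}"
  let ?B1 = "{es \<in> ?\<Omega>. \<forall>\<kappa>\<in>fans. \<not> good h es \<kappa>}"
  let ?B2 = "{es \<in> ?\<Omega>. b < card (wishlist es t)}"
  have B1: "real (card ?B1) \<le> (F - 1) * fact N"
    unfolding F_def q_def N_def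
    by (rule card_orders_no_good_le) (use h t N w \<rho> in \<open>auto simp: N_def\<close>)
  have B2: "real (card ?B2) \<le> W / real b * fact N"
  proof -
    have "real (card ?B2) * real b = (\<Sum>es\<in>?B2. real b)" by simp
    also have "\<dots> \<le> (\<Sum>es\<in>?B2. real (card (wishlist es t)))" by (rule sum_mono) auto
    also have "\<dots> \<le> (\<Sum>es\<in>?\<Omega>. real (card (wishlist es t)))" by (rule sum_mono2) auto
    also have "\<dots> \<le> W * fact N"
      unfolding W_def p_def N_def using t N k by (intro sum_card_wishlist_le) (auto simp: N_def)
    finally show ?thesis using b by (simp add: field_simps)
  qed
  have "?\<Omega> \<subseteq> ?S \<union> (?B1 \<union> ?B2)"
  proof
    fix es assume es: "es \<in> ?\<Omega>"
    then have "distinct es" "length es = N"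
      using permutations_of_set_list[of es "complete_edges n"] by (simp_all add: edge_orders_def N_def)
    then show "es \<in> ?S \<union> (?B1 \<union> ?B2)"
      using contains_fan_if_good[of es t h b] es t h by (cases "card (wishlist es t) \<le> b") auto
  qed
  then have "card ?\<Omega> \<le> card (?S \<union> (?B1 \<union> ?B2))" by (intro card_mono) auto
  also have "\<dots> \<le> card ?S + (card ?B1 + card ?B2)"
    by (rule order_trans[OF card_Un_le]) (rule add_left_mono, rule card_Un_le)
  finally have "real (card ?\<Omega>) \<le> real (card ?S + (card ?B1 + card ?B2))" by (rule of_nat_mono)
  then have "fact N \<le> real (card ?S) + ((F - 1) * fact N + W / real b * fact N)"
    using B1 B2 by (simp add: N_def)
  then have "(2 - F - W / real b) * fact N \<le> real (card ?S)" by (simp add: algebra_simps)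
  then show ?thesis
    unfolding prob_contains_return_pmf F_def[symmetric] W_def[symmetric]
    by (simp add: le_divide_eq N_def)
qed

end

section \<open>Choice of parameters\<close>

lemma real_choose_two_le: "real (n choose 2) \<le> real n ^ 2 / 2"
proof -
  have "n choose 2 \<le> n * (n - 1) div 2" by (simp add: choose_two)
  also have "\<dots> \<le> n * n div 2" by (intro div_le_mono mult_le_mono) auto
  finally have "2 * (n choose 2) \<le> n * n" by simp
  then have "real (2 * (n choose 2)) \<le> real (n * n)" by (rule of_nat_mono)
  then show ?thesis by (simp add: power2_eq_square)
qed

lemma tb_strategy_fan_rule:
  assumes "centres_and_blocks k n \<rho> w"
  shows "tb_strategy n t b (return_pmf (centres_and_blocks.fan_rule k \<rho> w b))"
  using centres_and_blocks.card_purchased_fan_rule[OF assms] by (simp add: tb_strategy_def)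

text \<open>The block size is the largest for which the edges closing a triangle at a given centre stay
  few (\<open>y = w\<^sup>2 q\<^sup>3\<close> is at most \<open>\<theta>\<^sup>2\<close>), and \<open>\<rho>\<close> is large enough for some centre to be
  completed, which happens with probability of order \<open>min 1 (y ^ k)\<close> for each of them.\<close>
lemma fan_strategy_exists:
  fixes k n t b :: nat and \<theta> :: real
  defines "N \<equiv> n choose 2" and "C \<equiv> (16 * real k) ^ (2 * k) * 8 ^ k"
  assumes k: "k \<ge> 1" and t: "t \<le> N" "6 * k + 2 \<le> t" and n: "8 * k \<le> n"
    and \<theta>: "1 \<le> \<theta>" "16 * C \<le> \<theta> ^ 3"
    and \<theta>A: "\<theta> ^ 4 \<le> real t ^ (3 * k) / real n ^ (4 * k - 1)"
    and \<theta>n: "\<theta> ^ 4 \<le> real n"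
    and \<theta>b: "\<theta> ^ 4 \<le> real b / b_star n t k"
  shows "\<exists>S. tb_strategy n t b S \<and> prob_contains (triangle_fan k) n t S \<ge>
    2 - (real N / (real N - real (6 * k))) ^ (6 * k) / (1 - real (3 * k) / real (t div 2)) ^ (6 * k)
        * (4 ^ k / \<theta> + (1 + (512 * real k ^ 2 / real t + 4 / \<theta> ^ 2)) ^ k)
      - 6912 * real k * C / \<theta>"
proof -
  define h where "h = t div 2"
  define q where "q = real h / real N"
  define p where "p = real t / real N"
  \<comment> \<open>Avoids half-integer powers of \<open>q\<close>: the condition
    \<open>w^2 * q^3 \<le> \<theta>^2\<close> reads \<open>w \<le> \<theta> / u^3\<close>.\<close>
  define u where "u = sqrt q"
  define A where "A = real t ^ (3 * k) / real n ^ (4 * k - 1)"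
  define bs where "bs = b_star n t k"
  have h: "3 * k < h" "2 * h \<le> t" using t by (auto simp: h_def)
  have t3: "t \<le> 3 * h" using t k by (simp add: h_def)
  have N: "6 * k < N" using t by linarith
  have n0: "real n > 0" "n > 0" using n k by auto
  have t0: "real t > 0" using t k by simp
  have N0: "real N > 0" using N by simp
  have q0: "q > 0" using h N0 by (simp add: q_def)
  have q1: "q \<le> 1" using h t N0 by (simp add: q_def)
  have p: "0 \<le> p" "p \<le> 3 * q"
  proof -
    have "real t \<le> 3 * real h" using t3 by linarith
    then have "p \<le> 3 * real h / real N" unfolding p_def by (intro divide_right_mono) auto
    then show "p \<le> 3 * q" by (simp add: q_def)
  qed (simp add: p_def)
  have u0: "u > 0" and u1: "u \<le> 1" and u2: "u ^ 2 = q"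
    using q0 q1 by (auto simp: u_def real_sqrt_le_1_iff)
  \<comment> \<open>From \<open>t \<le> 3 * h\<close> and \<open>N \<le> n^2 / 2\<close> the
    constant would be \<open>3 / 2\<close>; it is rounded up.\<close>
  have qinv: "1 / q \<le> 2 * real n ^ 2 / real t"
  proof -
    have "real t \<le> 3 * real h" using t3 by linarith
    then have "real N * real t \<le> (real n ^ 2 / 2) * (3 * real h)"
      unfolding N_def by (intro mult_mono real_choose_two_le) auto
    also have "\<dots> \<le> 2 * real n ^ 2 * real h" by (simp add: mult_right_mono)
    finally show ?thesis using t0 h N0 by (simp add: q_def field_simps)
  qed
  have A0: "A > 0" using t0 n0 by (simp add: A_def)
  have nA: "real n ^ (4 * k) / real t ^ (3 * k) = real n / A"
  proof -
    have "real n ^ (4 * k) = real n * real n ^ (4 * k - 1)" using k by (simp add: power_eq_if)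
    then show ?thesis by (simp add: A_def)
  qed
  have bs1: "real n ^ (4 * k - 1) / real t ^ (3 * k - 1) \<le> bs" and bs2: "real n / sqrt (real t) \<le> bs"
    by (auto simp: bs_def b_star_def)
  have bs0: "bs > 0" using bs2 n0 t0 by (intro less_le_trans[OF _ bs2]) simp
  have b0: "b > 0"
  proof -
    have "1 \<le> \<theta> ^ 4" using \<theta>(1) by (rule one_le_power)
    then have "0 < real b / bs" using \<theta>b by (simp add: bs_def)
    then show ?thesis using bs0 by (simp add: zero_less_divide_iff)
  qed
  \<comment> \<open>In \<open>C\<close>, the factor \<open>(16 * k) ^ (2 * k)\<close> accounts for
    \<open>1 / w\<close> in the case of blocks of order \<open>n\<close>, and
    \<open>8 ^ k = 2 ^ (3 * k)\<close> for the constant 2 in the bound on \<open>1 / q\<close>. The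
    other case needs only \<open>4 ^ k\<close>.\<close>
  have C1: "C \<ge> 1" and C4: "4 ^ k \<le> C"
  proof -
    have "(1::real) \<le> (16 * real k) ^ (2 * k)" using k by (intro one_le_power) auto
    then have *: "8 ^ k \<le> C" unfolding C_def by (simp add: mult_le_cancel_right1)
    have "(4::real) ^ k \<le> 8 ^ k" by (intro power_mono) auto
    then show "4 ^ k \<le> C" using * by linarith
    have "(1::real) \<le> 8 ^ k" by (intro one_le_power) auto
    then show "C \<ge> 1" using * by linarith
  qed
  \<comment> \<open>The first cap lets the \<open>2 * k\<close> blocks take at most
    \<open>n / 4\<close> vertices, beside at most \<open>n / 2\<close> centres. The factor \<theta>
    in the second keeps \<open>1 / (w^2 * q)\<close> small even when \<open>q\<close> is bounded
    away from 0.\<close>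
  define m where "m = min (real n / (8 * real k)) (\<theta> / u ^ 3)"
  have m1: "m \<ge> 1"
  proof -
    have "1 \<le> real n / (8 * real k)" using n k by (simp add: le_divide_eq)
    moreover have "u ^ 3 \<le> 1" using u0 u1 by (intro power_le_one) auto
    then have "1 \<le> \<theta> / u ^ 3" using \<theta>(1) u0 by (simp add: le_divide_eq)
    ultimately show ?thesis by (simp add: m_def)
  qed
  define w where "w = nat \<lfloor>m\<rfloor>"
  have wm: "real w \<le> m" "m / 2 \<le> real w"
  proof -
    have f: "1 \<le> \<lfloor>m\<rfloor>" using m1 by simp
    then have rw: "real w = real_of_int \<lfloor>m\<rfloor>" by (simp add: w_def)
    show "real w \<le> m" by (simp add: rw)
    have "m < real_of_int \<lfloor>m\<rfloor> + 1" by linarith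
    moreover have "1 \<le> real_of_int \<lfloor>m\<rfloor>" using f by linarith
    ultimately show "m / 2 \<le> real w" unfolding rw by linarith
  qed
  have w0: "real w > 0" using wm m1 by linarith
  have wn: "real w \<le> real n / (8 * real k)" and wu: "real w \<le> \<theta> / u ^ 3" using wm by (auto simp: m_def)
  have winv: "1 / real w \<le> max (16 * real k / real n) (2 * u ^ 3 / \<theta>)"
  proof -
    have "1 / real w \<le> 1 / (m / 2)" using wm m1 by (intro divide_left_mono) auto
    also have "\<dots> = 2 / m" by simp
    also have "\<dots> \<le> max (16 * real k / real n) (2 * u ^ 3 / \<theta>)"
    proof (cases "real n / (8 * real k) \<le> \<theta> / u ^ 3")
      case True
      then have "m = real n / (8 * real k)" by (simp add: m_def)
      then have "2 / m = 16 * real k / real n" by simp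
      then show ?thesis by simp
    next
      case False
      then have "m = \<theta> / u ^ 3" by (simp add: m_def)
      then have "2 / m = 2 * u ^ 3 / \<theta>" by simp
      then show ?thesis by simp
    qed
    finally show ?thesis .
  qed
  have winv_pow: "(1 / real w) ^ j \<le> (16 * real k / real n) ^ j + (2 * u ^ 3 / \<theta>) ^ j" for j
  proof -
    have "(1 / real w) ^ j \<le> max (16 * real k / real n) (2 * u ^ 3 / \<theta>) ^ j"
      using winv by (intro power_mono) auto
    also have "\<dots> \<le> (16 * real k / real n) ^ j + (2 * u ^ 3 / \<theta>) ^ j"
      using u0 \<theta>(1) by (cases "16 * real k / real n \<le> 2 * u ^ 3 / \<theta>") (auto simp: max_def)
    finally show ?thesis .
  qed
  have winv_pow': "(1 / real w) ^ j \<le> (16 * real k / real n) ^ j + (2 * u ^ 3) ^ j" for j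
  proof -
    have "2 * u ^ 3 / \<theta> \<le> 2 * u ^ 3" using \<theta>(1) u0 by (simp add: divide_le_eq mult_le_cancel_left1)
    then have "(2 * u ^ 3 / \<theta>) ^ j \<le> (2 * u ^ 3) ^ j" using u0 \<theta>(1) by (intro power_mono) auto
    then show ?thesis using winv_pow[of j] by linarith
  qed
  define y where "y = real w ^ 2 * q ^ 3"
  have y0: "y > 0" using w0 q0 by (simp add: y_def)
  \<comment> \<open>The number of centres needed, up to constants, when \<open>y\<close> is
    small.\<close>
  define Y where "Y = 1 / y ^ k"
  have Y0: "Y \<ge> 0" using y0 by (simp add: Y_def)
  have Y_eq: "Y = (1 / real w) ^ (2 * k) * (1 / q) ^ (3 * k)"
    by (simp add: Y_def y_def power_mult_distrib power_mult power_divide)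
  have qinv_pow: "(1 / q) ^ j \<le> 2 ^ j * real n ^ (2 * j) / real t ^ j" for j
  proof -
    have "(1 / q) ^ j \<le> (2 * real n ^ 2 / real t) ^ j" using qinv q0 by (intro power_mono) auto
    then show ?thesis by (simp add: power_divide power_mult_distrib power_mult)
  qed
  \<comment> \<open>One summand for each cap on \<open>w\<close>: the first gives
    \<open>n / A = n ^ (4 * k) / t ^ (3 * k)\<close>, the second a constant.\<close>
  have Yle: "Y \<le> C * (real n / A + 1)"
  proof -
    have "Y \<le> ((16 * real k / real n) ^ (2 * k) + (2 * u ^ 3) ^ (2 * k)) * (1 / q) ^ (3 * k)"
      unfolding Y_eq using q0 by (intro mult_right_mono winv_pow') auto
    also have "\<dots> = (16 * real k / real n) ^ (2 * k) * (1 / q) ^ (3 * k) + (2 * u ^ 3) ^ (2 * k) * (1 / q) ^ (3 * k)"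
      by (rule distrib_right)
    also have "(2 * u ^ 3) ^ (2 * k) * (1 / q) ^ (3 * k) = 4 ^ k"
    proof -
      have "(2 * u ^ 3) ^ (2 * k) = ((2 * u ^ 3) ^ 2) ^ k" by (rule power_mult)
      also have "(2 * u ^ 3) ^ 2 = 4 * (u ^ 2) ^ 3" by (simp add: power_mult_distrib flip: power_mult)
      finally have "(2 * u ^ 3) ^ (2 * k) = 4 ^ k * q ^ (3 * k)"
        by (simp add: u2 power_mult_distrib power_mult)
      then show ?thesis using q0 by (simp add: power_divide)
    qed
    also have "(16 * real k / real n) ^ (2 * k) * (1 / q) ^ (3 * k) \<le> C * (real n / A)"
    proof -
      have "(16 * real k / real n) ^ (2 * k) * (1 / q) ^ (3 * k)
          \<le> (16 * real k / real n) ^ (2 * k) * (2 ^ (3 * k) * real n ^ (2 * (3 * k)) / real t ^ (3 * k))"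
        by (intro mult_left_mono qinv_pow) simp
      also have "\<dots> = C * (real n ^ (2 * (3 * k)) / real n ^ (2 * k) / real t ^ (3 * k))"
        by (simp add: C_def power_divide power_mult)
      also have "real n ^ (2 * (3 * k)) / real n ^ (2 * k) = real n ^ (4 * k)"
      proof -
        have "real n ^ (2 * (3 * k)) = real n ^ (4 * k) * real n ^ (2 * k)"
          by (simp add: power_add[symmetric])
        then show ?thesis using n0 by simp
      qed
      finally show ?thesis by (simp only: nA)
    qed
    finally show ?thesis using C4 by (simp add: distrib_left)
  qed
  \<comment> \<open>The summand 1 serves the case of large \<open>y\<close>, where the mean would
    allow less than one centre. As the argument is at least 1, rounding up at most doubles
    it.\<close>
  define \<rho> where "\<rho> = nat \<lceil>\<theta> * (1 + Y)\<rceil>"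
  have \<theta>Y: "1 \<le> \<theta> * (1 + Y)"
    using mult_mono[OF \<theta>(1), of 1 "1 + Y"] Y0 \<theta>(1) by simp
  have \<rho>_ge: "\<theta> * (1 + Y) \<le> real \<rho>" unfolding \<rho>_def by (rule real_nat_ceiling_ge)
  have \<rho>_le: "real \<rho> \<le> 2 * \<theta> * (1 + Y)"
  proof -
    have "real \<rho> \<le> \<theta> * (1 + Y) + 1" unfolding \<rho>_def using \<theta>Y by linarith
    then show ?thesis using \<theta>Y by linarith
  qed
  have \<rho>0: "\<rho> > 0" using \<rho>_ge \<theta>Y by linarith
  have \<theta>C: "16 * C * \<theta> \<le> \<theta> ^ 4"
  proof -
    have "16 * C * \<theta> \<le> \<theta> ^ 3 * \<theta>" using \<theta> by (intro mult_right_mono) auto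
    also have "\<dots> = \<theta> ^ 4" by (simp add: power_eq_if)
    finally show ?thesis .
  qed
  \<comment> \<open>The lower bound on \<open>t\<close> enters here:
    \<open>A \<ge> \<theta> ^ 4\<close> absorbs the factor \<open>16 * C * \<theta>\<close> and
    keeps the centres within half of the vertices.\<close>
  have \<rho>n: "real \<rho> \<le> real n / 2"
  proof -
    have x0: "0 \<le> real n / A" using A0 by simp
    have "1 + Y \<le> 2 * C * (real n / A + 1)"
    proof -
      have "1 * 1 \<le> C * (real n / A + 1)" using C1 x0 by (intro mult_mono) auto
      then show ?thesis using Yle by linarith
    qed
    then have "2 * \<theta> * (1 + Y) \<le> 2 * \<theta> * (2 * C * (real n / A + 1))"
      using \<theta>(1) by (intro mult_left_mono) auto
    also have "\<dots> = (16 * C * \<theta>) * (real n / A) / 4 + (16 * C * \<theta>) / 4"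
      by (simp add: algebra_simps)
    also have "\<dots> \<le> A * (real n / A) / 4 + real n / 4"
      using \<theta>C \<theta>A \<theta>n x0 unfolding A_def[symmetric]
      by (intro add_mono divide_right_mono mult_right_mono) auto
    also have "\<dots> = real n / 2" using A0 by simp
    finally show ?thesis using \<rho>_le by linarith
  qed
  have fits: "\<rho> + 2 * k * w \<le> n"
  proof -
    have "2 * real k * real w \<le> 2 * real k * (real n / (8 * real k))"
      using wn by (intro mult_left_mono) auto
    also have "\<dots> = real n / 4" using k by simp
    finally have "real (\<rho> + 2 * k * w) \<le> real n" using \<rho>n n0 by simp
    then show ?thesis by linarith
  qed
  interpret centres_and_blocks k n \<rho> w using k fits by unfold_locales
  have uinv: "1 / u \<le> 2 * bs"
  proof -
    have "1 / u = sqrt (1 / q)" by (simp add: u_def real_sqrt_divide)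
    also have "\<dots> \<le> sqrt (2 * real n ^ 2 / real t)" using qinv by (rule real_sqrt_le_mono)
    also have "\<dots> \<le> sqrt (2 ^ 2 * real n ^ 2 / real t)"
      using t0 by (intro real_sqrt_le_mono divide_right_mono mult_right_mono) auto
    also have "\<dots> = 2 * (real n / sqrt (real t))" by (simp add: real_sqrt_divide real_sqrt_mult)
    also have "\<dots> \<le> 2 * bs" using bs2 by simp
    finally show ?thesis .
  qed
  have wq: "real w * q \<le> 2 * \<theta> * bs"
  proof -
    have "real w * q \<le> \<theta> / u ^ 3 * u ^ 2" unfolding u2[symmetric] using wu u0 by (intro mult_right_mono) auto
    also have "\<dots> = \<theta> * (1 / u)" using u0 by (simp add: power2_eq_square power3_eq_cube)
    also have "\<dots> \<le> \<theta> * (2 * bs)" using uinv \<theta>(1) by (intro mult_left_mono) auto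
    finally show ?thesis by simp
  qed
  \<comment> \<open>The factor \<open>w * q\<close> removes one power of each inverse. What remains
    is the first term of \<open>b_star\<close> under the cap of order \<open>n\<close>, and
    \<open>1 / u\<close>, hence the second term, under the other cap.\<close>
  have Ywq: "Y * (real w * q) \<le> 2 * C * bs"
  proof -
    define j where "j = 2 * k - 1"
    have j: "2 * k = Suc j" "3 * k = Suc (3 * k - 1)" using k by (auto simp: j_def)
    have "Y * (real w * q) = (1 / real w) ^ j * (1 / q) ^ (3 * k - 1)"
    proof -
      have "Y = (1 / real w) ^ Suc j * (1 / q) ^ Suc (3 * k - 1)" unfolding Y_eq using j by metis
      then show ?thesis using w0 q0 by simp
    qed
    also have "\<dots> \<le> ((16 * real k / real n) ^ j + (2 * u ^ 3) ^ j) * (1 / q) ^ (3 * k - 1)"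
      using q0 by (intro mult_right_mono winv_pow') auto
    also have "\<dots> = (16 * real k / real n) ^ j * (1 / q) ^ (3 * k - 1) + (2 * u ^ 3) ^ j * (1 / q) ^ (3 * k - 1)"
      by (rule distrib_right)
    also have "\<dots> \<le> C * bs + C * bs"
    proof (rule add_mono)
      have "(16 * real k / real n) ^ j * (1 / q) ^ (3 * k - 1)
          \<le> (16 * real k / real n) ^ j * (2 ^ (3 * k - 1) * real n ^ (2 * (3 * k - 1)) / real t ^ (3 * k - 1))"
        by (intro mult_left_mono qinv_pow) simp
      also have "\<dots> = (16 * real k) ^ j * 2 ^ (3 * k - 1) * (real n ^ (2 * (3 * k - 1)) / real n ^ j / real t ^ (3 * k - 1))"
        by (simp add: power_divide)
      also have "real n ^ (2 * (3 * k - 1)) / real n ^ j = real n ^ (4 * k - 1)"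
      proof -
        have "2 * (3 * k - 1) = (4 * k - 1) + j" using k by (simp add: j_def)
        then show ?thesis using n0 by (simp add: power_add)
      qed
      also have "(16 * real k) ^ j * 2 ^ (3 * k - 1) * (real n ^ (4 * k - 1) / real t ^ (3 * k - 1)) \<le> C * bs"
      proof (rule mult_mono)
        have "(16 * real k) ^ j \<le> (16 * real k) ^ (2 * k)" using k by (intro power_increasing) (auto simp: j_def)
        moreover have "(2::real) ^ (3 * k - 1) \<le> 2 ^ (3 * k)" by (intro power_increasing) auto
        moreover have "(2::real) ^ (3 * k) = 8 ^ k" by (simp add: power_mult)
        ultimately show "(16 * real k) ^ j * 2 ^ (3 * k - 1) \<le> C" unfolding C_def by (intro mult_mono) auto
      qed (use bs1 C1 in auto)
      finally show "(16 * real k / real n) ^ j * (1 / q) ^ (3 * k - 1) \<le> C * bs" .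
    next
      have "(2 * u ^ 3) ^ j * (1 / q) ^ (3 * k - 1) = 2 ^ j * (1 / u)"
      proof -
        have "2 * (3 * k - 1) = 3 * j + 1" using k by (simp add: j_def)
        then have "q ^ (3 * k - 1) = u ^ (3 * j) * u" unfolding u2[symmetric] power_mult[symmetric] by simp
        then show ?thesis using u0 by (simp add: power_divide power_mult_distrib power_mult)
      qed
      also have "\<dots> \<le> 2 ^ j * (2 * bs)" using uinv by (intro mult_left_mono) auto
      also have "\<dots> = 4 ^ k * bs"
      proof -
        have "(4::real) ^ k = 2 ^ Suc j" unfolding j(1)[symmetric] by (simp add: power_mult)
        then show ?thesis by simp
      qed
      also have "\<dots> \<le> C * bs" using C4 bs0 by (intro mult_right_mono) auto
      finally show "(2 * u ^ 3) ^ j * (1 / q) ^ (3 * k - 1) \<le> C * bs" .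
    qed
    finally show ?thesis by simp
  qed
  \<comment> \<open>Three factors \<theta> accumulate, from the block size, the number of centres
    and the ratio of cross edges to star edges. The assumed \<open>\<theta> ^ 4\<close> leaves
    \<open>1 / \<theta>\<close>; the constant is \<open>16 * 54 * 8\<close>.\<close>
  have cost: "16 * real k * real \<rho> * (real w * p + real w ^ 2 * p ^ 3) / real b \<le> 6912 * real k * C / \<theta>"
  proof -
    have wq2: "real w * q ^ 2 \<le> \<theta>"
    proof -
      have "real w * q ^ 2 \<le> \<theta> / u ^ 3 * (u ^ 2) ^ 2" unfolding u2[symmetric] using wu u0 by (intro mult_right_mono) auto
      also have "\<dots> = \<theta> * u" using u0 by (simp add: power2_eq_square power3_eq_cube)
      also have "\<dots> \<le> \<theta>" using u1 \<theta>(1) by (simp add: mult_le_cancel_left1)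
      finally show ?thesis .
    qed
    have "real w * p + real w ^ 2 * p ^ 3 \<le> real w * (3 * q) + real w ^ 2 * (3 * q) ^ 3"
      using p w0 by (intro add_mono mult_left_mono power_mono) auto
    also have "\<dots> = real w * q * (3 + 27 * (real w * q ^ 2))"
      by (simp add: power2_eq_square power3_eq_cube algebra_simps)
    also have "\<dots> \<le> real w * q * (54 * \<theta>)"
      using wq2 \<theta>(1) w0 q0 by (intro mult_left_mono) auto
    finally have S: "real w * p + real w ^ 2 * p ^ 3 \<le> real w * q * (54 * \<theta>)" .
    have "real \<rho> * (real w * q) \<le> 2 * \<theta> * (1 + Y) * (real w * q)"
      using \<rho>_le w0 q0 by (intro mult_right_mono) auto
    also have "\<dots> = 2 * \<theta> * (real w * q + Y * (real w * q))" by (simp add: algebra_simps)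
    also have "\<dots> \<le> 2 * \<theta> * (2 * \<theta> * bs + 2 * C * bs)"
      using wq Ywq \<theta>(1) by (intro mult_left_mono add_mono) auto
    also have "\<dots> \<le> 2 * \<theta> * (2 * (C * \<theta>) * bs + 2 * (C * \<theta>) * bs)"
    proof -
      have "\<theta> \<le> C * \<theta>" "C \<le> C * \<theta>" using C1 \<theta>(1) by (auto simp: mult_le_cancel_right1 mult_le_cancel_left1)
      then show ?thesis using \<theta>(1) bs0 by (intro mult_left_mono add_mono mult_right_mono) auto
    qed
    also have "\<dots> = 8 * C * \<theta> ^ 2 * bs" by (simp add: power2_eq_square)
    finally have R: "real \<rho> * (real w * q) \<le> 8 * C * \<theta> ^ 2 * bs" .
    have "16 * real k * real \<rho> * (real w * p + real w ^ 2 * p ^ 3)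
        \<le> 16 * real k * real \<rho> * (real w * q * (54 * \<theta>))"
      using S by (intro mult_left_mono) auto
    also have "\<dots> = 864 * real k * \<theta> * (real \<rho> * (real w * q))" by simp
    also have "\<dots> \<le> 864 * real k * \<theta> * (8 * C * \<theta> ^ 2 * bs)"
      using R \<theta>(1) by (intro mult_left_mono) auto
    also have "\<dots> = 6912 * real k * C * \<theta> ^ 3 * bs" by (simp add: power2_eq_square power3_eq_cube)
    also have "\<dots> \<le> 6912 * real k * C / \<theta> * real b"
    proof -
      have "\<theta> ^ 4 * bs \<le> real b" using \<theta>b bs0 by (simp add: bs_def le_divide_eq)
      moreover have "\<theta> ^ 4 = \<theta> ^ 3 * \<theta>" by (simp add: power_eq_if)
      ultimately have "\<theta> ^ 3 * bs \<le> real b / \<theta>" using \<theta>(1) by (simp add: le_divide_eq mult_ac)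
      then have "6912 * real k * C * (\<theta> ^ 3 * bs) \<le> 6912 * real k * C * (real b / \<theta>)"
        using C1 by (intro mult_left_mono) auto
      then show ?thesis by simp
    qed
    finally show ?thesis using b0 by (simp add: divide_le_eq)
  qed
  have same: "1 / real \<rho> * (1 + 2 / (real w * q) + 1 / (real w ^ 2 * q ^ 3)) ^ k \<le> 4 ^ k / \<theta>"
  proof -
    define a where "a = 1 / (real w * q)"
    have a0: "a > 0" using w0 q0 by (simp add: a_def)
    have "a ^ 2 \<le> 1 / y"
    proof -
      have "y \<le> (real w * q) ^ 2"
        unfolding y_def power_mult_distrib using q0 q1 by (intro mult_left_mono power_decreasing) auto
      then show ?thesis using y0 w0 q0 by (simp add: a_def power_divide divide_left_mono)
    qed
    \<comment> \<open>Pairs of triangles sharing one block vertex need no separate treatment: their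
      term \<open>2 * a\<close> is absorbed by \<open>1 + a^2\<close>, and
      \<open>a^2 \<le> 1 / y\<close>.\<close>
    moreover have "0 \<le> (1 - a) ^ 2" by simp
    then have "2 * a \<le> 1 + a ^ 2" by (simp add: power2_eq_square algebra_simps)
    ultimately have "1 + 2 * a + 1 / y \<le> 2 + 2 * (1 / y)" by linarith
    also have "\<dots> \<le> 4 * max 1 (1 / y)" by (simp add: max_def)
    finally have "(1 + 2 * a + 1 / y) ^ k \<le> (4 * max 1 (1 / y)) ^ k"
      using a0 y0 by (intro power_mono) auto
    also have "\<dots> = 4 ^ k * max 1 (1 / y) ^ k" by (rule power_mult_distrib)
    also have "\<dots> \<le> 4 ^ k * (1 + Y)"
      using y0 Y0 by (intro mult_left_mono) (auto simp: Y_def max_def power_divide)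
    finally have "1 / real \<rho> * (1 + 2 * a + 1 / y) ^ k \<le> 1 / real \<rho> * (4 ^ k * (1 + Y))"
      using \<rho>0 by (intro mult_left_mono) auto
    also have "\<dots> \<le> 1 / (\<theta> * (1 + Y)) * (4 ^ k * (1 + Y))"
      using \<rho>_ge \<theta>Y \<rho>0 Y0 by (intro mult_right_mono divide_left_mono) auto
    also have "\<dots> = 4 ^ k / \<theta>" using Y0 by simp
    finally show ?thesis by (simp add: a_def y_def)
  qed
  have other: "1 / (real w ^ 2 * q) \<le> 512 * real k ^ 2 / real t + 4 / \<theta> ^ 2"
  proof -
    have "1 / (real w ^ 2 * q) = (1 / real w) ^ 2 * (1 / q)" by (simp add: power_divide)
    also have "\<dots> \<le> ((16 * real k / real n) ^ 2 + (2 * u ^ 3 / \<theta>) ^ 2) * (1 / q)"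
      using q0 by (intro mult_right_mono winv_pow) auto
    also have "\<dots> = (16 * real k / real n) ^ 2 * (1 / q) + (2 * u ^ 3 / \<theta>) ^ 2 * (1 / q)"
      by (rule distrib_right)
    also have "\<dots> \<le> 512 * real k ^ 2 / real t + 4 / \<theta> ^ 2"
    proof (rule add_mono)
      have "(16 * real k / real n) ^ 2 * (1 / q) \<le> (16 * real k / real n) ^ 2 * (2 * real n ^ 2 / real t)"
        using qinv by (intro mult_left_mono) auto
      also have "\<dots> = 512 * real k ^ 2 / real t" using n0 by (simp add: power_divide power_mult_distrib)
      finally show "(16 * real k / real n) ^ 2 * (1 / q) \<le> 512 * real k ^ 2 / real t" .
      have "(2 * u ^ 3 / \<theta>) ^ 2 * (1 / q) = 4 / \<theta> ^ 2 * q ^ 2"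
        unfolding u2[symmetric] using u0
        by (simp add: power2_eq_square power3_eq_cube)
      also have "\<dots> \<le> 4 / \<theta> ^ 2" using q0 q1 by (intro mult_right_le_one_le power_le_one) auto
      finally show "(2 * u ^ 3 / \<theta>) ^ 2 * (1 / q) \<le> 4 / \<theta> ^ 2" .
    qed
    finally show ?thesis .
  qed
  define G where "G = (real N / (real N - real (6 * k))) ^ (6 * k) / (1 - real (3 * k) / real h) ^ (6 * k)"
  have G0: "G \<ge> 0" using N h unfolding G_def by (intro divide_nonneg_nonneg zero_le_power) auto
  have "2 - G * (4 ^ k / \<theta> + (1 + (512 * real k ^ 2 / real t + 4 / \<theta> ^ 2)) ^ k) - 6912 * real k * C / \<theta>
    \<le> 2 - G * (1 / real \<rho> * (1 + 2 / (real w * q) + 1 / (real w ^ 2 * q ^ 3)) ^ k + (1 + 1 / (real w ^ 2 * q)) ^ k)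
      - 16 * real k * real \<rho> * (real w * p + real w ^ 2 * p ^ 3) / real b"
    using q0 by (intro diff_mono cost diff_left_mono mult_left_mono G0 add_mono same power_mono add_left_mono other) auto
  also have "\<dots> \<le> prob_contains (triangle_fan k) n t (return_pmf (fan_rule b))"
    unfolding G_def q_def p_def N_def
    by (rule prob_contains_fan_rule_ge) (use h t N w0 \<rho>0 b0 in \<open>auto simp: N_def\<close>)
  finally show ?thesis
    using tb_strategy_fan_rule[of k n \<rho> w t b] centres_and_blocks_axioms unfolding G_def h_def by blast
qed

section \<open>The threshold theorem\<close>

lemma filterlim_min_at_top:
  fixes f g :: "'a \<Rightarrow> real"
  assumes "filterlim f at_top F" "filterlim g at_top F"
  shows "filterlim (\<lambda>x. min (f x) (g x)) at_top F"
  unfolding filterlim_at_top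
proof
  fix Z
  have "eventually (\<lambda>x. Z \<le> f x) F" "eventually (\<lambda>x. Z \<le> g x) F"
    using assms by (auto simp: filterlim_at_top)
  then show "eventually (\<lambda>x. Z \<le> min (f x) (g x)) F" by eventually_elim simp
qed

text \<open>All corrections vanish, leaving \<open>2 - 1 * (0 + 1) - 0\<close>.\<close>

lemma fan_strategy_error_tendsto:
  fixes x y \<theta> s :: "nat \<Rightarrow> real" and c d C a :: real
  assumes x: "filterlim x at_top sequentially" and y: "filterlim y at_top sequentially"
    and \<theta>: "filterlim \<theta> at_top sequentially" and s: "filterlim s at_top sequentially"
  shows "(\<lambda>n. 2 - (x n / (x n - c)) ^ m / (1 - d / y n) ^ m
        * (4 ^ k / \<theta> n + (1 + (a / s n + 4 / \<theta> n ^ 2)) ^ k) - C / \<theta> n) \<longlonglongrightarrow> 1"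
proof -
  have inv: "(\<lambda>n. e / z n) \<longlonglongrightarrow> 0" if "filterlim z at_top sequentially" for z :: "nat \<Rightarrow> real" and e
    by (rule tendsto_divide_0[OF tendsto_const filterlim_at_top_imp_at_infinity[OF that]])
  have "(\<lambda>n. 1 / (1 - c / x n)) \<longlonglongrightarrow> 1 / (1 - 0)" by (intro tendsto_intros inv x) simp
  moreover have "eventually (\<lambda>n. 1 / (1 - c / x n) = x n / (x n - c)) sequentially"
    using filterlim_at_top_dense[THEN iffD1, OF x, rule_format, of "max 0 c"]
    by eventually_elim (simp add: field_simps)
  ultimately have X: "(\<lambda>n. x n / (x n - c)) \<longlonglongrightarrow> 1" by (simp add: tendsto_cong)
  have \<theta>2: "filterlim (\<lambda>n. \<theta> n ^ 2) at_top sequentially" using \<theta> by (intro filterlim_pow_at_top) auto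
  have "(\<lambda>n. 2 - (x n / (x n - c)) ^ m / (1 - d / y n) ^ m
        * (4 ^ k / \<theta> n + (1 + (a / s n + 4 / \<theta> n ^ 2)) ^ k) - C / \<theta> n)
    \<longlonglongrightarrow> 2 - 1 ^ m / (1 - 0) ^ m * (0 + (1 + (0 + 0)) ^ k) - 0"
    by (intro tendsto_intros X inv y \<theta> s \<theta>2) auto
  then show ?thesis by simp
qed

lemma exists_fan_strategy:
  fixes k :: nat and t b :: "nat \<Rightarrow> nat"
  assumes k: "k \<ge> 1" and t: "\<forall>n. t n \<le> n choose 2"
    and many: "is_omega (\<lambda>n. real (t n)) (\<lambda>n. real n powr ((4 * real k - 1) / (3 * real k)))"
    and budget: "is_omega (\<lambda>n. real (b n)) (\<lambda>n. b_star n (t n) k)"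
  shows "\<exists>B :: nat \<Rightarrow> strategy. (\<forall>n. tb_strategy n (t n) (b n) (B n)) \<and>
            (\<lambda>n. prob_contains (triangle_fan k) n (t n) (B n)) \<longlonglongrightarrow> 1"
proof -
  define C where "C = (16 * real k) ^ (2 * k) * 8 ^ k"
  define x where "x n = real (t n) / real n powr ((4 * real k - 1) / (3 * real k))" for n
  define A where "A n = real (t n) ^ (3 * k) / real n ^ (4 * k - 1)" for n
  define \<omega> where "\<omega> n = real (b n) / b_star n (t n) k" for n
  \<comment> \<open>With this minimum, \<open>\<theta> ^ 4 = \<mu>\<close> lies below all three
    quantities that have to dominate it and still tends to infinity.\<close>
  define \<mu> where "\<mu> n = min (min (\<omega> n) (A n)) (real n)" for n
  define \<theta> where "\<theta> n = sqrt (sqrt (\<mu> n))" for n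
  have x: "filterlim x at_top sequentially" using many by (simp add: is_omega_def x_def[abs_def])
  have \<omega>: "filterlim \<omega> at_top sequentially" using budget by (simp add: is_omega_def \<omega>_def[abs_def])
  have A: "filterlim A at_top sequentially"
  proof -
    have "filterlim (\<lambda>n. x n ^ (3 * k)) at_top sequentially" using x k by (intro filterlim_pow_at_top) auto
    moreover have "eventually (\<lambda>n. x n ^ (3 * k) = A n) sequentially"
      using eventually_gt_at_top[of 0]
      by eventually_elim (simp only: x_def A_def power_divide powr_threshold_power[OF k])
    ultimately show ?thesis by (simp add: filterlim_cong[OF refl refl])
  qed
  have rt: "filterlim (\<lambda>n. real (t n)) at_top sequentially"
  proof (rule filterlim_at_top_mono[OF x])
    show "eventually (\<lambda>n. x n \<le> real (t n)) sequentially"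
      using eventually_gt_at_top[of 0]
    proof eventually_elim
      case (elim n)
      have "1 \<le> real n powr ((4 * real k - 1) / (3 * real k))"
        using elim k by (intro ge_one_powr_ge_zero) auto
      then have "x n \<le> real (t n) / 1" unfolding x_def using elim by (intro divide_left_mono) auto
      then show ?case by simp
    qed
  qed
  have rN: "filterlim (\<lambda>n. real (n choose 2)) at_top sequentially"
    by (rule filterlim_at_top_mono[OF rt]) (use t in auto)
  have rh: "filterlim (\<lambda>n. real (t n div 2)) at_top sequentially"
    unfolding filterlim_at_top
  proof
    fix Z :: real
    have "eventually (\<lambda>n. 2 * Z + 1 \<le> real (t n)) sequentially" using rt by (auto simp: filterlim_at_top)
    then show "eventually (\<lambda>n. Z \<le> real (t n div 2)) sequentially"
    proof eventually_elim
      case (elim n)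
      have "t n \<le> 2 * (t n div 2) + 1" by simp
      then have "real (t n) \<le> real (2 * (t n div 2) + 1)" by (rule of_nat_mono)
      then show ?case using elim by simp
    qed
  qed
  have \<mu>: "filterlim \<mu> at_top sequentially"
    unfolding \<mu>_def[abs_def] by (intro filterlim_min_at_top \<omega> A filterlim_real_sequentially)
  have \<theta>: "filterlim \<theta> at_top sequentially"
    unfolding \<theta>_def[abs_def] by (intro filterlim_compose[OF sqrt_at_top] \<mu>)
  define g where "g n = 2 - (real (n choose 2) / (real (n choose 2) - real (6 * k))) ^ (6 * k)
          / (1 - real (3 * k) / real (t n div 2)) ^ (6 * k)
        * (4 ^ k / \<theta> n + (1 + (512 * real k ^ 2 / real (t n) + 4 / \<theta> n ^ 2)) ^ k)
      - 6912 * real k * C / \<theta> n" for n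
  have g: "g \<longlonglongrightarrow> 1" unfolding g_def[abs_def] by (intro fan_strategy_error_tendsto rN rh \<theta> rt)
  have "eventually (\<lambda>n. max 1 (16 * C) \<le> \<theta> n) sequentially"
    "eventually (\<lambda>n. real (6 * k + 2) \<le> real (t n)) sequentially"
    "eventually (\<lambda>n. 0 \<le> \<mu> n) sequentially"
    using \<theta> rt \<mu> by (auto simp only: filterlim_at_top)
  then have ev: "eventually (\<lambda>n. \<exists>S. tb_strategy n (t n) (b n) S \<and>
      prob_contains (triangle_fan k) n (t n) S \<ge> g n) sequentially"
    using eventually_ge_at_top[of "8 * k"]
  proof eventually_elim
    case (elim n)
    have "\<theta> n ^ 4 = ((\<theta> n) ^ 2) ^ 2" by (simp flip: power_mult)
    then have \<theta>4: "\<theta> n ^ 4 = \<mu> n" using elim(3) by (simp add: \<theta>_def)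
    have "\<theta> n ^ 1 \<le> \<theta> n ^ 3" using elim(1) by (intro power_increasing) auto
    then have \<theta>3: "16 * C \<le> \<theta> n ^ 3" using elim(1) by simp
    show ?case
      unfolding g_def C_def
      by (rule fan_strategy_exists)
        (use k t elim \<theta>3 in \<open>auto simp: \<theta>4 C_def \<mu>_def \<omega>_def A_def\<close>)
  qed
  \<comment> \<open>A strategy is due for every \<open>n\<close>. Never buying respects any budget,
    so one also exists for the finitely many \<open>n\<close> outside the asymptotic range.\<close>
  have trivial: "tb_strategy n (t n) (b n) (return_pmf (\<lambda>_ _. False))" for n
  proof -
    have "purchased (\<lambda>_ _. False) es s = {}" for es s by (induction s) auto
    then show ?thesis by (simp add: tb_strategy_def)
  qed
  have "\<forall>n. \<exists>S. tb_strategy n (t n) (b n) S \<and>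
      ((\<exists>S. tb_strategy n (t n) (b n) S \<and> prob_contains (triangle_fan k) n (t n) S \<ge> g n)
        \<longrightarrow> prob_contains (triangle_fan k) n (t n) S \<ge> g n)"
    using trivial by blast
  then obtain B where B: "\<And>n. tb_strategy n (t n) (b n) (B n)"
    "\<And>n. (\<exists>S. tb_strategy n (t n) (b n) S \<and> prob_contains (triangle_fan k) n (t n) S \<ge> g n)
        \<Longrightarrow> prob_contains (triangle_fan k) n (t n) (B n) \<ge> g n"
    by metis
  have "eventually (\<lambda>n. g n \<le> prob_contains (triangle_fan k) n (t n) (B n)) sequentially"
    using ev by eventually_elim (rule B(2))
  moreover have "eventually (\<lambda>n. prob_contains (triangle_fan k) n (t n) (B n) \<le> 1) sequentially"
    by (simp add: prob_contains_def)
  ultimately have "(\<lambda>n. prob_contains (triangle_fan k) n (t n) (B n)) \<longlonglongrightarrow> 1"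
    using g tendsto_const by (rule tendsto_sandwich)
  then show ?thesis using B(1) by blast
qed

theorem theorem1p4:
  fixes k :: nat and t b :: "nat \<Rightarrow> nat"
  assumes "k \<ge> 1"
    and "\<forall>n. t n \<le> n choose 2"
  shows
    "(is_omega (\<lambda>n. real (t n)) (\<lambda>n. real n powr ((4 * real k - 1) / (3 * real k))) \<and>
      is_omega (\<lambda>n. real (b n)) (\<lambda>n. b_star n (t n) k)
      \<longrightarrow> (\<exists>B :: nat \<Rightarrow> strategy.
            (\<forall>n. tb_strategy n (t n) (b n) (B n)) \<and>
            (\<lambda>n. prob_contains (triangle_fan k) n (t n) (B n)) \<longlonglongrightarrow> 1)) \<and>
     (is_little_o (\<lambda>n. real (t n)) (\<lambda>n. real n powr ((4 * real k - 1) / (3 * real k))) \<or>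
      is_little_o (\<lambda>n. real (b n)) (\<lambda>n. b_star n (t n) k)
      \<longrightarrow> (\<forall>B :: nat \<Rightarrow> strategy.
            (\<forall>n. tb_strategy n (t n) (b n) (B n)) \<longrightarrow>
            (\<lambda>n. prob_contains (triangle_fan k) n (t n) (B n)) \<longlonglongrightarrow> 0))"
  using exists_fan_strategy[OF assms] prob_contains_fan_tendsto_0_few_edges[OF assms]
    prob_contains_fan_tendsto_0_small_budget[OF assms(1)]
  by blast

end
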